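(* Let $S=(S_1,\dots,S_d)$ and $T=(T_1,\dots,T_d)$ be absolutely continuous commuting row contractions which are both cyclic. Let $\Lambda\subset\mathbb B_d$ be an interpolating sequence and let $\kappa$ be a non-negative integer such that $\mathfrak v_\kappa(\Lambda)\subset\mathrm{Ann}(S)=\mathrm{Ann}(T)$. Then $S$ is quasi-similar to $T$.
   Context: $\mathbb B_d$ is the open unit ball of $\mathbb C^d$; $\mathcal M_d$ is the multiplier algebra of the Drury–Arveson space $H^2_d$ (the RKHS on $\mathbb B_d$ with kernel $(1-\langle z,w\rangle)^{-1}$), viewed as multiplication operators on $H^2_d$ with the weak-$*$ topology. A commuting row contraction is a commuting $d$-tuple $T$ on a Hilbert space $\mathfrak H$ with $\sum T_jT_j^*\le I$; it is absolutely continuous if $p\mapsto p(T)$ extends to a weak-$*$ continuous unital homomorphism $\mathcal M_d\to B(\mathfrak H)$, with kernel $\mathrm{Ann}(T)$. $T$ is cyclic if there is $\xi$ with $\{p(T)\xi: p \text{ polynomial}\}$ dense. $\Lambda$ is interpolating if every bounded function on $\Lambda$ is the restriction of an element of $\mathcal M_d$. $\mathfrak v_\kappa(\Lambda)$ is the set of $\psi\in\mathcal M_d$ all of whose partial derivatives of order $\le\kappa$ (including order $0$) vanish at every point of $\Lambda$. $S$ on $\mathfrak K$ and $T$ on $\mathfrak H$ are quasi-similar if there are injective bounded operators $X:\mathfrak H\to\mathfrak K$ and $Y:\mathfrak K\to\mathfrak H$ with dense ranges such that $XT_j=S_jX$ and $YS_j=T_jY$ for $1\le j\le d$. *)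

theory Defs
  imports "HOL-Analysis.Analysis"
begin

class chilbert = ab_group_add +
  fixes cscale :: "complex \<Rightarrow> 'a \<Rightarrow> 'a"
    and cinner :: "'a \<Rightarrow> 'a \<Rightarrow> complex"
  assumes cscale_add_right: "cscale a (x + y) = cscale a x + cscale a y"
    and cscale_add_left: "cscale (a + b) x = cscale a x + cscale b x"
    and cscale_cscale: "cscale a (cscale b x) = cscale (a * b) x"
    and cscale_one: "cscale 1 x = x"
    and cinner_conj: "cinner x y = cnj (cinner y x)"
    and cinner_add_left: "cinner (x + y) z = cinner x z + cinner y z"
    and cinner_cscale_left: "cinner (cscale a x) y = a * cinner x y"
    and cinner_nonneg: "0 \<le> Re (cinner x x)"
    and cinner_eq_zero: "cinner x x = 0 \<longleftrightarrow> x = 0"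
    and cinner_complete:
      "(\<forall>e>0. \<exists>N::nat. \<forall>m\<ge>N. \<forall>n\<ge>N. Re (cinner ((X::nat \<Rightarrow> 'a) m - X n) (X m - X n)) < e)
       \<Longrightarrow> \<exists>L. \<forall>e>0. \<exists>N. \<forall>n\<ge>N. Re (cinner (X n - L) (X n - L)) < e"

definition cnorm :: "'a::chilbert \<Rightarrow> real" where
  "cnorm x = sqrt (Re (cinner x x))"

definition bounded_op :: "('a::chilbert \<Rightarrow> 'b::chilbert) \<Rightarrow> bool" where
  "bounded_op A \<longleftrightarrow> (\<forall>x y. A (x + y) = A x + A y) \<and> (\<forall>c x. A (cscale c x) = cscale c (A x))
     \<and> (\<exists>K. \<forall>x. cnorm (A x) \<le> K * cnorm x)"

definition adj :: "('a::chilbert \<Rightarrow> 'b::chilbert) \<Rightarrow> 'b \<Rightarrow> 'a" where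
  "adj A y = (THE z. \<forall>x. cinner (A x) y = cinner x z)"

text \<open>Commuting row contraction: \<open>\<Sum> T_j T_j^* \<le> I\<close>, i.e.
  \<open>\<langle>\<Sum> T_j T_j^* x, x\<rangle> = \<Sum> \<parallel>T_j^* x\<parallel>^2 \<le> \<parallel>x\<parallel>^2\<close>.
  The dimension is \<open>d = CARD('d)\<close>.\<close>
definition comm_row_contraction :: "('d::finite \<Rightarrow> 'a::chilbert \<Rightarrow> 'a) \<Rightarrow> bool" where
  "comm_row_contraction T \<longleftrightarrow> (\<forall>j. bounded_op (T j)) \<and> (\<forall>i j. T i \<circ> T j = T j \<circ> T i)
     \<and> (\<forall>x. (\<Sum>j\<in>UNIV. (cnorm (adj (T j) x))\<^sup>2) \<le> (cnorm x)\<^sup>2)"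

definition op_wstar :: "('a::chilbert \<Rightarrow> 'a) topology" where
  "op_wstar = topology_generated_by
     {{A. bounded_op A \<and> (\<Sum>n. cinner (A (x n)) (y n)) \<in> U} | x y U.
        summable (\<lambda>n. (cnorm (x n))\<^sup>2) \<and> summable (\<lambda>n. (cnorm (y n))\<^sup>2) \<and> open U}"

definition DA_ball :: "(complex^'d::finite) set" where
  "DA_ball = {z. norm z < 1}"

definition mi_abs :: "('d::finite \<Rightarrow> nat) \<Rightarrow> nat" where
  "mi_abs \<alpha> = (\<Sum>i\<in>UNIV. \<alpha> i)"

definition mi_fact :: "('d::finite \<Rightarrow> nat) \<Rightarrow> real" where
  "mi_fact \<alpha> = (\<Prod>i\<in>UNIV. fact (\<alpha> i))"

text \<open>\<open>\<parallel>z^\<alpha>\<parallel>^2_{H^2_d} = \<alpha>!/|\<alpha>|!\<close>, coming from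
  \<open>(1 - \<langle>z,w\<rangle>)^{-1} = \<Sum>_\<alpha> |\<alpha>|!/\<alpha>! z^\<alpha> conj(w^\<alpha>)\<close>.\<close>
definition DA_weight :: "('d::finite \<Rightarrow> nat) \<Rightarrow> real" where
  "DA_weight \<alpha> = mi_fact \<alpha> / fact (mi_abs \<alpha>)"

definition mono_pow :: "complex^'d::finite \<Rightarrow> ('d \<Rightarrow> nat) \<Rightarrow> complex" where
  "mono_pow z \<alpha> = (\<Prod>i\<in>UNIV. (z $ i) ^ (\<alpha> i))"

definition DA_coeffs :: "(('d::finite \<Rightarrow> nat) \<Rightarrow> complex) set" where
  "DA_coeffs = {c. (\<lambda>\<alpha>. (cmod (c \<alpha>))\<^sup>2 * DA_weight \<alpha>) summable_on UNIV}"

definition DA_series :: "(('d::finite \<Rightarrow> nat) \<Rightarrow> complex) \<Rightarrow> complex^'d \<Rightarrow> complex" where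
  "DA_series c z = (if z \<in> DA_ball then (\<Sum>\<^sub>\<infinity>\<alpha>. c \<alpha> * mono_pow z \<alpha>) else 0)"

text \<open>The Drury--Arveson space \<open>H^2_d\<close> (RKHS with kernel \<open>(1 - \<langle>z,w\<rangle>)^{-1}\<close>).\<close>
definition H2 :: "(complex^'d::finite \<Rightarrow> complex) set" where
  "H2 = DA_series ` DA_coeffs"

definition DA_coeff :: "(complex^'d::finite \<Rightarrow> complex) \<Rightarrow> ('d \<Rightarrow> nat) \<Rightarrow> complex" where
  "DA_coeff f = (SOME c. c \<in> DA_coeffs \<and> DA_series c = f)"

definition DA_inner :: "(complex^'d::finite \<Rightarrow> complex) \<Rightarrow> (complex^'d \<Rightarrow> complex) \<Rightarrow> complex" where
  "DA_inner f g = (\<Sum>\<^sub>\<infinity>\<alpha>. DA_coeff f \<alpha> * cnj (DA_coeff g \<alpha>) * complex_of_real (DA_weight \<alpha>))"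

definition multipliers :: "(complex^'d::finite \<Rightarrow> complex) set" where
  "multipliers = {\<phi>. (\<forall>z. z \<notin> DA_ball \<longrightarrow> \<phi> z = 0) \<and> (\<forall>f\<in>H2. (\<lambda>z. \<phi> z * f z) \<in> H2)}"

text \<open>Weak-* topology of \<open>\<M>_d\<close> viewed as multiplication operators on \<open>H^2_d\<close>
  (the relative weak-* topology of \<open>B(H^2_d)\<close>).\<close>
definition DA_wstar :: "(complex^'d::finite \<Rightarrow> complex) topology" where
  "DA_wstar = topology_generated_by
     {{\<phi>\<in>multipliers. (\<Sum>n. DA_inner (\<lambda>z. \<phi> z * f n z) (g n)) \<in> U} | f g U.
        (\<forall>n. f n \<in> H2 \<and> g n \<in> H2) \<and> summable (\<lambda>n. Re (DA_inner (f n) (f n)))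
        \<and> summable (\<lambda>n. Re (DA_inner (g n) (g n))) \<and> open U}"

definition DA_one :: "complex^'d::finite \<Rightarrow> complex" where
  "DA_one z = (if z \<in> DA_ball then 1 else 0)"

definition DA_coord :: "'d::finite \<Rightarrow> complex^'d \<Rightarrow> complex" where
  "DA_coord j z = (if z \<in> DA_ball then z $ j else 0)"

text \<open>\<open>\<Phi>\<close> is a weak-* continuous unital homomorphism \<open>\<M>_d \<rightarrow> B(H)\<close> extending the
  polynomial calculus \<open>p \<mapsto> p(T)\<close> (equivalently, sending the coordinate functions to \<open>T_j\<close>).\<close>
definition abs_cont_hom ::
  "('d::finite \<Rightarrow> 'a::chilbert \<Rightarrow> 'a) \<Rightarrow> ((complex^'d \<Rightarrow> complex) \<Rightarrow> 'a \<Rightarrow> 'a) \<Rightarrow> bool" where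
  "abs_cont_hom T \<Phi> \<longleftrightarrow>
     (\<forall>\<phi>\<in>multipliers. bounded_op (\<Phi> \<phi>))
   \<and> \<Phi> DA_one = id
   \<and> (\<forall>\<phi>\<in>multipliers. \<forall>\<psi>\<in>multipliers. \<Phi> (\<lambda>z. \<phi> z + \<psi> z) = (\<lambda>x. \<Phi> \<phi> x + \<Phi> \<psi> x))
   \<and> (\<forall>\<phi>\<in>multipliers. \<forall>c. \<Phi> (\<lambda>z. c * \<phi> z) = (\<lambda>x. cscale c (\<Phi> \<phi> x)))
   \<and> (\<forall>\<phi>\<in>multipliers. \<forall>\<psi>\<in>multipliers. \<Phi> (\<lambda>z. \<phi> z * \<psi> z) = \<Phi> \<phi> \<circ> \<Phi> \<psi>)
   \<and> (\<forall>j. \<Phi> (DA_coord j) = T j)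
   \<and> continuous_map DA_wstar op_wstar \<Phi>"

definition absolutely_continuous :: "('d::finite \<Rightarrow> 'a::chilbert \<Rightarrow> 'a) \<Rightarrow> bool" where
  "absolutely_continuous T \<longleftrightarrow> (\<exists>\<Phi>. abs_cont_hom T \<Phi>)"

text \<open>\<open>Ann(T) = ker \<Phi>\<close> where \<open>\<Phi>\<close> is the (unique) weak-* continuous functional calculus.\<close>
definition Ann :: "((complex^'d::finite \<Rightarrow> complex) \<Rightarrow> 'a::chilbert \<Rightarrow> 'a) \<Rightarrow> (complex^'d \<Rightarrow> complex) set" where
  "Ann \<Phi> = {\<phi>\<in>multipliers. \<Phi> \<phi> = (\<lambda>_. 0)}"

text \<open>\<open>{p(T)\<xi> : p polynomial}\<close>.\<close>
inductive_set poly_orbit :: "('d \<Rightarrow> 'a::chilbert \<Rightarrow> 'a) \<Rightarrow> 'a \<Rightarrow> 'a set" for T \<xi> where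
  base: "\<xi> \<in> poly_orbit T \<xi>"
| apply_T: "x \<in> poly_orbit T \<xi> \<Longrightarrow> T j x \<in> poly_orbit T \<xi>"
| add: "x \<in> poly_orbit T \<xi> \<Longrightarrow> y \<in> poly_orbit T \<xi> \<Longrightarrow> x + y \<in> poly_orbit T \<xi>"
| scale: "x \<in> poly_orbit T \<xi> \<Longrightarrow> cscale c x \<in> poly_orbit T \<xi>"

definition cdense :: "'a::chilbert set \<Rightarrow> bool" where
  "cdense A \<longleftrightarrow> (\<forall>y. \<forall>e>0. \<exists>x\<in>A. cnorm (x - y) < e)"

definition cyclic_tuple :: "('d \<Rightarrow> 'a::chilbert \<Rightarrow> 'a) \<Rightarrow> bool" where
  "cyclic_tuple T \<longleftrightarrow> (\<exists>\<xi>. cdense (poly_orbit T \<xi>))"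

definition quasi_similar :: "('d \<Rightarrow> 'k::chilbert \<Rightarrow> 'k) \<Rightarrow> ('d \<Rightarrow> 'h::chilbert \<Rightarrow> 'h) \<Rightarrow> bool" where
  "quasi_similar S T \<longleftrightarrow> (\<exists>(X::'h \<Rightarrow> 'k) (Y::'k \<Rightarrow> 'h).
      bounded_op X \<and> inj X \<and> cdense (range X) \<and>
      bounded_op Y \<and> inj Y \<and> cdense (range Y) \<and>
      (\<forall>j. X \<circ> T j = S j \<circ> X) \<and> (\<forall>j. Y \<circ> S j = T j \<circ> Y))"

definition interpolating :: "(complex^'d::finite) set \<Rightarrow> bool" where
  "interpolating \<Lambda> \<longleftrightarrow> \<Lambda> \<subseteq> DA_ball \<and> countable \<Lambda> \<and>
     (\<forall>h::complex^'d \<Rightarrow> complex. (\<exists>B. \<forall>p\<in>\<Lambda>. cmod (h p) \<le> B) \<longrightarrow>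
        (\<exists>\<phi>\<in>multipliers. \<forall>p\<in>\<Lambda>. \<phi> p = h p))"

definition cpartial :: "'d::finite \<Rightarrow> (complex^'d \<Rightarrow> complex) \<Rightarrow> complex^'d \<Rightarrow> complex" where
  "cpartial j f z = deriv (\<lambda>t. f (z + t *s axis j 1)) 0"

fun derivs_upto :: "nat \<Rightarrow> (complex^'d::finite \<Rightarrow> complex) \<Rightarrow> (complex^'d \<Rightarrow> complex) set" where
  "derivs_upto 0 f = {f}"
| "derivs_upto (Suc k) f = derivs_upto k f \<union> {cpartial j g | j g. g \<in> derivs_upto k f}"

definition vanish_ideal :: "nat \<Rightarrow> (complex^'d::finite) set \<Rightarrow> (complex^'d \<Rightarrow> complex) set" where
  "vanish_ideal \<kappa> \<Lambda> = {\<psi>\<in>multipliers. \<forall>g\<in>derivs_upto \<kappa> \<psi>. \<forall>p\<in>\<Lambda>. g p = 0}"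

end

theory Submission
  imports Defs "HOL-Complex_Analysis.Complex_Analysis"
begin

text \<open>
  Let \<open>N = \<kappa> + 1\<close>. Applying the polynomial \<open>1 - (1 - x^N)^N\<close> to a multiplier that interpolates the
  indicator of a subset \<open>A\<close> of \<open>\<Lambda>\<close> gives a multiplier which is idempotent modulo
  \<open>v_\<kappa>(\<Lambda>)\<close>, so \<open>\<Phi>\<close> turns it into an idempotent \<open>P_A\<close> commuting with the tuple.
  This finitely additive family is countably additive: by the closed graph theorem every multiplier is
  bounded, by Baire's theorem on the Cantor space of subsets of \<open>\<Lambda>\<close> the interpolation is uniformly
  bounded on a cylinder, and bounded pointwise convergence of multipliers is weak-* convergence.
  Hence the ranges of the idempotents \<open>E_p\<close> at the points \<open>p\<close> of \<open>\<Lambda>\<close> span a dense subspace,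
  and \<open>E_p x = 0\<close> for all \<open>p\<close> forces \<open>x = 0\<close>.

  The product of \<open>E_p\<close> with any \<open>N\<close> factors \<open>T_j - p_j\<close> is zero, so the range of \<open>E_p\<close> is
  finite-dimensional and consists of the vectors \<open>\<Phi>(f e_p)\<xi>\<close>, for a cyclic vector \<open>\<xi>\<close> and multipliers
  \<open>f\<close>. Since \<open>\<Phi>(g)\<xi> = 0\<close> means \<open>g \<in> Ann\<close>, equality of the annihilators makes
  \<open>\<Phi>\<^sub>T(f e_p)\<xi> \<mapsto> \<Phi>\<^sub>S(f e_p)\<eta>\<close> a well-defined bijection of the ranges at \<open>p\<close>. A weighted
  norm-convergent sum of these bijections over \<open>\<Lambda>\<close> is an injective intertwiner with dense range;
  exchanging \<open>S\<close> and \<open>T\<close> gives the other one.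
\<close>

section \<open>Multivariate power series\<close>

text \<open>The hypothesis \<open>interpolating\<close> supplies one interpolant per bounded
  function and no common bound, while limits of multipliers are accessible only along bounded
  sequences. This is the obstacle to countable additivity. The bound from Baire's theorem holds only
  for subsets with a prescribed initial part, which is enough because finitely many points can be
  split off by finite additivity. The equality of the annihilators is used in both directions: one
  inclusion makes the map between the ranges at a point well defined, the other makes it injective.
  The bijections between the ranges need not be uniformly bounded over \<open>\<Lambda>\<close>,
  hence the weights. When infinitely many of the idempotents are non-zero, the decay of the weights
  rules out a bounded inverse of the sum; so the second intertwiner is built separately, and the
  conclusion is quasi-similarity instead of similarity.\<close>

definition ps_conv :: "(('d::finite \<Rightarrow> nat) \<Rightarrow> complex) \<Rightarrow> bool" where
  "ps_conv c \<longleftrightarrow> (\<forall>z\<in>DA_ball. (\<lambda>\<alpha>. c \<alpha> * mono_pow z \<alpha>) summable_on UNIV)"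

definition mi_inc :: "'d \<Rightarrow> ('d \<Rightarrow> nat) \<Rightarrow> 'd \<Rightarrow> nat" where
  "mi_inc j \<alpha> = \<alpha>(j := Suc (\<alpha> j))"

definition ps_deriv :: "'d \<Rightarrow> (('d \<Rightarrow> nat) \<Rightarrow> complex) \<Rightarrow> ('d \<Rightarrow> nat) \<Rightarrow> complex" where
  "ps_deriv j c \<alpha> = of_nat (Suc (\<alpha> j)) * c (mi_inc j \<alpha>)"

lemma inj_mi_inc: "inj (mi_inc j)"
  unfolding mi_inc_def inj_def by (metis fun_upd_eqD fun_upd_triv fun_upd_upd nat.inject)

lemma range_mi_inc: "range (mi_inc j) = {\<alpha>. \<alpha> j \<noteq> 0}"
proof -
  have "\<alpha> \<in> range (mi_inc j)" if "\<alpha> j \<noteq> 0" for \<alpha>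
  proof -
    have "\<alpha> = mi_inc j (\<alpha>(j := \<alpha> j - 1))" using that by (auto simp: mi_inc_def)
    then show ?thesis by blast
  qed
  then show ?thesis by (auto simp: mi_inc_def)
qed

lemma mono_pow_split: "mono_pow z \<alpha> = (z $ j) ^ \<alpha> j * (\<Prod>i\<in>UNIV-{j}. (z $ i) ^ \<alpha> i)"
  unfolding mono_pow_def by (subst prod.remove[of _ j]) auto

lemma mono_pow_inc: "mono_pow z (mi_inc j \<alpha>) = z $ j * mono_pow z \<alpha>"
proof -
  have "(\<Prod>i\<in>UNIV-{j}. (z $ i) ^ mi_inc j \<alpha> i) = (\<Prod>i\<in>UNIV-{j}. (z $ i) ^ \<alpha> i)"
    by (rule prod.cong) (auto simp: mi_inc_def)
  then show ?thesis by (simp add: mono_pow_split[of _ _ j] mi_inc_def)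
qed

lemma norm_mono_pow: "norm (mono_pow z \<alpha>) = (\<Prod>i\<in>UNIV. norm (z $ i) ^ \<alpha> i)"
  by (simp add: mono_pow_def prod_norm[symmetric] norm_power)

lemma mono_pow_0: "mono_pow 0 \<alpha> = (if \<alpha> = (\<lambda>_. 0) then 1 else 0)"
proof (cases "\<alpha> = (\<lambda>_. 0)")
  case False
  then obtain i where "\<alpha> i \<noteq> 0" by auto
  then show ?thesis using False by (auto simp: mono_pow_def intro!: prod_zero)
qed (simp add: mono_pow_def)

lemma DA_series_at: "z \<in> DA_ball \<Longrightarrow> DA_series c z = (\<Sum>\<^sub>\<infinity>\<alpha>. c \<alpha> * mono_pow z \<alpha>)"
  by (simp add: DA_series_def)

lemma norm_axis_complex: "norm (axis j t :: complex^'d::finite) = norm t"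
proof -
  have "(\<Sum>i\<in>UNIV. (norm ((axis j t :: complex^'d) $ i))\<^sup>2) = (\<Sum>i\<in>UNIV. if i = j then (norm t)\<^sup>2 else 0)"
    by (rule sum.cong) (auto simp: axis_def)
  then show ?thesis by (simp add: norm_vec_def L2_set_def)
qed

lemma coordinate_ball:
  assumes "z \<in> DA_ball" "norm z + norm t < 1"
  shows "z + t *s axis j 1 \<in> DA_ball"
proof -
  have "norm (t *s axis j (1::complex)) = norm t"
  proof -
    have "t *s axis j (1::complex) = axis j t" by (auto simp: vec_eq_iff axis_def)
    then show ?thesis by (simp add: norm_axis_complex)
  qed
  then show ?thesis using norm_triangle_ineq[of z "t *s axis j 1"] assms by (auto simp: DA_ball_def)
qed

text \<open>Along a coordinate line the finite partial sums are polynomials in \<open>t\<close> that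
  converge uniformly near 0, so their derivatives converge to the derivative of the limit.\<close>

lemma ps_termwise_deriv:
  fixes c :: "('d::finite \<Rightarrow> nat) \<Rightarrow> complex"
  assumes c: "ps_conv c" and z: "z \<in> DA_ball"
  shows "((\<lambda>t. DA_series c (z + t *s axis j 1)) has_field_derivative DA_series (ps_deriv j c) z) (at 0)"
    and "(\<lambda>\<alpha>. ps_deriv j c \<alpha> * mono_pow z \<alpha>) summable_on UNIV"
proof -
  define r where "r = (1 - norm z) / 2"
  have r: "0 < r" "norm z + r < 1" using z by (auto simp: r_def DA_ball_def field_simps)
  define R where "R \<alpha> = (\<Prod>i\<in>UNIV-{j}. (z $ i) ^ \<alpha> i)" for \<alpha> :: "'d \<Rightarrow> nat"
  define f where "f F t = (\<Sum>\<alpha>\<in>F. c \<alpha> * ((z $ j + t) ^ \<alpha> j * R \<alpha>))" for F t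
  define f' where "f' F t = (\<Sum>\<alpha>\<in>F. c \<alpha> * (of_nat (\<alpha> j) * (z $ j + t) ^ (\<alpha> j - 1) * R \<alpha>))" for F t
  have mp: "mono_pow (z + t *s axis j 1) \<alpha> = (z $ j + t) ^ \<alpha> j * R \<alpha>" for t \<alpha>
  proof -
    have "(\<Prod>i\<in>UNIV-{j}. ((z + t *s axis j 1) $ i) ^ \<alpha> i) = R \<alpha>"
      unfolding R_def by (rule prod.cong) (auto simp: axis_def)
    then show ?thesis by (simp add: mono_pow_split[of _ _ j])
  qed
  have inb: "z + t *s axis j 1 \<in> DA_ball" if "t \<in> cball 0 r" for t
    using coordinate_ball[OF z] that r by auto
  \<comment> \<open>For \<open>t\<close> in \<open>cball 0 r\<close> the coordinates of
    \<open>z'\<close> dominate those of \<open>z + t *s axis j 1\<close> in modulus, and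
    \<open>z'\<close> is still in the ball. Absolute convergence at \<open>z'\<close> is the
    majorant for the M-test.\<close>
  define z' :: "complex^'d" where "z' = (\<chi> i. of_real (norm (z $ i) + (if i = j then r else 0)))"
  have z': "z' \<in> DA_ball"
  proof -
    have "z' = (\<chi> i. of_real (norm (z $ i))) + axis j (of_real r)"
      by (auto simp: z'_def vec_eq_iff axis_def)
    then have "norm z' \<le> norm ((\<chi> i. of_real (norm (z $ i))) :: complex^'d) + r"
      using norm_triangle_ineq[of "\<chi> i. complex_of_real (norm (z $ i))" "axis j (complex_of_real r)"] r by (simp add: norm_axis_complex)
    also have "norm ((\<chi> i. of_real (norm (z $ i))) :: complex^'d) = norm z"
      by (simp add: norm_vec_def)
    finally show ?thesis using r by (simp add: DA_ball_def)
  qed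
  have bnd: "norm (c \<alpha> * ((z $ j + t) ^ \<alpha> j * R \<alpha>)) \<le> norm (c \<alpha> * mono_pow z' \<alpha>)" if "t \<in> cball 0 r" for \<alpha> t
  proof -
    have "norm ((z $ j + t) ^ \<alpha> j * R \<alpha>) = norm (mono_pow (z + t *s axis j 1) \<alpha>)" by (simp add: mp)
    also have "\<dots> \<le> norm (mono_pow z' \<alpha>)" unfolding norm_mono_pow
    proof (intro prod_mono conjI power_mono)
      fix i
      have "norm (z $ j + t) \<le> norm (z $ j) + r" using norm_triangle_ineq[of "z $ j" t] that by simp
      then show "norm ((z + t *s axis j 1) $ i) \<le> norm (z' $ i)" using r
        by (auto simp: z'_def axis_def simp del: of_real_add)
    qed auto
    finally show ?thesis by (simp add: norm_mult mult_left_mono)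
  qed
  have sm: "(\<lambda>\<alpha>. norm (c \<alpha> * mono_pow z' \<alpha>)) summable_on UNIV"
    using c z' by (auto simp: ps_conv_def summable_on_iff_abs_summable_on_complex)
  have ul: "uniform_limit (cball 0 r) f (\<lambda>t. \<Sum>\<^sub>\<infinity>\<alpha>. c \<alpha> * ((z $ j + t) ^ \<alpha> j * R \<alpha>)) (finite_subsets_at_top UNIV)"
    unfolding f_def by (rule Weierstrass_m_test_general[OF _ sm]) (use bnd in auto)
  have ul: "uniform_limit (cball 0 r) f (\<lambda>t. DA_series c (z + t *s axis j 1)) (finite_subsets_at_top UNIV)"
    by (rule uniform_limit_cong'[THEN iffD1, OF _ _ ul]) (auto simp: DA_series_at inb mp)
  have d: "(f F has_field_derivative f' F w) (at w)" for F w
    unfolding f_def f'_def by (auto intro!: derivative_eq_intros sum.cong)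
  have ev: "\<forall>\<^sub>F F in finite_subsets_at_top UNIV. continuous_on (cball 0 r) (f F) \<and>
       (\<forall>w\<in>ball 0 r. (f F has_field_derivative f' F w) (at w))"
    by (rule always_eventually) (auto intro!: continuous_intros d simp: f_def)
  obtain g' where g': "\<And>w. w \<in> ball 0 r \<Longrightarrow> ((\<lambda>t. DA_series c (z + t *s axis j 1)) has_field_derivative g' w) (at w) \<and>
      ((\<lambda>F. f' F w) \<longlongrightarrow> g' w) (finite_subsets_at_top UNIV)"
    using has_complex_derivative_uniform_limit[OF ev ul] r by auto
  have g0: "((\<lambda>t. DA_series c (z + t *s axis j 1)) has_field_derivative g' 0) (at 0)"
     "((\<lambda>F. f' F 0) \<longlongrightarrow> g' 0) (finite_subsets_at_top UNIV)" using g'[of 0] r by auto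
  define h where "h \<alpha> = c \<alpha> * (of_nat (\<alpha> j) * (z $ j) ^ (\<alpha> j - 1) * R \<alpha>)" for \<alpha>
  have "(h has_sum g' 0) UNIV"
    using g0(2) by (simp add: has_sum_def h_def[abs_def] f'_def)
  \<comment> \<open>Terms with \<open>\<alpha> j = 0\<close> carry the factor 0, which also makes
    the truncated exponent \<open>\<alpha> j - 1\<close> harmless. The remaining ones are reindexed
    by \<open>mi_inc j\<close>.\<close>
  then have "(h has_sum g' 0) (range (mi_inc j))"
    by (subst has_sum_cong_neutral[of "UNIV" _ h h]) (auto simp: range_mi_inc h_def)
  then have "((h \<circ> mi_inc j) has_sum g' 0) UNIV"
    by (simp only: has_sum_reindex[OF inj_mi_inc])
  moreover have "h \<circ> mi_inc j = (\<lambda>\<alpha>. ps_deriv j c \<alpha> * mono_pow z \<alpha>)"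
  proof
    fix \<alpha>
    have "R (mi_inc j \<alpha>) = R \<alpha>" unfolding R_def by (rule prod.cong) (auto simp: mi_inc_def)
    then show "(h \<circ> mi_inc j) \<alpha> = ps_deriv j c \<alpha> * mono_pow z \<alpha>"
      by (simp add: h_def mono_pow_split[of _ _ j] ps_deriv_def R_def) (simp add: mi_inc_def)
  qed
  ultimately have hs: "((\<lambda>\<alpha>. ps_deriv j c \<alpha> * mono_pow z \<alpha>) has_sum g' 0) UNIV" by simp
  then show "(\<lambda>\<alpha>. ps_deriv j c \<alpha> * mono_pow z \<alpha>) summable_on UNIV" by (auto simp: summable_on_def)
  show "((\<lambda>t. DA_series c (z + t *s axis j 1)) has_field_derivative DA_series (ps_deriv j c) z) (at 0)"
    using g0(1) hs z by (simp add: DA_series_at infsumI)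
qed

text \<open>Square-summability as in \<open>DA_coeffs\<close> is lost under differentiation. This
  weaker class is stable, so inductions on the order of a derivative run inside it.\<close>

lemma ps_conv_deriv: "ps_conv c \<Longrightarrow> ps_conv (ps_deriv j c)"
  using ps_termwise_deriv(2) by (auto simp: ps_conv_def)

text \<open>The value at 0 gives the constant coefficient. For the others, the derivative in a
  direction \<open>j\<close> also vanishes on the ball, and its coefficients of lower degree are
  non-zero multiples of those of \<open>c\<close>.\<close>

lemma ps_coeff_zero:
  fixes c :: "('d::finite \<Rightarrow> nat) \<Rightarrow> complex"
  assumes "ps_conv c" "\<And>z. z \<in> DA_ball \<Longrightarrow> DA_series c z = 0"
  shows "c \<alpha> = 0"
  using assms
proof (induction "mi_abs \<alpha>" arbitrary: \<alpha> c)
  case 0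
  then have a: "\<alpha> = (\<lambda>_. 0)" by (auto simp: mi_abs_def)
  have "(\<Sum>\<^sub>\<infinity>\<beta>. c \<beta> * mono_pow 0 \<beta>) = (\<Sum>\<^sub>\<infinity>\<beta>\<in>{\<lambda>_. 0}. c \<beta> * mono_pow 0 \<beta>)"
    by (rule infsum_cong_neutral) (auto simp: mono_pow_0)
  also have "\<dots> = c \<alpha>" by (simp add: a mono_pow_0)
  finally show ?case using 0(3)[of 0] by (simp add: DA_series_at DA_ball_def)
next
  case (Suc n)
  then obtain j where j: "\<alpha> j \<noteq> 0" by (fastforce simp: mi_abs_def)
  then obtain \<beta> where b: "\<alpha> = mi_inc j \<beta>" using range_mi_inc[of j] by blast
  have "mi_abs (mi_inc j \<beta>) = Suc (mi_abs \<beta>)"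
    by (simp add: mi_abs_def mi_inc_def sum.remove[of _ j])
  then have n: "n = mi_abs \<beta>" using Suc(2) b by simp
  have "DA_series (ps_deriv j c) z = 0" if z: "z \<in> DA_ball" for z
  proof -
    have "((\<lambda>t. DA_series c (z + t *s axis j 1)) has_field_derivative 0) (at 0)"
    proof (rule has_field_derivative_transform_within[of "\<lambda>_. 0" _ _ _ "1 - norm z"])
      show "0 < 1 - norm z" using z by (simp add: DA_ball_def)
      fix t :: complex assume "dist t 0 < 1 - norm z"
      then show "0 = DA_series c (z + t *s axis j 1)" using coordinate_ball[OF z] Suc by simp
    qed auto
    then show ?thesis using ps_termwise_deriv(1)[OF Suc(3) z] DERIV_unique by blast
  qed
  then have "ps_deriv j c \<beta> = 0" using Suc(1)[OF n ps_conv_deriv[OF Suc(3)]] by blast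
  then show ?case by (simp only: ps_deriv_def b mult_eq_0_iff of_nat_eq_0_iff) auto
qed

section \<open>The Drury--Arveson space\<close>

lemma mi_abs_inc: "mi_abs (mi_inc j \<beta>) = Suc (mi_abs \<beta>)"
  by (simp add: mi_abs_def mi_inc_def sum.remove[of _ j])

lemma mi_fact_inc: "mi_fact (mi_inc j \<beta>) = real (Suc (\<beta> j)) * mi_fact \<beta>"
proof -
  have "(\<Prod>i\<in>UNIV-{j}. fact (mi_inc j \<beta> i)) = (\<Prod>i\<in>UNIV-{j}. fact (\<beta> i) :: real)"
    by (rule prod.cong) (auto simp: mi_inc_def)
  then show ?thesis
    by (simp add: mi_fact_def prod.remove[of _ j] del: of_nat_Suc) (simp add: mi_inc_def)
qed

lemma DA_weight_pos: "DA_weight \<alpha> > 0"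
  by (auto simp: DA_weight_def mi_fact_def intro!: divide_pos_pos prod_pos)

lemma DA_weight_inc: "DA_weight (mi_inc j \<beta>) = DA_weight \<beta> * real (Suc (\<beta> j)) / real (Suc (mi_abs \<beta>))"
  by (simp add: DA_weight_def mi_abs_inc mi_fact_inc mult.commute)

lemma le_mi_abs: "\<alpha> i \<le> mi_abs \<alpha>"
  unfolding mi_abs_def by (rule member_le_sum) auto

lemma finite_mi_abs: "finite {\<alpha>::'d::finite \<Rightarrow> nat. mi_abs \<alpha> = n}"
proof (rule finite_subset)
  show "{\<alpha>::'d \<Rightarrow> nat. mi_abs \<alpha> = n} \<subseteq> Pi\<^sub>E UNIV (\<lambda>_. {..n})" using le_mi_abs by auto
qed (intro finite_PiE, auto)

text \<open>This is the multinomial theorem, since \<open>1 / DA_weight \<alpha>\<close> is the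
  multinomial coefficient. The induction step multiplies each term by
  \<open>(\<Sum>j\<in>UNIV. \<alpha> j) / Suc n = 1\<close>, and the factor
  \<open>\<alpha> j\<close> then cancels against the recursion of the weight along
  \<open>mi_inc j\<close>.\<close>

lemma multinomial_sum:
  fixes x :: "'d::finite \<Rightarrow> real"
  defines "u \<equiv> \<lambda>\<alpha>. (\<Prod>i\<in>UNIV. x i ^ \<alpha> i) / DA_weight \<alpha>"
  shows "(\<Sum>\<alpha> | mi_abs \<alpha> = n. u \<alpha>) = (\<Sum>i\<in>UNIV. x i) ^ n"
proof (induction n)
  case 0
  have "{\<alpha>::'d \<Rightarrow> nat. mi_abs \<alpha> = 0} = {\<lambda>_. 0}" by (auto simp: mi_abs_def)
  then show ?case by (simp add: u_def DA_weight_def mi_fact_def mi_abs_def)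
next
  case (Suc n)
  have u: "u (mi_inc j \<beta>) * real (Suc (\<beta> j)) / real (Suc n) = x j * u \<beta>" if "mi_abs \<beta> = n" for j \<beta>
  proof -
    have "(\<Prod>i\<in>UNIV-{j}. x i ^ mi_inc j \<beta> i) = (\<Prod>i\<in>UNIV-{j}. x i ^ \<beta> i)"
      by (rule prod.cong) (auto simp: mi_inc_def)
    then have "(\<Prod>i\<in>UNIV. x i ^ mi_inc j \<beta> i) = x j * (\<Prod>i\<in>UNIV. x i ^ \<beta> i)"
      by (simp add: prod.remove[of _ j]) (simp add: mi_inc_def)
    then show ?thesis using DA_weight_pos[of \<beta>] by (simp add: u_def DA_weight_inc that del: of_nat_Suc)
  qed
  have "(\<Sum>\<alpha> | mi_abs \<alpha> = Suc n. u \<alpha>) = (\<Sum>\<alpha> | mi_abs \<alpha> = Suc n. \<Sum>j\<in>UNIV. u \<alpha> * real (\<alpha> j) / real (Suc n))"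
  proof (rule sum.cong)
    fix \<alpha> :: "'d \<Rightarrow> nat" assume "\<alpha> \<in> {\<alpha>. mi_abs \<alpha> = Suc n}"
    then have "(\<Sum>j\<in>UNIV. real (\<alpha> j)) = real (Suc n)" by (simp add: mi_abs_def flip: of_nat_sum)
    then have "(\<Sum>j\<in>UNIV. u \<alpha> * real (\<alpha> j) / real (Suc n)) = u \<alpha> * real (Suc n) / real (Suc n)"
      by (simp add: sum_divide_distrib[symmetric] sum_distrib_left[symmetric] del: of_nat_Suc)
    then show "u \<alpha> = (\<Sum>j\<in>UNIV. u \<alpha> * real (\<alpha> j) / real (Suc n))" by simp
  qed simp
  also have "\<dots> = (\<Sum>j\<in>UNIV. \<Sum>\<alpha> | mi_abs \<alpha> = Suc n. u \<alpha> * real (\<alpha> j) / real (Suc n))"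
    by (rule sum.swap)
  also have "\<dots> = (\<Sum>j\<in>UNIV. \<Sum>\<beta> | mi_abs \<beta> = n. x j * u \<beta>)"
  proof (rule sum.cong)
    fix j :: 'd
    have "(\<Sum>\<alpha> | mi_abs \<alpha> = Suc n. u \<alpha> * real (\<alpha> j) / real (Suc n))
        = (\<Sum>\<alpha> \<in> mi_inc j ` {\<beta>. mi_abs \<beta> = n}. u \<alpha> * real (\<alpha> j) / real (Suc n))"
    proof (rule sum.mono_neutral_right)
      have "\<alpha> j = 0" if "mi_abs \<alpha> = Suc n" "\<alpha> \<notin> mi_inc j ` {\<beta>. mi_abs \<beta> = n}" for \<alpha>
      proof (rule ccontr)
        assume "\<alpha> j \<noteq> 0"
        then obtain \<beta> where "\<alpha> = mi_inc j \<beta>" using range_mi_inc[of j] by blast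
        then show False using that by (auto simp: mi_abs_inc)
      qed
      then show "\<forall>\<alpha>\<in>{\<alpha>. mi_abs \<alpha> = Suc n} - mi_inc j ` {\<beta>. mi_abs \<beta> = n}. u \<alpha> * real (\<alpha> j) / real (Suc n) = 0"
        by auto
    qed (auto simp: finite_mi_abs mi_abs_inc)
    also have "\<dots> = (\<Sum>\<beta> | mi_abs \<beta> = n. u (mi_inc j \<beta>) * real (mi_inc j \<beta> j) / real (Suc n))"
      by (subst sum.reindex) (auto intro: inj_on_subset[OF inj_mi_inc])
    also have "\<dots> = (\<Sum>\<beta> | mi_abs \<beta> = n. x j * u \<beta>)"
    proof (rule sum.cong)
      fix \<beta> :: "'d \<Rightarrow> nat" assume "\<beta> \<in> {\<beta>. mi_abs \<beta> = n}"
      then show "u (mi_inc j \<beta>) * real (mi_inc j \<beta> j) / real (Suc n) = x j * u \<beta>"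
        using u[of \<beta> j] by (simp add: mi_inc_def)
    qed simp
    finally show "(\<Sum>\<alpha> | mi_abs \<alpha> = Suc n. u \<alpha> * real (\<alpha> j) / real (Suc n)) = (\<Sum>\<beta> | mi_abs \<beta> = n. x j * u \<beta>)" .
  qed simp
  also have "\<dots> = (\<Sum>i\<in>UNIV. x i) ^ Suc n"
    by (simp add: sum_distrib_left[symmetric] Suc sum_distrib_right[symmetric])
  finally show ?case .
qed

section \<open>Duality of weighted square-summable coefficient families\<close>

definition coeff_bound :: "real \<Rightarrow> (('d::finite \<Rightarrow> nat) \<Rightarrow> complex) \<Rightarrow> bool" where
  "coeff_bound M c \<longleftrightarrow> (\<forall>F. finite F \<longrightarrow> L2_set (\<lambda>\<alpha>. cmod (c \<alpha>) * sqrt (DA_weight \<alpha>)) F \<le> M)"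

text \<open>This is the norm dual to that of \<open>coeff_bound\<close> for the bilinear pairing of
  families. Point evaluations and inner products with a fixed function are both such pairings. Both
  bounds quantify over finite sets, so they pass to coefficientwise limits without any summability
  argument.\<close>

definition dual_bound :: "real \<Rightarrow> (('d::finite \<Rightarrow> nat) \<Rightarrow> complex) \<Rightarrow> bool" where
  "dual_bound N e \<longleftrightarrow> (\<forall>F. finite F \<longrightarrow> L2_set (\<lambda>\<alpha>. cmod (e \<alpha>) / sqrt (DA_weight \<alpha>)) F \<le> N)"

lemma coeff_bound_nonneg: "coeff_bound M c \<Longrightarrow> 0 \<le> M"
  unfolding coeff_bound_def by (metis L2_set_empty finite.emptyI)

lemma dual_bound_nonneg: "dual_bound M c \<Longrightarrow> 0 \<le> M"
  unfolding dual_bound_def by (metis L2_set_empty finite.emptyI)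

lemma pairing_finite:
  assumes "coeff_bound M c" "dual_bound N e" "finite F"
  shows "(\<Sum>\<alpha>\<in>F. cmod (c \<alpha> * e \<alpha>)) \<le> M * N"
proof -
  have "(\<Sum>\<alpha>\<in>F. cmod (c \<alpha> * e \<alpha>)) =
     (\<Sum>\<alpha>\<in>F. \<bar>cmod (c \<alpha>) * sqrt (DA_weight \<alpha>)\<bar> * \<bar>cmod (e \<alpha>) / sqrt (DA_weight \<alpha>)\<bar>)"
    using less_imp_neq[OF DA_weight_pos, symmetric]
    by (intro sum.cong) (auto simp: norm_mult abs_mult)
  also have "\<dots> \<le> L2_set (\<lambda>\<alpha>. cmod (c \<alpha>) * sqrt (DA_weight \<alpha>)) F * L2_set (\<lambda>\<alpha>. cmod (e \<alpha>) / sqrt (DA_weight \<alpha>)) F"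
    by (rule L2_set_mult_ineq)
  also have "\<dots> \<le> M * N"
    using assms by (intro mult_mono) (auto simp: coeff_bound_def dual_bound_def intro: order_trans[OF L2_set_nonneg])
  finally show ?thesis .
qed

lemma pairing_abs_summable:
  assumes "coeff_bound M c" "dual_bound N e"
  shows "(\<lambda>\<alpha>. cmod (c \<alpha> * e \<alpha>)) summable_on UNIV"
  by (rule nonneg_bdd_above_summable_on) (use pairing_finite[OF assms] in \<open>auto simp: bdd_above_def\<close>)

lemma pairing_summable:
  assumes "coeff_bound M c" "dual_bound N e"
  shows "(\<lambda>\<alpha>. c \<alpha> * e \<alpha>) summable_on UNIV"
  using pairing_abs_summable[OF assms] by (rule abs_summable_summable)

lemma pairing_le:
  assumes "coeff_bound M c" "dual_bound N e"
  shows "cmod (\<Sum>\<^sub>\<infinity>\<alpha>. c \<alpha> * e \<alpha>) \<le> M * N"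
proof -
  have "cmod (\<Sum>\<^sub>\<infinity>\<alpha>. c \<alpha> * e \<alpha>) \<le> (\<Sum>\<^sub>\<infinity>\<alpha>. cmod (c \<alpha> * e \<alpha>))"
    using pairing_abs_summable[OF assms] by (rule norm_infsum_bound)
  also have "\<dots> \<le> M * N"
    by (rule infsum_le_finite_sums) (use pairing_abs_summable[OF assms] pairing_finite[OF assms] in auto)
  finally show ?thesis .
qed

text \<open>The finite sums of squares are bounded, and a finite \<open>F\<close> whose sum is
  within \<open>\<epsilon>\<^sup>2\<close> of their supremum leaves at most
  \<open>\<epsilon>\<^sup>2\<close> for anything disjoint from it.\<close>

lemma dual_bound_tail:
  assumes e: "dual_bound N e" and "\<epsilon> > 0"
  shows "\<exists>F. finite F \<and> dual_bound \<epsilon> (\<lambda>\<alpha>. if \<alpha> \<in> F then 0 else e \<alpha>)"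
proof -
  define g where "g \<alpha> = (cmod (e \<alpha>) / sqrt (DA_weight \<alpha>))\<^sup>2" for \<alpha>
  have gF: "sum g F \<le> N\<^sup>2" if "finite F" for F
  proof -
    have "L2_set (\<lambda>\<alpha>. cmod (e \<alpha>) / sqrt (DA_weight \<alpha>)) F \<le> N" using e that by (simp add: dual_bound_def)
    then have "sqrt (sum g F) \<le> N" unfolding L2_set_def g_def .
    then show ?thesis by (rule sqrt_le_D)
  qed
  define s where "s = Sup (sum g ` {F. finite F})"
  have bd: "bdd_above (sum g ` {F. finite F})" using gF by (auto simp: bdd_above_def)
  have "\<exists>y\<in>sum g ` {F. finite F}. s - \<epsilon>\<^sup>2 < y"
    unfolding s_def by (rule less_cSupD) (use \<open>\<epsilon> > 0\<close> in auto)
  then obtain F where F: "finite F" "s - \<epsilon>\<^sup>2 < sum g F" by auto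
  have "L2_set (\<lambda>\<alpha>. cmod (if \<alpha> \<in> F then 0 else e \<alpha>) / sqrt (DA_weight \<alpha>)) G \<le> \<epsilon>" if G: "finite G" for G
  proof -
    have "(\<Sum>\<alpha>\<in>G. (cmod (if \<alpha> \<in> F then 0 else e \<alpha>) / sqrt (DA_weight \<alpha>))\<^sup>2) = (\<Sum>\<alpha>\<in>G - F. g \<alpha>)"
      using G by (intro sum.mono_neutral_cong_right) (auto simp: g_def)
    also have "\<dots> = sum g (F \<union> G) - sum g F"
      using sum.union_disjoint[of F "G - F" g] F G by (simp add: Un_Diff_cancel)
    also have "sum g (F \<union> G) \<le> s" unfolding s_def by (rule cSup_upper) (use F G bd in auto)
    finally have "(\<Sum>\<alpha>\<in>G. (cmod (if \<alpha> \<in> F then 0 else e \<alpha>) / sqrt (DA_weight \<alpha>))\<^sup>2) \<le> \<epsilon>\<^sup>2" using F by simp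
    then show ?thesis unfolding L2_set_def using \<open>\<epsilon> > 0\<close> by (intro real_le_lsqrt) (auto intro: sum_nonneg)
  qed
  then show ?thesis using F unfolding dual_bound_def by blast
qed

lemma coeff_bound_add:
  assumes "coeff_bound M c" "coeff_bound N d"
  shows "coeff_bound (M + N) (\<lambda>\<alpha>. c \<alpha> + d \<alpha>)"
  unfolding coeff_bound_def
proof (intro allI impI)
  fix F :: "('a \<Rightarrow> nat) set" assume F: "finite F"
  have "L2_set (\<lambda>\<alpha>. cmod (c \<alpha> + d \<alpha>) * sqrt (DA_weight \<alpha>)) F
     \<le> L2_set (\<lambda>\<alpha>. cmod (c \<alpha>) * sqrt (DA_weight \<alpha>) + cmod (d \<alpha>) * sqrt (DA_weight \<alpha>)) F"
    by (rule L2_set_mono)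
      (auto simp: less_imp_le[OF DA_weight_pos] distrib_right[symmetric] intro!: mult_right_mono norm_triangle_ineq)
  also have "\<dots> \<le> M + N"
    by (rule order_trans[OF L2_set_triangle_ineq add_mono]) (use assms F in \<open>auto simp: coeff_bound_def\<close>)
  finally show "L2_set (\<lambda>\<alpha>. cmod (c \<alpha> + d \<alpha>) * sqrt (DA_weight \<alpha>)) F \<le> M + N" .
qed

lemma coeff_bound_scale:
  assumes "coeff_bound M c"
  shows "coeff_bound (cmod a * M) (\<lambda>\<alpha>. a * c \<alpha>)"
  unfolding coeff_bound_def
proof (intro allI impI)
  fix F :: "('a \<Rightarrow> nat) set" assume F: "finite F"
  have "L2_set (\<lambda>\<alpha>. cmod (a * c \<alpha>) * sqrt (DA_weight \<alpha>)) F = cmod a * L2_set (\<lambda>\<alpha>. cmod (c \<alpha>) * sqrt (DA_weight \<alpha>)) F"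
    by (simp add: L2_set_right_distrib norm_mult mult.assoc)
  also have "\<dots> \<le> cmod a * M" using assms F by (intro mult_left_mono) (auto simp: coeff_bound_def)
  finally show "L2_set (\<lambda>\<alpha>. cmod (a * c \<alpha>) * sqrt (DA_weight \<alpha>)) F \<le> cmod a * M" .
qed

lemma coeff_bound_limit:
  assumes c: "\<And>n. coeff_bound M (c n)" and lim: "\<And>\<alpha>. (\<lambda>n. c n \<alpha>) \<longlonglongrightarrow> a \<alpha>"
  shows "coeff_bound M a"
  unfolding coeff_bound_def
proof (intro allI impI)
  fix F :: "('a \<Rightarrow> nat) set" assume F: "finite F"
  have "(\<lambda>n. L2_set (\<lambda>\<alpha>. cmod (c n \<alpha>) * sqrt (DA_weight \<alpha>)) F) \<longlonglongrightarrow> L2_set (\<lambda>\<alpha>. cmod (a \<alpha>) * sqrt (DA_weight \<alpha>)) F"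
    unfolding L2_set_def by (intro tendsto_intros lim)
  then show "L2_set (\<lambda>\<alpha>. cmod (a \<alpha>) * sqrt (DA_weight \<alpha>)) F \<le> M"
    by (rule LIMSEQ_le_const2) (use c F in \<open>auto simp: coeff_bound_def\<close>)
qed

lemma infsum_diffI:
  fixes f g :: "'a \<Rightarrow> complex"
  assumes "f summable_on A" "g summable_on A"
  shows "(\<Sum>\<^sub>\<infinity>x\<in>A. f x - g x) = infsum f A - infsum g A"
  using infsum_add[OF assms(1), of "\<lambda>x. - g x"] assms(2) by (simp add: infsum_uminus summable_on_uminus)

text \<open>Bounded coefficientwise convergence is weak convergence: off a finite set
  \<open>e\<close> has small dual norm, uniformly in \<open>n\<close>, and on the finite set the
  convergence is termwise.\<close>

lemma pairing_limit:
  assumes c: "\<And>n. coeff_bound M (c n)" and lim: "\<And>\<alpha>. (\<lambda>n. c n \<alpha>) \<longlonglongrightarrow> a \<alpha>" and e: "dual_bound N e"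
  shows "(\<lambda>n. \<Sum>\<^sub>\<infinity>\<alpha>. c n \<alpha> * e \<alpha>) \<longlonglongrightarrow> (\<Sum>\<^sub>\<infinity>\<alpha>. a \<alpha> * e \<alpha>)"
proof (rule LIMSEQ_I)
  fix r :: real assume "r > 0"
  have a: "coeff_bound M a" using c lim by (rule coeff_bound_limit)
  have M: "0 \<le> M" using a by (rule coeff_bound_nonneg)
  \<comment> \<open>The tail contributes at most \<open>(M + M) * \<epsilon>\<close>, which is to be
    at most \<open>r / 2\<close>; the added 1 covers \<open>M = 0\<close>.\<close>
  define \<epsilon> where "\<epsilon> = r / (2 * (M + M + 1))"
  have \<epsilon>: "\<epsilon> > 0" using \<open>r > 0\<close> M by (simp add: \<epsilon>_def)
  obtain F where F: "finite F" "dual_bound \<epsilon> (\<lambda>\<alpha>. if \<alpha> \<in> F then 0 else e \<alpha>)"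
    using dual_bound_tail[OF e \<epsilon>] by blast
  have "(\<lambda>n. \<Sum>\<alpha>\<in>F. (c n \<alpha> - a \<alpha>) * e \<alpha>) \<longlonglongrightarrow> (\<Sum>\<alpha>\<in>F. (a \<alpha> - a \<alpha>) * e \<alpha>)"
    by (intro tendsto_intros lim)
  then obtain n0 where n0: "\<And>n. n \<ge> n0 \<Longrightarrow> cmod (\<Sum>\<alpha>\<in>F. (c n \<alpha> - a \<alpha>) * e \<alpha>) < r / 2"
    using LIMSEQ_D[of _ 0 "r/2"] \<open>r > 0\<close> by fastforce
  show "\<exists>no. \<forall>n\<ge>no. cmod ((\<Sum>\<^sub>\<infinity>\<alpha>. c n \<alpha> * e \<alpha>) - (\<Sum>\<^sub>\<infinity>\<alpha>. a \<alpha> * e \<alpha>)) < r"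
  proof (intro exI allI impI)
    fix n assume n: "n \<ge> n0"
    let ?d = "\<lambda>\<alpha>. c n \<alpha> - a \<alpha>"
    have d: "coeff_bound (M + M) ?d"
      using coeff_bound_add[OF c[of n] coeff_bound_scale[OF a, of "-1"]] by simp
    have "(\<Sum>\<^sub>\<infinity>\<alpha>. c n \<alpha> * e \<alpha>) - (\<Sum>\<^sub>\<infinity>\<alpha>. a \<alpha> * e \<alpha>) = (\<Sum>\<^sub>\<infinity>\<alpha>. ?d \<alpha> * e \<alpha>)"
      using infsum_diffI[OF pairing_summable[OF c e] pairing_summable[OF a e]]
      by (simp add: left_diff_distrib)
    also have "\<dots> = (\<Sum>\<^sub>\<infinity>\<alpha>. (if \<alpha> \<in> F then ?d \<alpha> * e \<alpha> else 0) + ?d \<alpha> * (if \<alpha> \<in> F then 0 else e \<alpha>))"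
      by (rule infsum_cong) auto
    also have "\<dots> = (\<Sum>\<^sub>\<infinity>\<alpha>. if \<alpha> \<in> F then ?d \<alpha> * e \<alpha> else 0) + (\<Sum>\<^sub>\<infinity>\<alpha>. ?d \<alpha> * (if \<alpha> \<in> F then 0 else e \<alpha>))"
    proof (rule infsum_add)
      show "(\<lambda>\<alpha>. if \<alpha> \<in> F then ?d \<alpha> * e \<alpha> else 0) summable_on UNIV"
        by (rule summable_on_cong_neutral[THEN iffD1, OF _ _ _ summable_on_finite[OF F(1), of "\<lambda>\<alpha>. ?d \<alpha> * e \<alpha>"]]) auto
    qed (rule pairing_summable[OF d F(2)])
    also have "(\<Sum>\<^sub>\<infinity>\<alpha>. if \<alpha> \<in> F then ?d \<alpha> * e \<alpha> else 0) = (\<Sum>\<alpha>\<in>F. ?d \<alpha> * e \<alpha>)"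
      using infsum_cong_neutral[of F UNIV "\<lambda>\<alpha>. ?d \<alpha> * e \<alpha>" "\<lambda>\<alpha>. if \<alpha> \<in> F then ?d \<alpha> * e \<alpha> else 0"] F by simp
    finally have eq: "(\<Sum>\<^sub>\<infinity>\<alpha>. c n \<alpha> * e \<alpha>) - (\<Sum>\<^sub>\<infinity>\<alpha>. a \<alpha> * e \<alpha>)
       = (\<Sum>\<alpha>\<in>F. ?d \<alpha> * e \<alpha>) + (\<Sum>\<^sub>\<infinity>\<alpha>. ?d \<alpha> * (if \<alpha> \<in> F then 0 else e \<alpha>))" .
    have "cmod ((\<Sum>\<^sub>\<infinity>\<alpha>. c n \<alpha> * e \<alpha>) - (\<Sum>\<^sub>\<infinity>\<alpha>. a \<alpha> * e \<alpha>))
       \<le> cmod (\<Sum>\<alpha>\<in>F. ?d \<alpha> * e \<alpha>) + cmod (\<Sum>\<^sub>\<infinity>\<alpha>. ?d \<alpha> * (if \<alpha> \<in> F then 0 else e \<alpha>))"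
      unfolding eq by (rule norm_triangle_ineq)
    also have "\<dots> \<le> cmod (\<Sum>\<alpha>\<in>F. ?d \<alpha> * e \<alpha>) + (M + M) * \<epsilon>"
      using pairing_le[OF d F(2)] by simp
    also have "(M + M) * \<epsilon> \<le> r / 2" using \<open>r > 0\<close> M by (simp add: \<epsilon>_def field_simps)
    finally show "cmod ((\<Sum>\<^sub>\<infinity>\<alpha>. c n \<alpha> * e \<alpha>) - (\<Sum>\<^sub>\<infinity>\<alpha>. a \<alpha> * e \<alpha>)) < r" using n0[OF n] by simp
  qed
qed

text \<open>Grouped by degree, the squares add up to the geometric series with ratio
  \<open>(norm z)\<^sup>2\<close>. Its sum is the value of the reproducing kernel on the
  diagonal.\<close>

lemma dual_bound_mono_pow:
  assumes z: "z \<in> DA_ball"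
  shows "\<exists>N. dual_bound N (mono_pow z)"
proof -
  define s where "s = (\<Sum>i\<in>UNIV. (cmod (z $ i))\<^sup>2)"
  have "norm z = sqrt s" by (simp add: norm_vec_def L2_set_def s_def)
  then have s: "0 \<le> s" "s < 1" using z by (auto simp: DA_ball_def s_def intro: sum_nonneg)
  define u where "u \<alpha> = (\<Prod>i\<in>UNIV. ((cmod (z $ i))\<^sup>2) ^ \<alpha> i) / DA_weight \<alpha>" for \<alpha>
  have u0: "u \<alpha> \<ge> 0" for \<alpha> using DA_weight_pos[of \<alpha>] by (auto simp: u_def intro!: divide_nonneg_pos prod_nonneg)
  have eq: "(cmod (mono_pow z \<alpha>) / sqrt (DA_weight \<alpha>))\<^sup>2 = u \<alpha>" for \<alpha>
    using DA_weight_pos[of \<alpha>]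
    by (simp add: u_def norm_mono_pow power_divide prod_power_distrib[symmetric] flip: power_mult)
     (simp add: prod_power_distrib power_mult[symmetric] mult.commute)
  have "L2_set (\<lambda>\<alpha>. cmod (mono_pow z \<alpha>) / sqrt (DA_weight \<alpha>)) F \<le> sqrt (1 / (1 - s))" if F: "finite F" for F
  proof -
    define m where "m = Max (mi_abs ` F \<union> {0})"
    have "sum u F \<le> sum u (\<Union>n\<in>{..m}. {\<alpha>. mi_abs \<alpha> = n})"
      using F u0 by (intro sum_mono2) (auto simp: finite_mi_abs m_def)
    also have "\<dots> = (\<Sum>n\<le>m. \<Sum>\<alpha> | mi_abs \<alpha> = n. u \<alpha>)"
      by (rule sum.UNION_disjoint) (auto simp: finite_mi_abs)
    also have "\<dots> = (\<Sum>n\<le>m. s ^ n)" by (simp add: u_def multinomial_sum s_def)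
    also have "\<dots> \<le> (\<Sum>n. s ^ n)" using s by (intro sum_le_suminf summable_geometric) auto
    also have "\<dots> = 1 / (1 - s)" using s by (subst suminf_geometric) auto
    finally show ?thesis by (simp add: L2_set_def eq)
  qed
  then show ?thesis unfolding dual_bound_def by blast
qed

section \<open>Norm, inner product and point evaluations on the Drury-Arveson space\<close>

definition H2_bound :: "real \<Rightarrow> (complex^'d::finite \<Rightarrow> complex) \<Rightarrow> bool" where
  "H2_bound M f \<longleftrightarrow> (\<exists>c. coeff_bound M c \<and> f = DA_series c)"

definition H2_norm :: "(complex^'d::finite \<Rightarrow> complex) \<Rightarrow> real" where
  "H2_norm f = sqrt (Re (DA_inner f f))"

lemma coeff_bound_sq:
  "coeff_bound M c \<longleftrightarrow> 0 \<le> M \<and> (\<forall>F. finite F \<longrightarrow> (\<Sum>\<alpha>\<in>F. (cmod (c \<alpha>))\<^sup>2 * DA_weight \<alpha>) \<le> M\<^sup>2)"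
proof -
  have eq: "L2_set (\<lambda>\<alpha>. cmod (c \<alpha>) * sqrt (DA_weight \<alpha>)) F = sqrt (\<Sum>\<alpha>\<in>F. (cmod (c \<alpha>))\<^sup>2 * DA_weight \<alpha>)" for F
    by (simp add: L2_set_def power_mult_distrib less_imp_le[OF DA_weight_pos])
  have nn: "0 \<le> (\<Sum>\<alpha>\<in>F. (cmod (c \<alpha>))\<^sup>2 * DA_weight \<alpha>)" for F
    by (intro sum_nonneg) (simp add: less_imp_le[OF DA_weight_pos])
  show ?thesis
  proof
    assume b: "coeff_bound M c"
    then show "0 \<le> M \<and> (\<forall>F. finite F \<longrightarrow> (\<Sum>\<alpha>\<in>F. (cmod (c \<alpha>))\<^sup>2 * DA_weight \<alpha>) \<le> M\<^sup>2)"
      using coeff_bound_nonneg[OF b] sqrt_le_D unfolding coeff_bound_def eq by auto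
  next
    assume "0 \<le> M \<and> (\<forall>F. finite F \<longrightarrow> (\<Sum>\<alpha>\<in>F. (cmod (c \<alpha>))\<^sup>2 * DA_weight \<alpha>) \<le> M\<^sup>2)"
    then show "coeff_bound M c" unfolding coeff_bound_def eq by (auto intro!: real_le_lsqrt)
  qed
qed

lemma coeff_bound_summable:
  "coeff_bound M c \<Longrightarrow> (\<lambda>\<alpha>. (cmod (c \<alpha>))\<^sup>2 * DA_weight \<alpha>) summable_on UNIV"
  by (rule nonneg_bdd_above_summable_on) (auto simp: coeff_bound_sq bdd_above_def less_imp_le[OF DA_weight_pos])

lemma DA_coeffs_bound:
  assumes "c \<in> DA_coeffs"
  shows "coeff_bound (sqrt (\<Sum>\<^sub>\<infinity>\<alpha>. (cmod (c \<alpha>))\<^sup>2 * DA_weight \<alpha>)) c"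
proof -
  have s: "(\<lambda>\<alpha>. (cmod (c \<alpha>))\<^sup>2 * DA_weight \<alpha>) summable_on UNIV" using assms by (simp add: DA_coeffs_def)
  have "0 \<le> (\<Sum>\<^sub>\<infinity>\<alpha>. (cmod (c \<alpha>))\<^sup>2 * DA_weight \<alpha>)"
    by (intro infsum_nonneg) (simp add: less_imp_le[OF DA_weight_pos])
  then show ?thesis
    unfolding coeff_bound_sq by (auto intro!: finite_sum_le_infsum s simp: less_imp_le[OF DA_weight_pos])
qed

lemma coeff_bound_DA_coeffs: "coeff_bound M c \<Longrightarrow> c \<in> DA_coeffs"
  using coeff_bound_summable by (auto simp: DA_coeffs_def)

lemma coeff_bound_ps_conv: "coeff_bound M c \<Longrightarrow> ps_conv c"
  unfolding ps_conv_def using pairing_summable dual_bound_mono_pow by blast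

lemma DA_series_add:
  assumes "ps_conv c" "ps_conv d"
  shows "DA_series (\<lambda>\<alpha>. c \<alpha> + d \<alpha>) = (\<lambda>z. DA_series c z + DA_series d z)"
proof
  fix z
  show "DA_series (\<lambda>\<alpha>. c \<alpha> + d \<alpha>) z = DA_series c z + DA_series d z"
    using assms infsum_add[of "\<lambda>\<alpha>. c \<alpha> * mono_pow z \<alpha>" UNIV "\<lambda>\<alpha>. d \<alpha> * mono_pow z \<alpha>"]
    by (auto simp: DA_series_def ps_conv_def distrib_right)
qed

lemma DA_series_scale: "DA_series (\<lambda>\<alpha>. a * c \<alpha>) = (\<lambda>z. a * DA_series c z)"
  by (rule ext) (auto simp: DA_series_def mult.assoc infsum_cmult_right')

text \<open>The arbitrary choice in \<open>DA_coeff\<close> is harmless because Taylor coefficients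
  are unique: \<open>ps_coeff_zero\<close> applies to the difference of the chosen and the given
  family.\<close>

lemma DA_coeff_series:
  assumes "coeff_bound M c"
  shows "DA_coeff (DA_series c) = c"
proof -
  let ?d = "DA_coeff (DA_series c)"
  have "c \<in> DA_coeffs \<and> DA_series c = DA_series c" using assms coeff_bound_DA_coeffs by auto
  then have d: "?d \<in> DA_coeffs \<and> DA_series ?d = DA_series c"
    unfolding DA_coeff_def by (rule someI[where P = "\<lambda>d. d \<in> DA_coeffs \<and> DA_series d = DA_series c"])
  obtain N where N: "coeff_bound N ?d" using d DA_coeffs_bound by blast
  have diff: "coeff_bound (N + cmod (-1) * M) (\<lambda>\<alpha>. ?d \<alpha> + (-1) * c \<alpha>)"
    by (intro coeff_bound_add coeff_bound_scale N assms)
  have "DA_series (\<lambda>\<alpha>. ?d \<alpha> + (-1) * c \<alpha>) z = 0" for z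
    by (subst DA_series_add) (use d in \<open>auto simp only: DA_series_scale intro!: coeff_bound_ps_conv coeff_bound_scale N assms\<close>, auto)
  then have "?d \<alpha> + (-1) * c \<alpha> = 0" for \<alpha>
    using ps_coeff_zero[OF coeff_bound_ps_conv[OF diff]] by blast
  then show ?thesis by (auto simp: fun_eq_iff)
qed

text \<open>It puts \<open>DA_inner\<close> with a fixed second argument into the form of the
  bilinear pairing, so that \<open>pairing_le\<close> and \<open>pairing_limit\<close> apply to
  it.\<close>

lemma dual_bound_cnj:
  assumes "coeff_bound N d"
  shows "dual_bound N (\<lambda>\<alpha>. cnj (d \<alpha>) * complex_of_real (DA_weight \<alpha>))"
proof -
  have "cmod (cnj (d \<alpha>) * complex_of_real (DA_weight \<alpha>)) / sqrt (DA_weight \<alpha>) = cmod (d \<alpha>) * sqrt (DA_weight \<alpha>)" for \<alpha>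
    using DA_weight_pos[of \<alpha>] by (simp add: norm_mult real_div_sqrt flip: times_divide_eq_right)
  then show ?thesis using assms by (simp add: dual_bound_def coeff_bound_def)
qed

lemma DA_inner_series:
  assumes "coeff_bound M c" "coeff_bound N d"
  shows "DA_inner (DA_series c) (DA_series d) = (\<Sum>\<^sub>\<infinity>\<alpha>. c \<alpha> * (cnj (d \<alpha>) * complex_of_real (DA_weight \<alpha>)))"
  unfolding DA_inner_def DA_coeff_series[OF assms(1)] DA_coeff_series[OF assms(2)] by (simp add: mult.assoc)

lemma infsum_complex_of_real:
  assumes "f summable_on A"
  shows "(\<Sum>\<^sub>\<infinity>x\<in>A. complex_of_real (f x)) = complex_of_real (infsum f A)"
  using has_sum_of_real[OF has_sum_infsum[OF assms]] by (rule infsumI)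

lemma H2_norm_series:
  assumes "coeff_bound M c"
  shows "H2_norm (DA_series c) = sqrt (\<Sum>\<^sub>\<infinity>\<alpha>. (cmod (c \<alpha>))\<^sup>2 * DA_weight \<alpha>)"
proof -
  have "c \<alpha> * (cnj (c \<alpha>) * complex_of_real (DA_weight \<alpha>)) = complex_of_real ((cmod (c \<alpha>))\<^sup>2 * DA_weight \<alpha>)" for \<alpha>
    by (simp add: complex_norm_square mult.assoc del: of_real_power)
  then have "DA_inner (DA_series c) (DA_series c) = complex_of_real (\<Sum>\<^sub>\<infinity>\<alpha>. (cmod (c \<alpha>))\<^sup>2 * DA_weight \<alpha>)"
    by (simp add: DA_inner_series[OF assms assms] infsum_complex_of_real[OF coeff_bound_summable[OF assms]] del: of_real_mult of_real_power)
  then show ?thesis by (simp add: H2_norm_def)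
qed

lemma H2_iff_bound: "f \<in> H2 \<longleftrightarrow> (\<exists>M. H2_bound M f)"
  unfolding H2_def H2_bound_def using DA_coeffs_bound coeff_bound_DA_coeffs by blast

lemma H2_bound_norm:
  assumes "f \<in> H2"
  shows "H2_bound (H2_norm f) f"
proof -
  obtain c where c: "c \<in> DA_coeffs" "f = DA_series c" using assms by (auto simp: H2_def)
  show ?thesis using DA_coeffs_bound[OF c(1)] H2_norm_series[OF DA_coeffs_bound[OF c(1)]] c
    unfolding H2_bound_def by auto
qed

lemma H2_norm_le: "H2_bound M f \<Longrightarrow> H2_norm f \<le> M"
proof -
  assume "H2_bound M f"
  then obtain c where c: "coeff_bound M c" "f = DA_series c" by (auto simp: H2_bound_def)
  have "(\<Sum>\<^sub>\<infinity>\<alpha>. (cmod (c \<alpha>))\<^sup>2 * DA_weight \<alpha>) \<le> M\<^sup>2"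
    by (rule infsum_le_finite_sums) (use c coeff_bound_summable in \<open>auto simp: coeff_bound_sq\<close>)
  then show ?thesis using c H2_norm_series[OF c(1)] real_sqrt_le_mono coeff_bound_nonneg by fastforce
qed

lemma H2_bound_nonneg: "H2_bound M f \<Longrightarrow> 0 \<le> M"
  using coeff_bound_nonneg by (auto simp: H2_bound_def)

lemma H2_norm_nonneg: "f \<in> H2 \<Longrightarrow> 0 \<le> H2_norm f"
  using H2_bound_norm H2_bound_nonneg by blast

lemma H2_bound_mono: "H2_bound M f \<Longrightarrow> M \<le> N \<Longrightarrow> H2_bound N f"
  unfolding H2_bound_def coeff_bound_def by (blast intro: order_trans)

lemma H2_bound_iff: "H2_bound M f \<longleftrightarrow> f \<in> H2 \<and> H2_norm f \<le> M"
  using H2_norm_le H2_bound_norm H2_bound_mono H2_iff_bound by blast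

lemma H2_bound_add:
  "H2_bound M f \<Longrightarrow> H2_bound N g \<Longrightarrow> H2_bound (M + N) (\<lambda>z. f z + g z)"
  unfolding H2_bound_def
proof (elim exE conjE)
  fix c d assume "coeff_bound M c" "f = DA_series c" "coeff_bound N d" "g = DA_series d"
  then show "\<exists>c. coeff_bound (M + N) c \<and> (\<lambda>z. f z + g z) = DA_series c"
    by (intro exI[of _ "\<lambda>\<alpha>. c \<alpha> + d \<alpha>"]) (simp add: coeff_bound_add DA_series_add coeff_bound_ps_conv)
qed

lemma H2_bound_scale: "H2_bound M f \<Longrightarrow> H2_bound (cmod a * M) (\<lambda>z. a * f z)"
  unfolding H2_bound_def
proof (elim exE conjE)
  fix c assume "coeff_bound M c" "f = DA_series c"
  then show "\<exists>c. coeff_bound (cmod a * M) c \<and> (\<lambda>z. a * f z) = DA_series c"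
    by (intro exI[of _ "\<lambda>\<alpha>. a * c \<alpha>"]) (simp add: coeff_bound_scale DA_series_scale)
qed

lemma H2_bound_diff:
  "H2_bound M f \<Longrightarrow> H2_bound N g \<Longrightarrow> H2_bound (M + N) (\<lambda>z. f z - g z)"
  using H2_bound_add[OF _ H2_bound_scale[of N g "-1"], of M f] by simp

lemma H2_outside: "H2_bound M f \<Longrightarrow> z \<notin> DA_ball \<Longrightarrow> f z = 0"
  by (auto simp: H2_bound_def DA_series_def)

text \<open>The constant depends on \<open>z\<close> only, so it turns norm estimates for
  differences into pointwise ones.\<close>

lemma H2_eval_bound:
  assumes "z \<in> DA_ball"
  shows "\<exists>C\<ge>0. \<forall>f M. H2_bound M f \<longrightarrow> cmod (f z) \<le> M * C"
proof -
  obtain N where N: "dual_bound N (mono_pow z)" using dual_bound_mono_pow[OF assms] by blast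
  have "cmod (f z) \<le> M * N" if "H2_bound M f" for f M
    using that pairing_le[OF _ N] assms by (auto simp: H2_bound_def DA_series_at)
  then show ?thesis using dual_bound_nonneg[OF N] by blast
qed

lemma H2_bound_0:
  assumes "H2_bound 0 f"
  shows "f = (\<lambda>_. 0)"
proof
  fix z
  show "f z = 0"
  proof (cases "z \<in> DA_ball")
    case True
    then show ?thesis using H2_eval_bound[OF True] assms by fastforce
  qed (use assms H2_outside in blast)
qed

lemma DA_inner_le:
  assumes "H2_bound M f" "H2_bound N g"
  shows "cmod (DA_inner f g) \<le> M * N"
proof -
  obtain c d where c: "coeff_bound M c" "f = DA_series c" and d: "coeff_bound N d" "g = DA_series d"
    using assms by (auto simp: H2_bound_def)
  show ?thesis using pairing_le[OF c(1) dual_bound_cnj[OF d(1)]] by (simp add: c d DA_inner_series[OF c(1) d(1)])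
qed

section \<open>Bounded sequences: compactness and weak convergence\<close>

lemma H2_bounded_subsequence_coeffs:
  fixes c :: "nat \<Rightarrow> ('d::finite \<Rightarrow> nat) \<Rightarrow> complex"
  assumes c: "\<And>n. coeff_bound M (c n)"
  shows "\<exists>r a. strict_mono (r::nat\<Rightarrow>nat) \<and> coeff_bound M a \<and> (\<forall>\<alpha>. (\<lambda>n. c (r n) \<alpha>) \<longlonglongrightarrow> a \<alpha>)"
proof -
  \<comment> \<open>After scaling by the square root of the weight, all coefficients are bounded by
    the same \<open>M\<close>, as the diagonal argument over the countably many multi-indices
    requires.\<close>
  define s where "s n \<alpha> = c n \<alpha> * of_real (sqrt (DA_weight \<alpha>))" for n \<alpha>
  have "cmod (s n \<alpha>) \<le> M" for n \<alpha>
  proof -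
    have "L2_set (\<lambda>\<alpha>. cmod (c n \<alpha>) * sqrt (DA_weight \<alpha>)) {\<alpha>} \<le> M" using c[of n] unfolding coeff_bound_def by blast
    then show ?thesis by (simp add: s_def norm_mult less_imp_le[OF DA_weight_pos])
  qed
  then obtain r where r: "strict_mono (r::nat\<Rightarrow>nat)" "\<And>\<alpha>. \<exists>l. (\<lambda>n. s (r n) \<alpha>) \<longlonglongrightarrow> l"
    using function_convergent_subsequence[of UNIV s M thesis] countableI_type by auto
  have "\<forall>\<alpha>. \<exists>l. (\<lambda>n. s (r n) \<alpha>) \<longlonglongrightarrow> l" using r(2) by blast
  from choice[OF this] obtain l where l: "\<And>\<alpha>. (\<lambda>n. s (r n) \<alpha>) \<longlonglongrightarrow> l \<alpha>" by blast
  have lim: "(\<lambda>n. c (r n) \<alpha>) \<longlonglongrightarrow> l \<alpha> / of_real (sqrt (DA_weight \<alpha>))" for \<alpha>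
  proof -
    have nz: "complex_of_real (sqrt (DA_weight \<alpha>)) \<noteq> 0" using DA_weight_pos[of \<alpha>] by simp
    have "(\<lambda>n. s (r n) \<alpha> / of_real (sqrt (DA_weight \<alpha>))) \<longlonglongrightarrow> l \<alpha> / of_real (sqrt (DA_weight \<alpha>))"
      by (intro tendsto_intros l nz)
    then show ?thesis using nz by (simp add: s_def)
  qed
  have "coeff_bound M (\<lambda>\<alpha>. l \<alpha> / of_real (sqrt (DA_weight \<alpha>)))"
    by (rule coeff_bound_limit[of M "\<lambda>n. c (r n)"]) (use c lim in auto)
  then show ?thesis using r(1) lim by blast
qed

text \<open>Weak sequential compactness of balls, in pointwise form: coefficientwise convergence of
  a bounded sequence forces convergence at each point of the ball by
  \<open>pairing_limit\<close>.\<close>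

lemma H2_bounded_subsequence:
  fixes f :: "nat \<Rightarrow> complex^'d::finite \<Rightarrow> complex"
  assumes "\<And>n. H2_bound M (f n)"
  shows "\<exists>r g. strict_mono (r::nat\<Rightarrow>nat) \<and> H2_bound M g \<and> (\<forall>z. (\<lambda>n. f (r n) z) \<longlonglongrightarrow> g z)"
proof -
  have "\<forall>n. \<exists>c. coeff_bound M c \<and> f n = DA_series c" using assms by (auto simp: H2_bound_def)
  from choice[OF this] obtain c where c: "\<And>n. coeff_bound M (c n)" "\<And>n. f n = DA_series (c n)" by blast
  obtain r a where r: "strict_mono (r::nat\<Rightarrow>nat)" "coeff_bound M a" "\<And>\<alpha>. (\<lambda>n. c (r n) \<alpha>) \<longlonglongrightarrow> a \<alpha>"
    using H2_bounded_subsequence_coeffs[of M c, OF c(1)] by blast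
  have "(\<lambda>n. f (r n) z) \<longlonglongrightarrow> DA_series a z" for z
  proof (cases "z \<in> DA_ball")
    case True
    then obtain N where "dual_bound N (mono_pow z)" using dual_bound_mono_pow by blast
    then show ?thesis using pairing_limit[of M "\<lambda>n. c (r n)", OF c(1) r(3)] True by (simp add: c(2) DA_series_at)
  qed (simp add: c(2) DA_series_def)
  moreover have "H2_bound M (DA_series a)" using r(2) unfolding H2_bound_def by blast
  ultimately show ?thesis using r(1) by blast
qed

text \<open>Bounded pointwise convergence implies convergence of every Taylor coefficient, since each
  subsequence has a coefficientwise convergent further subsequence with the same limit.\<close>

lemma H2_pointwise_weak:
  fixes f :: "nat \<Rightarrow> complex^'d::finite \<Rightarrow> complex"
  assumes f: "\<And>n. H2_bound M (f n)" and lim: "\<And>z. (\<lambda>n. f n z) \<longlonglongrightarrow> g z"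
  shows "H2_bound M g" and "h \<in> H2 \<Longrightarrow> (\<lambda>n. DA_inner (f n) h) \<longlonglongrightarrow> DA_inner g h"
proof -
  have sub: "g = g'" if "strict_mono (r::nat\<Rightarrow>nat)" "\<And>z. (\<lambda>n. f (r n) z) \<longlonglongrightarrow> g' z" for r g'
    using that LIMSEQ_unique LIMSEQ_subseq_LIMSEQ[OF lim that(1)] unfolding comp_def by (intro ext) blast
  obtain r0 :: "nat \<Rightarrow> nat" and g0 where r0: "strict_mono r0" "H2_bound M g0" "\<And>z. (\<lambda>n. f (r0 n) z) \<longlonglongrightarrow> g0 z"
    using H2_bounded_subsequence[of M f, OF f] by blast
  show g: "H2_bound M g" using sub[OF r0(1,3)] r0(2) by simp
  have "\<forall>n. \<exists>c. coeff_bound M c \<and> f n = DA_series c" using f by (auto simp: H2_bound_def)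
  from choice[OF this] obtain c where c: "\<And>n. coeff_bound M (c n)" "\<And>n. f n = DA_series (c n)" by blast
  obtain a where a: "coeff_bound M a" "g = DA_series a" using g by (auto simp: H2_bound_def)
  have ca: "(\<lambda>n. c n \<alpha>) \<longlonglongrightarrow> a \<alpha>" for \<alpha>
  proof (rule ccontr)
    assume "\<not> ?thesis"
    then obtain e where e: "e > 0" "\<And>N. \<exists>n\<ge>N. e \<le> dist (c n \<alpha>) (a \<alpha>)"
      by (auto simp: lim_sequentially not_less)
    then have "infinite {n. e \<le> dist (c n \<alpha>) (a \<alpha>)}" unfolding infinite_nat_iff_unbounded_le by blast
    then obtain r where r: "strict_mono (r::nat\<Rightarrow>nat)" "\<And>n. e \<le> dist (c (r n) \<alpha>) (a \<alpha>)"
      using infinite_enumerate by blast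
    obtain q b where q: "strict_mono (q::nat\<Rightarrow>nat)" "coeff_bound M b" "\<And>\<alpha>. (\<lambda>n. c (r (q n)) \<alpha>) \<longlonglongrightarrow> b \<alpha>"
      using H2_bounded_subsequence_coeffs[of M "\<lambda>n. c (r n)"] c(1) by blast
    have "(\<lambda>n. f ((r \<circ> q) n) z) \<longlonglongrightarrow> DA_series b z" for z
    proof (cases "z \<in> DA_ball")
      case True
      then obtain N where "dual_bound N (mono_pow z)" using dual_bound_mono_pow by blast
      then show ?thesis using pairing_limit[of M "\<lambda>n. c (r (q n))", OF c(1) q(3)] True by (simp add: c(2) DA_series_at)
    qed (simp add: c(2) DA_series_def)
    then have "g = DA_series b" using sub[of "r \<circ> q"] r(1) q(1) strict_mono_o by blast
    then have "DA_coeff (DA_series b) = DA_coeff (DA_series a)" using a(2) by simp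
    then have "b = a" unfolding DA_coeff_series[OF q(2)] DA_coeff_series[OF a(1)] .
    then have "(\<lambda>n. c (r (q n)) \<alpha>) \<longlonglongrightarrow> a \<alpha>" using q(3) by simp
    then obtain n where "dist (c (r (q n)) \<alpha>) (a \<alpha>) < e" using \<open>e > 0\<close> by (auto simp: lim_sequentially)
    then show False using r(2)[of "q n"] by simp
  qed
  show "(\<lambda>n. DA_inner (f n) h) \<longlonglongrightarrow> DA_inner g h" if h: "h \<in> H2"
  proof -
    obtain N d where d: "coeff_bound N d" "h = DA_series d" using h by (auto simp: H2_iff_bound H2_bound_def)
    show ?thesis
      using pairing_limit[of M c, OF c(1) ca dual_bound_cnj[OF d(1)]]
      by (simp add: a(2) c(2) d(2) DA_inner_series[OF c(1) d(1)] DA_inner_series[OF a(1) d(1)])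
  qed
qed

lemma DA_one_H2: "H2_bound 1 (DA_one :: complex^'d::finite \<Rightarrow> complex)"
proof -
  define c :: "('d \<Rightarrow> nat) \<Rightarrow> complex" where "c \<alpha> = (if \<alpha> = (\<lambda>_. 0) then 1 else 0)" for \<alpha>
  have w: "DA_weight ((\<lambda>_. 0) :: 'd \<Rightarrow> nat) = 1" by (simp add: DA_weight_def mi_fact_def mi_abs_def)
  have "coeff_bound 1 c" unfolding coeff_bound_sq
  proof (intro conjI allI impI)
    fix F :: "('d \<Rightarrow> nat) set" assume F: "finite F"
    have "(\<Sum>\<alpha>\<in>F. (cmod (c \<alpha>))\<^sup>2 * DA_weight \<alpha>) = (\<Sum>\<alpha>\<in>F. if \<alpha> = (\<lambda>_. 0) then 1 else 0)"
      by (rule sum.cong) (auto simp: c_def w)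
    then show "(\<Sum>\<alpha>\<in>F. (cmod (c \<alpha>))\<^sup>2 * DA_weight \<alpha>) \<le> 1\<^sup>2" using F by simp
  qed simp
  moreover have "DA_one = DA_series c"
  proof
    fix z :: "complex^'d"
    have "(\<Sum>\<^sub>\<infinity>\<beta>. c \<beta> * mono_pow z \<beta>) = (\<Sum>\<^sub>\<infinity>\<beta>\<in>{\<lambda>_. 0}. c \<beta> * mono_pow z \<beta>)"
      by (rule infsum_cong_neutral) (auto simp: c_def)
    then show "DA_one z = DA_series c z" by (simp add: DA_one_def DA_series_def c_def mono_pow_def)
  qed
  ultimately show ?thesis unfolding H2_bound_def by blast
qed

text \<open>Multiplication by a coordinate shifts the coefficients along \<open>mi_inc j\<close>.
  The weight does not grow under this shift, as \<open>\<beta> j + 1\<close> is at most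
  \<open>mi_abs \<beta> + 1\<close>.\<close>

lemma H2_bound_coord:
  fixes f :: "complex^'d::finite \<Rightarrow> complex"
  assumes "H2_bound M f"
  shows "H2_bound M (\<lambda>z. DA_coord j z * f z)"
proof -
  obtain c where c: "coeff_bound M c" "f = DA_series c" using assms by (auto simp: H2_bound_def)
  define d where "d \<alpha> = (if \<alpha> j = 0 then 0 else c (\<alpha>(j := \<alpha> j - 1)))" for \<alpha>
  have di: "d (mi_inc j \<beta>) = c \<beta>" for \<beta> by (simp add: d_def mi_inc_def)
  have d0: "d \<alpha> = 0" if "\<alpha> \<notin> range (mi_inc j)" for \<alpha> using that by (auto simp: range_mi_inc d_def)
  have w: "DA_weight (mi_inc j \<beta>) \<le> DA_weight \<beta>" for \<beta>
    using DA_weight_pos[of \<beta>] le_mi_abs[of \<beta> j] by (simp add: DA_weight_inc divide_le_eq mult_left_mono)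
  have "coeff_bound M d" unfolding coeff_bound_sq
  proof (intro conjI allI impI)
    fix F :: "('d \<Rightarrow> nat) set" assume F: "finite F"
    define G where "G = mi_inc j -` F"
    have G: "finite G" unfolding G_def using F inj_mi_inc by (rule finite_vimageI)
    have "(\<Sum>\<alpha>\<in>F. (cmod (d \<alpha>))\<^sup>2 * DA_weight \<alpha>) = (\<Sum>\<alpha>\<in>mi_inc j ` G. (cmod (d \<alpha>))\<^sup>2 * DA_weight \<alpha>)"
      using F by (intro sum.mono_neutral_right) (auto simp: G_def intro!: d0)
    also have "\<dots> = (\<Sum>\<beta>\<in>G. (cmod (c \<beta>))\<^sup>2 * DA_weight (mi_inc j \<beta>))"
      by (subst sum.reindex) (auto intro: inj_on_subset[OF inj_mi_inc] simp: di)
    also have "\<dots> \<le> (\<Sum>\<beta>\<in>G. (cmod (c \<beta>))\<^sup>2 * DA_weight \<beta>)"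
      by (intro sum_mono mult_left_mono w) auto
    also have "\<dots> \<le> M\<^sup>2" using c(1) G by (simp add: coeff_bound_sq)
    finally show "(\<Sum>\<alpha>\<in>F. (cmod (d \<alpha>))\<^sup>2 * DA_weight \<alpha>) \<le> M\<^sup>2" .
  qed (use c coeff_bound_nonneg in blast)
  moreover have "(\<lambda>z. DA_coord j z * f z) = DA_series d"
  proof
    fix z :: "complex^'d"
    have "(\<Sum>\<^sub>\<infinity>\<alpha>. d \<alpha> * mono_pow z \<alpha>) = (\<Sum>\<^sub>\<infinity>\<alpha>\<in>range (mi_inc j). d \<alpha> * mono_pow z \<alpha>)"
      by (rule infsum_cong_neutral) (auto simp: d0)
    also have "\<dots> = (\<Sum>\<^sub>\<infinity>\<beta>. z $ j * (c \<beta> * mono_pow z \<beta>))"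
      by (subst infsum_reindex[OF inj_mi_inc]) (simp add: o_def di mono_pow_inc mult.left_commute)
    also have "\<dots> = z $ j * (\<Sum>\<^sub>\<infinity>\<beta>. c \<beta> * mono_pow z \<beta>)" by (simp add: infsum_cmult_right')
    finally show "DA_coord j z * f z = DA_series d z" by (simp add: c(2) DA_coord_def DA_series_def)
  qed
  ultimately show ?thesis unfolding H2_bound_def by blast
qed

section \<open>Multipliers\<close>

text \<open>The number \<open>M\<close> bounds the operator norm of multiplication by
  \<open>\<phi>\<close>. Formulated through \<open>H2_bound\<close>, the constants simply multiply
  under composition, and no membership conditions have to be carried along.\<close>

definition mult_bound :: "real \<Rightarrow> (complex^'d::finite \<Rightarrow> complex) \<Rightarrow> bool" where
  "mult_bound M \<phi> \<longleftrightarrow> (\<forall>z. z \<notin> DA_ball \<longrightarrow> \<phi> z = 0) \<and>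
     (\<forall>f N. H2_bound N f \<longrightarrow> H2_bound (M * N) (\<lambda>z. \<phi> z * f z))"

text \<open>The locale \<open>Metric_space\<close> demands non-negativity and symmetry for all
  arguments, also outside the carrier; the default value 0 provides them there.\<close>

definition H2_dist :: "(complex^'d::finite \<Rightarrow> complex) \<Rightarrow> (complex^'d \<Rightarrow> complex) \<Rightarrow> real" where
  "H2_dist f g = (if f \<in> H2 \<and> g \<in> H2 then H2_norm (\<lambda>z. f z - g z) else 0)"

lemma H2_diff: "f \<in> H2 \<Longrightarrow> g \<in> H2 \<Longrightarrow> (\<lambda>z. f z - g z) \<in> H2"
  using H2_bound_diff H2_iff_bound by metis

lemma H2_add: "f \<in> H2 \<Longrightarrow> g \<in> H2 \<Longrightarrow> (\<lambda>z. f z + g z) \<in> H2"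
  using H2_bound_add H2_iff_bound by metis

lemma H2_scale: "f \<in> H2 \<Longrightarrow> (\<lambda>z. a * f z) \<in> H2"
  using H2_bound_scale H2_iff_bound by metis

lemma H2_dist_le:
  "f \<in> H2 \<Longrightarrow> g \<in> H2 \<Longrightarrow> H2_dist f g \<le> M \<longleftrightarrow> H2_bound M (\<lambda>z. f z - g z)"
  by (simp add: H2_dist_def H2_bound_iff H2_diff)

lemma H2_dist_bound: "f \<in> H2 \<Longrightarrow> g \<in> H2 \<Longrightarrow> H2_bound (H2_dist f g) (\<lambda>z. f z - g z)"
  using H2_dist_le by blast

lemma H2_bound_uminus: "H2_bound M (\<lambda>z. f z - g z) \<Longrightarrow> H2_bound M (\<lambda>z. g z - f z)"
  using H2_bound_scale[of M "\<lambda>z. f z - g z" "-1"] by simp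

lemma H2_Metric_space: "Metric_space H2 H2_dist"
proof
  show "0 \<le> H2_dist f g" for f g :: "complex^'a \<Rightarrow> complex"
    by (simp add: H2_dist_def H2_norm_nonneg H2_diff)
  have "H2_dist f g \<le> H2_dist g f" if "f \<in> H2" "g \<in> H2" for f g :: "complex^'a \<Rightarrow> complex"
    using that H2_dist_le[of f g "H2_dist g f"] H2_bound_uminus[OF H2_dist_bound[of g f]] by simp
  then show "H2_dist f g = H2_dist g f" for f g :: "complex^'a \<Rightarrow> complex"
    by (cases "f \<in> H2 \<and> g \<in> H2") (auto intro: antisym simp: H2_dist_def)
  show "(H2_dist f g = 0) = (f = g)" if "f \<in> H2" "g \<in> H2" for f g :: "complex^'a \<Rightarrow> complex"
  proof
    assume "H2_dist f g = 0"
    then have "H2_bound 0 (\<lambda>z. f z - g z)" using H2_dist_bound[OF that] by simp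
    from H2_bound_0[OF this] show "f = g" by (auto simp: fun_eq_iff)
  next
    assume "f = g"
    have "H2_bound (cmod 0 * 1) (\<lambda>z::complex^'a. 0 * DA_one z)" by (intro H2_bound_scale DA_one_H2)
    then have "H2_dist f g \<le> 0" unfolding H2_dist_le[OF that] using \<open>f = g\<close> by simp
    moreover have "0 \<le> H2_dist f g" using that by (simp add: H2_dist_def H2_norm_nonneg H2_diff)
    ultimately show "H2_dist f g = 0" by simp
  qed
  show "H2_dist f h \<le> H2_dist f g + H2_dist g h" if "f \<in> H2" "g \<in> H2" "h \<in> H2" for f g h :: "complex^'a \<Rightarrow> complex"
    using H2_bound_add[OF H2_dist_bound[OF that(1,2)] H2_dist_bound[OF that(2,3)]] H2_dist_le[OF that(1,3)] by simp
qed

lemma H2_dist_pointwise: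
  fixes f :: "nat \<Rightarrow> complex^'d::finite \<Rightarrow> complex"
  assumes f: "\<And>n. f n \<in> H2" and g: "g \<in> H2" and lim: "(\<lambda>n. H2_dist (f n) g) \<longlonglongrightarrow> 0"
  shows "(\<lambda>n. f n z) \<longlonglongrightarrow> g z"
proof (cases "z \<in> DA_ball")
  case True
  obtain C where C: "\<And>f M. H2_bound M f \<Longrightarrow> cmod (f z) \<le> M * C" using H2_eval_bound[OF True] by blast
  have "(\<lambda>n. f n z - g z) \<longlonglongrightarrow> 0"
  proof (rule Lim_null_comparison)
    show "\<forall>\<^sub>F n in sequentially. cmod (f n z - g z) \<le> H2_dist (f n) g * C"
      using C[OF H2_dist_bound[OF f g]] by simp
    show "(\<lambda>n. H2_dist (f n) g * C) \<longlonglongrightarrow> 0" using tendsto_mult_right[OF lim, of C] by simp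
  qed
  then show ?thesis by (simp add: LIM_zero_iff)
next
  case False
  then have "f n z = 0" "g z = 0" for n using f g H2_outside H2_iff_bound by blast+
  then show ?thesis by simp
qed

text \<open>Bounded point evaluations make the sequence pointwise convergent. That the limit is also
  a norm limit follows because norm bounds survive pointwise limits.\<close>

lemma H2_complete:
  fixes f :: "nat \<Rightarrow> complex^'d::finite \<Rightarrow> complex"
  assumes f: "\<And>n. f n \<in> H2" and cau: "\<And>e. e > 0 \<Longrightarrow> \<exists>N. \<forall>n m. N \<le> n \<longrightarrow> N \<le> m \<longrightarrow> H2_dist (f n) (f m) < e"
  shows "\<exists>g\<in>H2. (\<lambda>n. H2_dist (f n) g) \<longlonglongrightarrow> 0"
proof -
  have "\<exists>l. (\<lambda>n. f n z) \<longlonglongrightarrow> l" for z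
  proof (cases "z \<in> DA_ball")
    case True
    obtain C where C: "C \<ge> 0" "\<And>f M. H2_bound M f \<Longrightarrow> cmod (f z) \<le> M * C" using H2_eval_bound[OF True] by blast
    have "Cauchy (\<lambda>n. f n z)"
    proof (rule CauchyI)
      fix e :: real assume e: "e > 0"
      then obtain N where N: "\<And>n m. N \<le> n \<Longrightarrow> N \<le> m \<Longrightarrow> H2_dist (f n) (f m) < e / (C + 1)"
        using cau[of "e / (C + 1)"] C(1) by auto
      have "cmod (f m z - f n z) < e" if "m \<ge> N" "n \<ge> N" for m n
      proof -
        have "cmod (f m z - f n z) \<le> H2_dist (f m) (f n) * C" using C(2)[OF H2_dist_bound[OF f f]] .
        also have "\<dots> \<le> e / (C + 1) * C" using N[OF that] C(1) by (intro mult_right_mono) auto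
        also have "\<dots> < e" using e C(1) by (simp add: field_simps)
        finally show ?thesis .
      qed
      then show "\<exists>M. \<forall>m\<ge>M. \<forall>n\<ge>M. cmod (f m z - f n z) < e" by blast
    qed
    then show ?thesis using Cauchy_convergent convergent_def by blast
  next
    case False
    then have "f n z = 0" for n using f H2_outside H2_iff_bound by blast
    then show ?thesis by auto
  qed
  then have "\<forall>z. \<exists>l. (\<lambda>n. f n z) \<longlonglongrightarrow> l" by blast
  from choice[OF this] obtain g where g: "\<And>z. (\<lambda>n. f n z) \<longlonglongrightarrow> g z" by blast
  have key: "\<exists>N. \<forall>n\<ge>N. H2_bound e (\<lambda>z. f n z - g z)" if "e > 0" for e
  proof -
    obtain N where N: "\<And>n m. N \<le> n \<Longrightarrow> N \<le> m \<Longrightarrow> H2_dist (f n) (f m) < e" using cau[OF \<open>e > 0\<close>] by blast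
    \<comment> \<open>Here \<open>n\<close> stays fixed and the second index of the Cauchy condition
      tends to infinity.\<close>
    have "H2_bound e (\<lambda>z. f n z - g z)" if n: "n \<ge> N" for n
    proof (rule H2_pointwise_weak(1)[of e "\<lambda>m z. f n z - f (m + N) z"])
      show "H2_bound e (\<lambda>z. f n z - f (m + N) z)" for m
        using N[OF n, of "m + N"] H2_dist_le[OF f f, of n "m + N" e] by simp
      show "(\<lambda>m. f n z - f (m + N) z) \<longlonglongrightarrow> f n z - g z" for z
        by (intro tendsto_intros LIMSEQ_ignore_initial_segment g)
    qed
    then show ?thesis by blast
  qed
  obtain N where "H2_bound 1 (\<lambda>z. f N z - g z)" using key[of 1] by auto
  then have "(\<lambda>z. f N z - (f N z - g z)) \<in> H2" using H2_diff[OF f[of N]] H2_iff_bound by blast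
  then have gH: "g \<in> H2" by simp
  have "(\<lambda>n. H2_dist (f n) g) \<longlonglongrightarrow> 0"
  proof (rule LIMSEQ_I)
    fix e :: real assume "e > 0"
    then obtain N where N: "\<And>n. n \<ge> N \<Longrightarrow> H2_bound (e/2) (\<lambda>z. f n z - g z)" using key[of "e/2"] by auto
    have "norm (H2_dist (f n) g - 0) < e" if "n \<ge> N" for n
    proof -
      have "H2_dist (f n) g \<le> e/2" using N[OF that] H2_dist_le[OF f gH] by blast
      moreover have "0 \<le> H2_dist (f n) g" by (rule Metric_space.nonneg[OF H2_Metric_space])
      ultimately show ?thesis using \<open>e > 0\<close> by simp
    qed
    then show "\<exists>no. \<forall>n\<ge>no. norm (H2_dist (f n) g - 0) < e" by blast
  qed
  then show ?thesis using gH by blast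
qed

text \<open>Closed graph theorem for multiplication operators, by the Baire category theorem.\<close>

lemma multiplier_bounded:
  fixes \<phi> :: "complex^'d::finite \<Rightarrow> complex"
  assumes \<phi>: "\<phi> \<in> multipliers"
  shows "\<exists>M. mult_bound M \<phi>"
proof -
  interpret H: Metric_space "H2 :: (complex^'d \<Rightarrow> complex) set" H2_dist by (rule H2_Metric_space)
  \<comment> \<open>The sets on which multiplication by \<open>\<phi>\<close> has norm at most
    \<open>n\<close>. They cover the space, and they are closed because norm convergence is
    pointwise convergence and norm bounds survive the latter.\<close>
  define V where "V n = {f \<in> H2. H2_bound (real n) (\<lambda>z. \<phi> z * f z)}" for n :: nat
  have lim: "limitin H.mtopology f g sequentially \<longleftrightarrow> g \<in> H2 \<and> (\<lambda>n. H2_dist (f n) g) \<longlonglongrightarrow> 0"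
    if "\<And>n. f n \<in> H2" for f g
    using that by (auto simp: H.limitin_metric_dist_null)
  have comp: "H.mcomplete" unfolding H.mcomplete_def
  proof (intro allI impI)
    fix f assume "H.MCauchy f"
    then have f: "\<And>n. f n \<in> H2" "\<And>e. e > 0 \<Longrightarrow> \<exists>N. \<forall>n m. N \<le> n \<longrightarrow> N \<le> m \<longrightarrow> H2_dist (f n) (f m) < e"
      by (auto simp: H.MCauchy_def)
    show "\<exists>g. limitin H.mtopology f g sequentially" using H2_complete[of f, OF f] lim[of f, OF f(1)] by blast
  qed
  have closed: "closedin H.mtopology (V n)" for n
    unfolding H.metric_closedin_iff_sequentially_closed
  proof (intro conjI allI impI)
    show "V n \<subseteq> H2" by (auto simp: V_def)
    fix f g assume "range f \<subseteq> V n \<and> limitin H.mtopology f g sequentially"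
    then have f: "\<And>n. f n \<in> H2" "\<And>k. H2_bound (real n) (\<lambda>z. \<phi> z * f k z)"
      and l: "limitin H.mtopology f g sequentially" by (auto simp: V_def)
    then have g: "g \<in> H2" "(\<lambda>n. H2_dist (f n) g) \<longlonglongrightarrow> 0" using lim[of f, OF f(1)] by auto
    have "H2_bound (real n) (\<lambda>z. \<phi> z * g z)"
      by (rule H2_pointwise_weak(1)[of _ "\<lambda>k z. \<phi> z * f k z"])
         (auto intro!: f tendsto_intros H2_dist_pointwise[of f, OF f(1) g])
    then show "g \<in> V n" using g by (simp add: V_def)
  qed
  have "\<Union>(range V) = H2"
  proof -
    have "f \<in> \<Union>(range V)" if f: "f \<in> H2" for f
    proof -
      have "(\<lambda>z. \<phi> z * f z) \<in> H2" using \<phi> f by (simp add: multipliers_def)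
      then obtain N where "H2_bound N (\<lambda>z. \<phi> z * f z)" using H2_iff_bound by blast
      moreover obtain n :: nat where "N \<le> real n" using real_arch_simple by blast
      ultimately show ?thesis using f H2_bound_mono by (auto simp: V_def)
    qed
    then show ?thesis by (auto simp: V_def)
  qed
  \<comment> \<open>The union of the closed sets is the whole space, whose interior is itself; it is
    non-empty as it contains \<open>DA_one\<close>.\<close>
  moreover have "H.mtopology interior_of H2 = (H2 :: (complex^'d \<Rightarrow> complex) set)"
    by (metis H.topspace_mtopology interior_of_topspace)
  moreover have "(DA_one :: complex^'d \<Rightarrow> complex) \<in> H2" using DA_one_H2 H2_iff_bound by blast
  ultimately have "H.mtopology interior_of \<Union>(range V) \<noteq> {}" by auto
  then have "\<not> (\<forall>n. H.mtopology interior_of (V n) = {})"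
    using H.metric_Baire_category_alt[OF comp, of "range V"] closed by auto
  then obtain n where "H.mtopology interior_of (V n) \<noteq> {}" by blast
  then obtain f0 U where "openin H.mtopology U" "U \<subseteq> V n" "f0 \<in> U" by (auto simp: interior_of_def)
  then obtain r where r: "r > 0" "H.mball f0 r \<subseteq> V n" "f0 \<in> H2"
    unfolding H.openin_mtopology by blast
  have f0: "H2_bound (real n) (\<lambda>z. \<phi> z * f0 z)" using r by (auto simp: V_def)
  have main: "H2_bound (4 * real n / r * N) (\<lambda>z. \<phi> z * f z)" if f: "H2_bound N f" for f N
  proof (cases "N = 0")
    case True
    then have "f = (\<lambda>_. 0)" using f H2_bound_0 by blast
    then show ?thesis using f True by simp
  next
    case False
    then have N: "N > 0" using f H2_bound_nonneg by fastforce
    \<comment> \<open>With this \<open>t\<close> the point \<open>f0 + t f\<close> has distance at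
      most \<open>r / 2\<close> from \<open>f0\<close>, so it lies in the open ball. Then
      \<open>\<phi> f\<close> is \<open>1 / t\<close> times a difference of two functions of norm at
      most \<open>n\<close>, which gives \<open>2 * n / t = 4 * n / r * N\<close>.\<close>
    define t where "t = r / (2 * N)"
    have t: "t > 0" using r N by (simp add: t_def)
    have fH: "f \<in> H2" using f H2_iff_bound by blast
    define h where "h = (\<lambda>z. f0 z + of_real t * f z)"
    have hH: "h \<in> H2" unfolding h_def using r(3) fH H2_add H2_scale by blast
    have e: "cmod (of_real t) * N = r / 2" using r(1) N unfolding norm_of_real by (simp add: t_def)
    have "H2_bound (r / 2) (\<lambda>z. of_real t * f z)"
      using H2_bound_scale[OF f, of "of_real t"] unfolding e .
    then have "H2_bound (r / 2) (\<lambda>z. h z - f0 z)" by (simp add: h_def)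
    then have "H2_dist h f0 \<le> r/2" using H2_dist_le[OF hH r(3)] by blast
    then have "h \<in> H.mball f0 r" using hH r H.commute[of h f0] by (simp add: H.in_mball)
    then have h: "H2_bound (real n) (\<lambda>z. \<phi> z * h z)" using r by (auto simp: V_def)
    have "H2_bound (cmod (of_real (1/t)) * (real n + real n)) (\<lambda>z. of_real (1/t) * (\<phi> z * h z - \<phi> z * f0 z))"
      by (intro H2_bound_scale H2_bound_diff h f0)
    moreover have "(\<lambda>z. of_real (1/t) * (\<phi> z * h z - \<phi> z * f0 z)) = (\<lambda>z. \<phi> z * f z)"
      using t by (auto simp: h_def algebra_simps fun_eq_iff)
    moreover have "cmod (of_real (1/t)) * (real n + real n) = 4 * real n / r * N"
      unfolding norm_of_real using N r(1) by (simp add: t_def field_simps)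
    ultimately show ?thesis by simp
  qed
  then show ?thesis using \<phi> unfolding mult_bound_def multipliers_def by blast
qed


section \<open>Algebra and weak-* limits of bounded multipliers\<close>

lemma mult_boundD: "mult_bound M \<phi> \<Longrightarrow> \<phi> \<in> multipliers"
proof -
  assume \<phi>: "mult_bound M \<phi>"
  have "(\<lambda>z. \<phi> z * f z) \<in> H2" if "f \<in> H2" for f
    using \<phi> H2_bound_norm[OF that] unfolding mult_bound_def H2_iff_bound by meson
  then show ?thesis using \<phi> by (simp add: mult_bound_def multipliers_def)
qed

lemma mult_bound_apply: "mult_bound M \<phi> \<Longrightarrow> H2_bound N f \<Longrightarrow> H2_bound (M * N) (\<lambda>z. \<phi> z * f z)"
  by (simp add: mult_bound_def)

text \<open>A multiplier is its own product with \<open>DA_one\<close>, a function of norm at most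
  1.\<close>

lemma mult_bound_H2: 
  assumes "mult_bound M \<phi>" shows "H2_bound M \<phi>"
proof -
  have "H2_bound (M * 1) (\<lambda>z. \<phi> z * DA_one z)" using assms DA_one_H2 by (rule mult_bound_apply)
  moreover have "(\<lambda>z. \<phi> z * DA_one z) = \<phi>" using assms by (auto simp: mult_bound_def DA_one_def fun_eq_iff)
  ultimately show ?thesis by simp
qed

lemma mult_bound_add:
  assumes "mult_bound M \<phi>" "mult_bound N \<psi>"
  shows "mult_bound (M + N) (\<lambda>z. \<phi> z + \<psi> z)"
  using assms H2_bound_add[OF mult_bound_apply[OF assms(1)] mult_bound_apply[OF assms(2)]]
  by (simp add: mult_bound_def distrib_right)

lemma mult_bound_scale:
  assumes "mult_bound M \<phi>"
  shows "mult_bound (cmod a * M) (\<lambda>z. a * \<phi> z)"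
  using assms H2_bound_scale[OF mult_bound_apply[OF assms]] by (simp add: mult_bound_def mult.assoc)

lemma mult_bound_diff:
  assumes "mult_bound M \<phi>" "mult_bound N \<psi>"
  shows "mult_bound (M + N) (\<lambda>z. \<phi> z - \<psi> z)"
  using mult_bound_add[OF assms(1) mult_bound_scale[OF assms(2), of "-1"]] by simp

lemma mult_bound_mult:
  assumes "mult_bound M \<phi>" "mult_bound N \<psi>"
  shows "mult_bound (M * N) (\<lambda>z. \<phi> z * \<psi> z)"
  using assms mult_bound_apply[OF assms(1) mult_bound_apply[OF assms(2)]] by (simp add: mult_bound_def mult.assoc)

lemma mult_bound_one: "mult_bound 1 DA_one"
proof -
  have "(\<lambda>z. DA_one z * f z) = f" if "H2_bound N f" for f :: "complex^'a \<Rightarrow> complex" and N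
    using H2_outside[OF that] by (auto simp: DA_one_def fun_eq_iff)
  then show ?thesis by (auto simp: mult_bound_def) (auto simp: DA_one_def)
qed

lemma mult_bound_coord: "mult_bound 1 (DA_coord j)"
  using H2_bound_coord by (auto simp: mult_bound_def) (auto simp: DA_coord_def)

text \<open>The exponent is a successor because \<open>\<phi> z ^ 0\<close> equals 1 off the ball as
  well, where a multiplier has to vanish.\<close>

lemma mult_bound_power: "mult_bound M \<phi> \<Longrightarrow> mult_bound (M ^ Suc n) (\<lambda>z. \<phi> z ^ Suc n)"
  by (induction n) (auto dest: mult_bound_mult)

lemma multipliers_iff: "\<phi> \<in> multipliers \<longleftrightarrow> (\<exists>M. mult_bound M \<phi>)"
  using mult_boundD multiplier_bounded by blast

lemma multipliers_outside: "\<phi> \<in> multipliers \<Longrightarrow> z \<notin> DA_ball \<Longrightarrow> \<phi> z = 0"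
  by (simp add: multipliers_def)

lemma multipliers_add: "\<phi> \<in> multipliers \<Longrightarrow> \<psi> \<in> multipliers \<Longrightarrow> (\<lambda>z. \<phi> z + \<psi> z) \<in> multipliers"
  unfolding multipliers_iff using mult_bound_add by blast

lemma multipliers_diff: "\<phi> \<in> multipliers \<Longrightarrow> \<psi> \<in> multipliers \<Longrightarrow> (\<lambda>z. \<phi> z - \<psi> z) \<in> multipliers"
  unfolding multipliers_iff using mult_bound_diff by blast

lemma multipliers_mult: "\<phi> \<in> multipliers \<Longrightarrow> \<psi> \<in> multipliers \<Longrightarrow> (\<lambda>z. \<phi> z * \<psi> z) \<in> multipliers"
  unfolding multipliers_iff using mult_bound_mult by blast

lemma multipliers_scale: "\<phi> \<in> multipliers \<Longrightarrow> (\<lambda>z. a * \<phi> z) \<in> multipliers"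
  unfolding multipliers_iff using mult_bound_scale by blast

lemma multipliers_one: "DA_one \<in> multipliers"
  unfolding multipliers_iff using mult_bound_one by blast

lemma multipliers_coord: "DA_coord j \<in> multipliers"
  unfolding multipliers_iff using mult_bound_coord by blast

lemma multipliers_zero: "(\<lambda>_. 0) \<in> multipliers"
  using multipliers_scale[OF multipliers_one, of 0] by simp

lemma mult_bound_limit:
  fixes \<phi> :: "nat \<Rightarrow> complex^'a::finite \<Rightarrow> complex"
  assumes \<phi>: "\<And>n. mult_bound M (\<phi> n)" and lim: "\<And>z. (\<lambda>n. \<phi> n z) \<longlonglongrightarrow> \<psi> z"
  shows "mult_bound M \<psi>"
  unfolding mult_bound_def
proof (intro conjI allI impI)
  fix z :: "complex^'a" assume "z \<notin> DA_ball"
  then have "\<phi> n z = 0" for n using \<phi>[of n] by (simp add: mult_bound_def)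
  then show "\<psi> z = 0" using lim[of z] by (simp add: LIMSEQ_const_iff)
next
  fix f :: "complex^'a \<Rightarrow> complex" and N assume f: "H2_bound N f"
  show "H2_bound (M * N) (\<lambda>z. \<psi> z * f z)"
    by (rule H2_pointwise_weak(1)[of _ "\<lambda>n z. \<phi> n z * f z"]) (auto intro!: mult_bound_apply[OF \<phi> f] tendsto_intros lim)
qed

text \<open>The multipliers are bounded in \<open>H2\<close>, so compactness there yields a
  pointwise limit, and \<open>mult_bound_limit\<close> returns the operator bound for it.\<close>

lemma mult_bound_subsequence:
  fixes \<phi> :: "nat \<Rightarrow> complex^'d::finite \<Rightarrow> complex"
  assumes \<phi>: "\<And>n. mult_bound M (\<phi> n)"
  shows "\<exists>r \<psi>. strict_mono (r::nat\<Rightarrow>nat) \<and> mult_bound M \<psi> \<and> (\<forall>z. (\<lambda>n. \<phi> (r n) z) \<longlonglongrightarrow> \<psi> z)"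
proof -
  obtain r :: "nat \<Rightarrow> nat" and \<psi> where r: "strict_mono r" "\<And>z. (\<lambda>n. \<phi> (r n) z) \<longlonglongrightarrow> \<psi> z"
    using H2_bounded_subsequence[of M \<phi>, OF mult_bound_H2[OF \<phi>]] by blast
  then show ?thesis using mult_bound_limit[of M "\<lambda>n. \<phi> (r n)", OF \<phi> r(2)] by blast
qed

lemma H2_norm_sq: "f \<in> H2 \<Longrightarrow> (H2_norm f)\<^sup>2 = Re (DA_inner f f)"
  using H2_norm_nonneg[of f] by (simp add: H2_norm_def)

text \<open>Dominated convergence for series: each term converges by weak convergence in
  \<open>H2\<close>, and the terms have a summable majorant independent of \<open>n\<close>.\<close>

lemma mult_pairing_limit:
  fixes \<phi> :: "nat \<Rightarrow> complex^'d::finite \<Rightarrow> complex"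
  assumes \<phi>: "\<And>n. mult_bound M (\<phi> n)" and lim: "\<And>z. (\<lambda>n. \<phi> n z) \<longlonglongrightarrow> \<psi> z"
    and fg: "\<And>n. f n \<in> H2" "\<And>n. g n \<in> H2" "summable (\<lambda>n. Re (DA_inner (f n) (f n)))" "summable (\<lambda>n. Re (DA_inner (g n) (g n)))"
  shows "(\<lambda>n. \<Sum>k. DA_inner (\<lambda>z. \<phi> n z * f k z) (g k)) \<longlonglongrightarrow> (\<Sum>k. DA_inner (\<lambda>z. \<psi> z * f k z) (g k))"
proof -
  let ?B = "\<lambda>k. M * ((H2_norm (f k))\<^sup>2 + (H2_norm (g k))\<^sup>2)"
  have M: "0 \<le> M" using H2_bound_nonneg[OF mult_bound_H2[OF \<phi>]] .
  have bnd: "cmod (DA_inner (\<lambda>z. \<phi> n z * f k z) (g k)) \<le> ?B k" for n k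
  proof -
    have "cmod (DA_inner (\<lambda>z. \<phi> n z * f k z) (g k)) \<le> M * H2_norm (f k) * H2_norm (g k)"
      by (intro DA_inner_le mult_bound_apply[OF \<phi>] H2_bound_norm fg)
    also have "\<dots> \<le> ?B k"
    proof -
      have "2 * (H2_norm (f k) * H2_norm (g k)) \<le> (H2_norm (f k))\<^sup>2 + (H2_norm (g k))\<^sup>2"
        using sum_squares_bound[of "H2_norm (f k)" "H2_norm (g k)"] by simp
      moreover have "0 \<le> H2_norm (f k) * H2_norm (g k)" by (intro mult_nonneg_nonneg H2_norm_nonneg fg)
      ultimately have "H2_norm (f k) * H2_norm (g k) \<le> (H2_norm (f k))\<^sup>2 + (H2_norm (g k))\<^sup>2" by linarith
      then show ?thesis using M by (simp add: mult.assoc mult_left_mono)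
    qed
    finally show ?thesis .
  qed
  have l: "(\<lambda>n. DA_inner (\<lambda>z. \<phi> n z * f k z) (g k)) \<longlonglongrightarrow> DA_inner (\<lambda>z. \<psi> z * f k z) (g k)" for k
    by (rule H2_pointwise_weak(2)[of "M * H2_norm (f k)"])
       (auto intro!: mult_bound_apply[OF \<phi>] H2_bound_norm fg tendsto_intros lim)
  have "summable ?B" using fg by (intro summable_mult summable_add) (simp_all add: H2_norm_sq)
  then show ?thesis
    using tannerys_theorem[of "\<lambda>k n. DA_inner (\<lambda>z. \<phi> n z * f k z) (g k)" "\<lambda>k. DA_inner (\<lambda>z. \<psi> z * f k z) (g k)" sequentially ?B] l bnd
    by (auto intro: always_eventually)
qed

text \<open>Eventual membership of \<open>\<phi> n\<close> holds for the generating sets by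
  \<open>mult_pairing_limit\<close> and is inherited by finite intersections and arbitrary unions.
  Hence the induction over the generated topology.\<close>

lemma mult_wstar_limit:
  fixes \<phi> :: "nat \<Rightarrow> complex^'d::finite \<Rightarrow> complex"
  assumes \<phi>: "\<And>n. mult_bound M (\<phi> n)" and lim: "\<And>z. (\<lambda>n. \<phi> n z) \<longlonglongrightarrow> \<psi> z"
  shows "limitin DA_wstar \<phi> \<psi> sequentially"
  unfolding limitin_def
proof (intro conjI allI impI)
  have \<psi>: "\<psi> \<in> multipliers" using mult_bound_limit[OF \<phi> lim] by (rule mult_boundD)
  let ?B = "{{\<phi>\<in>multipliers. (\<Sum>n. DA_inner (\<lambda>z. \<phi> z * f n z) (g n)) \<in> U} | f g U.
        (\<forall>n. (f n :: complex^'d \<Rightarrow> complex) \<in> H2 \<and> g n \<in> H2) \<and> summable (\<lambda>n. Re (DA_inner (f n) (f n)))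
        \<and> summable (\<lambda>n. Re (DA_inner (g n) (g n))) \<and> open U}"
  have z: "H2_bound 0 (\<lambda>_::complex^'d. 0)" using H2_bound_scale[OF DA_one_H2, of 0] by simp
  then have zz: "DA_inner (\<lambda>_::complex^'d. 0) (\<lambda>_. 0) = 0" using DA_inner_le[OF z z] by simp
  have zH: "(\<lambda>_::complex^'d. 0) \<in> H2" using z H2_iff_bound by blast
  \<comment> \<open>The zero sequences with \<open>U = UNIV\<close> exhibit the full set of
    multipliers as a generator, so \<open>\<psi>\<close> belongs to the underlying space of the
    topology.\<close>
  have "multipliers \<in> ?B"
    by (rule CollectI, rule exI[of _ "\<lambda>_ _. 0"], rule exI[of _ "\<lambda>_ _. 0"], rule exI[of _ UNIV]) (auto simp: zz zH)
  then show "\<psi> \<in> topspace DA_wstar" unfolding DA_wstar_def topology_generated_by_topspace using \<psi> by blast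
  fix W assume W: "openin DA_wstar W \<and> \<psi> \<in> W"
  then have "generate_topology_on ?B W" unfolding DA_wstar_def openin_topology_generated_by_iff by blast
  then have "\<psi> \<in> W \<longrightarrow> (\<forall>\<^sub>F n in sequentially. \<phi> n \<in> W)"
  proof (induction W rule: generate_topology_on.induct)
    case (UN K)
    show ?case
    proof
      assume "\<psi> \<in> \<Union>K"
      then obtain k where k: "k \<in> K" "\<psi> \<in> k" by blast
      then have "\<forall>\<^sub>F n in sequentially. \<phi> n \<in> k" using UN.IH by simp
      then show "\<forall>\<^sub>F n in sequentially. \<phi> n \<in> \<Union>K" by (rule eventually_mono) (use k in blast)
    qed
  next
    case (Basis s)
    then show ?case unfolding mem_Collect_eq
    proof (elim exE conjE, intro impI)
      fix f g U
      assume s: "s = {\<phi>\<in>multipliers. (\<Sum>n. DA_inner (\<lambda>z. \<phi> z * f n z) (g n)) \<in> U}"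
        and fg: "\<forall>n. f n \<in> H2 \<and> g n \<in> H2" "summable (\<lambda>n. Re (DA_inner (f n) (f n)))" "summable (\<lambda>n. Re (DA_inner (g n) (g n)))"
        and U: "open U" and "\<psi> \<in> s"
      have "(\<Sum>n. DA_inner (\<lambda>z. \<psi> z * f n z) (g n)) \<in> U" using \<open>\<psi> \<in> s\<close> by (simp add: s)
      moreover have "(\<lambda>n. \<Sum>k. DA_inner (\<lambda>z. \<phi> n z * f k z) (g k)) \<longlonglongrightarrow> (\<Sum>k. DA_inner (\<lambda>z. \<psi> z * f k z) (g k))"
        by (rule mult_pairing_limit[OF \<phi> lim]) (use fg in auto)
      ultimately have "\<forall>\<^sub>F n in sequentially. (\<Sum>k. DA_inner (\<lambda>z. \<phi> n z * f k z) (g k)) \<in> U"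
        using U topological_tendstoD by blast
      then show "\<forall>\<^sub>F n in sequentially. \<phi> n \<in> s" using mult_boundD[OF \<phi>] by (simp add: s)
    qed
  qed (auto intro: eventually_conj)
  then show "\<forall>\<^sub>F n in sequentially. \<phi> n \<in> W" using W by blast
qed

section \<open>Vanishing orders\<close>

text \<open>Just the regularity that the sum and product rules for \<open>cpartial\<close> consume.
  It is asked for at points of the ball only, because the functions at hand are extended by zero and
  may jump at the boundary.\<close>

fun smooth_upto :: "nat \<Rightarrow> (complex^'d::finite \<Rightarrow> complex) \<Rightarrow> bool" where
  "smooth_upto 0 f \<longleftrightarrow> True"
| "smooth_upto (Suc n) f \<longleftrightarrow>
     (\<forall>z\<in>DA_ball. \<forall>j. (\<lambda>t. f (z + t *s axis j 1)) field_differentiable (at 0)) \<and>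
     (\<forall>j. smooth_upto n (cpartial j f))"

definition smooth :: "(complex^'d::finite \<Rightarrow> complex) \<Rightarrow> bool" where
  "smooth f \<longleftrightarrow> (\<forall>n. smooth_upto n f)"

text \<open>The index counts strictly: all iterated partial derivatives of order less than
  \<open>n\<close> vanish at \<open>p\<close>. The ideal for \<open>\<kappa>\<close> therefore
  corresponds to index \<open>Suc \<kappa>\<close>.\<close>

fun vanishes :: "complex^'d::finite \<Rightarrow> nat \<Rightarrow> (complex^'d \<Rightarrow> complex) \<Rightarrow> bool" where
  "vanishes p 0 f \<longleftrightarrow> True"
| "vanishes p (Suc n) f \<longleftrightarrow> f p = 0 \<and> (\<forall>j. vanishes p n (cpartial j f))"

lemma eventually_coordinate_ball:
  "z \<in> DA_ball \<Longrightarrow> \<forall>\<^sub>F t in nhds 0. z + t *s axis j 1 \<in> DA_ball"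
proof -
  assume z: "z \<in> DA_ball"
  show ?thesis unfolding eventually_nhds_metric
    by (rule exI[of _ "1 - norm z"]) (use z coordinate_ball[OF z] in \<open>auto simp: DA_ball_def\<close>)
qed

text \<open>Off the ball \<open>cpartial\<close> may be the value of \<open>deriv\<close> at a point
  of non-differentiability, hence uncontrolled. Rules for derivatives thus hold only on the ball and
  can be iterated only because equality there, on an open set, determines the next derivatives
  there.\<close>

lemma cpartial_cong:
  assumes "\<And>z. z \<in> DA_ball \<Longrightarrow> f z = g z" "z \<in> DA_ball"
  shows "cpartial j f z = cpartial j g z"
  unfolding cpartial_def
  by (rule deriv_cong_ev[OF eventually_mono[OF eventually_coordinate_ball[OF assms(2)]]]) (use assms(1) in auto)

lemma field_differentiable_coordinate_cong:
  assumes "\<And>z. z \<in> DA_ball \<Longrightarrow> f z = g z" "z \<in> DA_ball"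
    and "(\<lambda>t. f (z + t *s axis j 1)) field_differentiable (at 0)"
  shows "(\<lambda>t. g (z + t *s axis j 1)) field_differentiable (at 0)"
proof -
  have "\<forall>\<^sub>F t in nhds 0. f (z + t *s axis j 1) = g (z + t *s axis j 1)"
    by (rule eventually_mono[OF eventually_coordinate_ball[OF assms(2)]]) (use assms(1) in auto)
  from DERIV_cong_ev[OF refl this refl] show ?thesis using assms(3) unfolding field_differentiable_def by simp
qed

lemma smooth_upto_cong:
  assumes "\<And>z. z \<in> DA_ball \<Longrightarrow> f z = g z" "smooth_upto n f"
  shows "smooth_upto n g"
  using assms
proof (induction n arbitrary: f g)
  case (Suc n)
  have "smooth_upto n (cpartial j g)" for j
    using Suc.IH[of "cpartial j f" "cpartial j g"] cpartial_cong[of f g, OF Suc.prems(1)] Suc.prems(2) by simp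
  then show ?case using field_differentiable_coordinate_cong[of f g, OF Suc.prems(1)] Suc.prems(2) by simp
qed simp

lemma vanishes_cong:
  assumes "\<And>z. z \<in> DA_ball \<Longrightarrow> f z = g z" "p \<in> DA_ball" "vanishes p n f"
  shows "vanishes p n g"
  using assms
proof (induction n arbitrary: f g)
  case (Suc n)
  have "vanishes p n (cpartial j g)" for j
    using Suc.IH[of "cpartial j f" "cpartial j g"] cpartial_cong[of f g, OF Suc.prems(1)] Suc.prems(2,3) by simp
  then show ?case using Suc.prems by simp
qed simp

lemma smooth_differentiable:
  "smooth f \<Longrightarrow> z \<in> DA_ball \<Longrightarrow> (\<lambda>t. f (z + t *s axis j 1)) field_differentiable (at 0)"
  unfolding smooth_def by (metis smooth_upto.simps(2))

lemma smooth_cpartial: "smooth f \<Longrightarrow> smooth (cpartial j f)"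
  unfolding smooth_def by (metis smooth_upto.simps(2))

lemma smooth_upto_mono: "smooth_upto (Suc n) f \<Longrightarrow> smooth_upto n f"
  by (induction n arbitrary: f) auto

lemma cpartial_add:
  assumes "z \<in> DA_ball" "(\<lambda>t. f (z + t *s axis j 1)) field_differentiable (at 0)"
    "(\<lambda>t. g (z + t *s axis j 1)) field_differentiable (at 0)"
  shows "cpartial j (\<lambda>z. f z + g z) z = cpartial j f z + cpartial j g z"
  unfolding cpartial_def using deriv_add[OF assms(2,3)] by simp

lemma cpartial_mult:
  assumes "z \<in> DA_ball" "(\<lambda>t. f (z + t *s axis j 1)) field_differentiable (at 0)"
    "(\<lambda>t. g (z + t *s axis j 1)) field_differentiable (at 0)"
  shows "cpartial j (\<lambda>z. f z * g z) z = f z * cpartial j g z + cpartial j f z * g z"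
  unfolding cpartial_def using deriv_mult[OF assms(2,3)] by simp

lemma smooth_upto_add:
  "smooth_upto n f \<Longrightarrow> smooth_upto n g \<Longrightarrow> smooth_upto n (\<lambda>z. f z + g z)"
proof (induction n arbitrary: f g)
  case (Suc n)
  have "smooth_upto n (cpartial j (\<lambda>z. f z + g z))" for j
    by (rule smooth_upto_cong[of "\<lambda>z. cpartial j f z + cpartial j g z"]) (use Suc cpartial_add in \<open>auto simp: cpartial_add\<close>)
  then show ?case using Suc.prems by (auto intro: field_differentiable_add)
qed simp

lemma smooth_upto_mult:
  "smooth_upto n f \<Longrightarrow> smooth_upto n g \<Longrightarrow> smooth_upto n (\<lambda>z. f z * g z)"
proof (induction n arbitrary: f g)
  case (Suc n)
  have "smooth_upto n f" "smooth_upto n g" using Suc.prems smooth_upto_mono by blast+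
  then have "smooth_upto n (\<lambda>z. f z * cpartial j g z + cpartial j f z * g z)" for j
    using Suc by (auto intro!: smooth_upto_add)
  then have "smooth_upto n (cpartial j (\<lambda>z. f z * g z))" for j
    by (rule smooth_upto_cong[rotated]) (use Suc.prems in \<open>auto simp: cpartial_mult\<close>)
  then show ?case using Suc.prems by (auto intro: field_differentiable_mult)
qed simp

lemma cpartial_const: "cpartial j (\<lambda>_. c) = (\<lambda>_. 0)"
  by (auto simp: cpartial_def fun_eq_iff)

lemma smooth_upto_const: "smooth_upto n (\<lambda>_. c)"
  by (induction n arbitrary: c) (auto simp: cpartial_const)

lemma smooth_add: "smooth f \<Longrightarrow> smooth g \<Longrightarrow> smooth (\<lambda>z. f z + g z)"
  by (simp add: smooth_def smooth_upto_add)

lemma smooth_mult: "smooth f \<Longrightarrow> smooth g \<Longrightarrow> smooth (\<lambda>z. f z * g z)"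
  by (simp add: smooth_def smooth_upto_mult)

lemma smooth_const: "smooth (\<lambda>_. c)"
  by (simp add: smooth_def smooth_upto_const)

lemma smooth_diff: "smooth f \<Longrightarrow> smooth g \<Longrightarrow> smooth (\<lambda>z. f z - g z)"
  using smooth_add[OF _ smooth_mult[OF smooth_const[of "-1"]], of f g] by simp

lemma smooth_power: "smooth f \<Longrightarrow> smooth (\<lambda>z. f z ^ n)"
  by (induction n) (auto simp: smooth_const intro: smooth_mult)

lemma smooth_upto_series: "ps_conv c \<Longrightarrow> smooth_upto n (DA_series c)"
proof (induction n arbitrary: c)
  case (Suc n)
  have "smooth_upto n (cpartial j (DA_series c))" for j
  proof (rule smooth_upto_cong)
    show "smooth_upto n (DA_series (ps_deriv j c))" using Suc ps_conv_deriv by blast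
    show "DA_series (ps_deriv j c) z = cpartial j (DA_series c) z" if "z \<in> DA_ball" for z
      unfolding cpartial_def using DERIV_imp_deriv[OF ps_termwise_deriv(1)[OF Suc.prems that]] by simp
  qed
  then show ?case using ps_termwise_deriv(1)[OF Suc.prems] unfolding smooth_upto.simps field_differentiable_def by blast
qed simp

lemma smooth_multiplier: "\<phi> \<in> multipliers \<Longrightarrow> smooth \<phi>"
proof -
  assume "\<phi> \<in> multipliers"
  then obtain M where "mult_bound M \<phi>" using multiplier_bounded by blast
  then obtain c where "coeff_bound M c" "\<phi> = DA_series c" using mult_bound_H2 by (auto simp: H2_bound_def)
  then show ?thesis using smooth_upto_series coeff_bound_ps_conv by (auto simp: smooth_def)
qed

lemma vanishes_antimono: "vanishes p (Suc n) f \<Longrightarrow> vanishes p n f"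
  by (induction n arbitrary: f) auto

lemma vanishes_add:
  assumes "p \<in> DA_ball"
  shows "smooth f \<Longrightarrow> smooth g \<Longrightarrow> vanishes p n f \<Longrightarrow> vanishes p n g \<Longrightarrow> vanishes p n (\<lambda>z. f z + g z)"
proof (induction n arbitrary: f g)
  case (Suc n)
  have "vanishes p n (cpartial j (\<lambda>z. f z + g z))" for j
  proof (rule vanishes_cong[OF _ assms])
    show "vanishes p n (\<lambda>z. cpartial j f z + cpartial j g z)"
      using Suc by (auto intro!: Suc.IH smooth_cpartial)
  qed (use Suc.prems in \<open>auto simp: cpartial_add smooth_differentiable\<close>)
  then show ?case using Suc.prems by simp
qed simp

text \<open>Orders of vanishing add by the Leibniz rule: each of the two terms of a derivative loses
  one order in one factor, so an induction on the total order applies.\<close>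

lemma vanishes_mult:
  assumes "p \<in> DA_ball"
  shows "smooth f \<Longrightarrow> smooth g \<Longrightarrow> vanishes p a f \<Longrightarrow> vanishes p b g \<Longrightarrow> vanishes p (a + b) (\<lambda>z. f z * g z)"
proof (induction "a + b" arbitrary: a b f g)
  case (Suc n)
  have 1: "vanishes p n (\<lambda>z. f z * cpartial j g z)" for j
  proof (cases b)
    case 0
    \<comment> \<open>There is no order left to take from the differentiated factor, so the other
      one, of order \<open>Suc n\<close>, is weakened to \<open>n\<close>.\<close>
    then show ?thesis using Suc.hyps(1)[of n 0 f "cpartial j g"] Suc.hyps(2) Suc.prems
      by (auto intro: smooth_cpartial vanishes_antimono)
  next
    case (Suc b')
    then show ?thesis using Suc.hyps(1)[of a b' f "cpartial j g"] Suc.hyps(2) Suc.prems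
      by (auto intro: smooth_cpartial)
  qed
  have 2: "vanishes p n (\<lambda>z. cpartial j f z * g z)" for j
  proof (cases a)
    case 0
    then show ?thesis using Suc.hyps(1)[of 0 n "cpartial j f" g] Suc.hyps(2) Suc.prems
      by (auto intro: smooth_cpartial vanishes_antimono)
  next
    case (Suc a')
    then show ?thesis using Suc.hyps(1)[of a' b "cpartial j f" g] Suc.hyps(2) Suc.prems
      by (auto intro: smooth_cpartial)
  qed
  have "vanishes p n (cpartial j (\<lambda>z. f z * g z))" for j
  proof (rule vanishes_cong[OF _ assms])
    show "vanishes p n (\<lambda>z. f z * cpartial j g z + cpartial j f z * g z)"
      using Suc.prems by (intro vanishes_add assms 1 2 smooth_mult smooth_cpartial)
  qed (use Suc.prems in \<open>auto simp: cpartial_mult smooth_differentiable\<close>)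
  moreover have "f p * g p = 0" using Suc.hyps(2) Suc.prems(3,4) by (cases a; cases b) auto
  ultimately show ?case using Suc.hyps(2)[symmetric] by simp
qed simp

lemma vanishes_power:
  assumes "p \<in> DA_ball" "smooth f" "f p = 0"
  shows "vanishes p n (\<lambda>z. f z ^ n)"
proof (induction n)
  case (Suc n)
  have "vanishes p (1 + n) (\<lambda>z. f z * f z ^ n)"
    using assms Suc by (intro vanishes_mult smooth_power) auto
  then show ?case by simp
qed simp

lemma vanishes_scale_left:
  assumes "p \<in> DA_ball" "smooth f" "smooth g" "vanishes p n g"
  shows "vanishes p n (\<lambda>z. f z * g z)"
  using vanishes_mult[OF assms(1,2,3), of 0 n] assms(4) by simp

text \<open>Every differentiation costs one order. The surplus \<open>m\<close> makes the induction
  go through, since a member at level \<open>k\<close> still has to be differentiated once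
  more.\<close>

lemma vanishes_derivs_upto:
  "vanishes p (Suc k + m) f \<Longrightarrow> g \<in> derivs_upto k f \<Longrightarrow> vanishes p (Suc m) g"
proof (induction k arbitrary: m g)
  case (Suc k)
  have IH: "vanishes p (Suc (Suc m)) h" if "h \<in> derivs_upto k f" for h
    using Suc.IH[of "Suc m" h] that Suc.prems(1) by simp
  show ?case
  proof (cases "g \<in> derivs_upto k f")
    case True
    then show ?thesis using IH vanishes_antimono by blast
  next
    case False
    then obtain j h where "g = cpartial j h" "h \<in> derivs_upto k f" using Suc.prems(2) by auto
    then show ?thesis using IH[of h] by simp
  qed
qed simp

lemma vanish_idealI:
  assumes "\<psi> \<in> multipliers" "\<And>p. p \<in> \<Lambda> \<Longrightarrow> vanishes p (Suc \<kappa>) \<psi>"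
  shows "\<psi> \<in> vanish_ideal \<kappa> \<Lambda>"
  unfolding vanish_ideal_def using assms vanishes_derivs_upto[of _ \<kappa> 0 \<psi>] by fastforce

text \<open>Equality of Taylor polynomials of degree less than \<open>N\<close> at \<open>p\<close>,
  that is, congruence modulo functions vanishing to order \<open>N\<close>.\<close>

definition jet_eq :: "nat \<Rightarrow> complex^'d::finite \<Rightarrow> (complex^'d \<Rightarrow> complex) \<Rightarrow> (complex^'d \<Rightarrow> complex) \<Rightarrow> bool" where
  "jet_eq N p f g \<longleftrightarrow> vanishes p N (\<lambda>z. f z - g z)"

lemma vanishes_zero: "vanishes p n (\<lambda>_. 0)"
  by (induction n) (auto simp: cpartial_const)

lemma jet_eq_refl: "jet_eq N p f f"
  by (simp add: jet_eq_def vanishes_zero)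

lemma jet_eq_add:
  assumes "p \<in> DA_ball" "smooth f" "smooth g" "smooth f'" "smooth g'" "jet_eq N p f f'" "jet_eq N p g g'"
  shows "jet_eq N p (\<lambda>z. f z + g z) (\<lambda>z. f' z + g' z)"
  using vanishes_add[OF assms(1) smooth_diff[OF assms(2,4)] smooth_diff[OF assms(3,5)]] assms(6,7)
  unfolding jet_eq_def by (simp add: algebra_simps)

lemma jet_eq_mult:
  assumes "p \<in> DA_ball" "smooth f" "smooth g" "smooth f'" "smooth g'" "jet_eq N p f f'" "jet_eq N p g g'"
  shows "jet_eq N p (\<lambda>z. f z * g z) (\<lambda>z. f' z * g' z)"
proof -
  have "vanishes p N (\<lambda>z. g z * (f z - f' z) + f' z * (g z - g' z))"
    using assms unfolding jet_eq_def
    by (intro vanishes_add vanishes_scale_left smooth_mult smooth_diff) auto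
  moreover have "(\<lambda>z. g z * (f z - f' z) + f' z * (g z - g' z)) = (\<lambda>z. f z * g z - f' z * g' z)"
    by (auto simp: algebra_simps)
  ultimately show ?thesis by (simp add: jet_eq_def)
qed

lemma jet_eq_scale:
  assumes "p \<in> DA_ball" "smooth f" "smooth g" "jet_eq N p f g"
  shows "jet_eq N p (\<lambda>z. a * f z) (\<lambda>z. a * g z)"
  using jet_eq_mult[of p "\<lambda>_. a" f "\<lambda>_. a" g] assms smooth_const jet_eq_refl by blast

lemma jet_eq_trans:
  assumes "p \<in> DA_ball" "smooth f" "smooth g" "smooth h" "jet_eq N p f g" "jet_eq N p g h"
  shows "jet_eq N p f h"
  using vanishes_add[OF assms(1) smooth_diff[OF assms(2,3)] smooth_diff[OF assms(3,4)]] assms(5,6)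
  unfolding jet_eq_def by simp

lemma jet_eq_sym:
  assumes "p \<in> DA_ball" "smooth f" "smooth g" "jet_eq N p f g"
  shows "jet_eq N p g f"
  using vanishes_scale_left[OF assms(1) smooth_const[of "-1"] smooth_diff[OF assms(2,3)]] assms(4)
  unfolding jet_eq_def by simp

lemma jet_eq_ball:
  assumes "p \<in> DA_ball" "\<And>z. z \<in> DA_ball \<Longrightarrow> f z = g z"
  shows "jet_eq N p f g"
  unfolding jet_eq_def by (rule vanishes_cong[OF _ assms(1) vanishes_zero]) (use assms(2) in auto)

text \<open>The polynomial \<open>1 - (1 - x^N)^N\<close> is congruent to \<open>0\<close> modulo \<open>x^N\<close> and to \<open>1\<close>
  modulo \<open>(1 - x)^N\<close>: it turns a multiplier with values in \<open>{0, 1}\<close> on \<open>\<Lambda>\<close>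
  into one which is constant to order \<open>N\<close> at each point of \<open>\<Lambda>\<close>.\<close>

definition flatten :: "nat \<Rightarrow> (complex^'d::finite \<Rightarrow> complex) \<Rightarrow> complex^'d \<Rightarrow> complex" where
  "flatten N \<phi> z = DA_one z - (DA_one z - \<phi> z ^ N) ^ N"

text \<open>The new bound depends on \<open>M\<close> and \<open>\<kappa>\<close> only, so
  flattening keeps a bounded sequence bounded and weak-* limits can be taken afterwards.\<close>

lemma flatten_multiplier:
  assumes "mult_bound M \<phi>"
  shows "mult_bound (1 + (1 + M ^ Suc \<kappa>) ^ Suc \<kappa>) (flatten (Suc \<kappa>) \<phi>)"
  unfolding flatten_def[abs_def] by (intro mult_bound_diff mult_bound_power mult_bound_one assms)

lemma smooth_one: "smooth DA_one"
  by (rule smooth_multiplier[OF multipliers_one])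

text \<open>The inner exponent does the work: \<open>\<phi> z ^ N\<close> vanishes to order
  \<open>N\<close>, so the base of the outer power is congruent to 1, and so are all its
  powers.\<close>

lemma flatten_0:
  assumes "p \<in> DA_ball" "smooth \<phi>" "\<phi> p = 0"
  shows "jet_eq N p (flatten N \<phi>) (\<lambda>_. 0)"
proof -
  have s: "smooth (\<lambda>z. DA_one z - \<phi> z ^ N)" using assms by (intro smooth_diff smooth_power smooth_one)
  have 1: "jet_eq N p (\<lambda>z. DA_one z - \<phi> z ^ N) (\<lambda>_. 1)"
    unfolding jet_eq_def
    by (rule vanishes_cong[OF _ assms(1) vanishes_scale_left[OF assms(1) smooth_const[of "-1"] _ vanishes_power[OF assms]]])
       (auto simp: DA_one_def intro: smooth_power assms)
  have 2: "jet_eq N p (\<lambda>z. (DA_one z - \<phi> z ^ N) ^ n) (\<lambda>_. 1)" for n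
  proof (induction n)
    case (Suc n)
    show ?case using jet_eq_mult[OF assms(1) s smooth_power[OF s] smooth_const smooth_const 1 Suc] by simp
  qed (simp add: jet_eq_refl)
  show ?thesis unfolding jet_eq_def
    by (rule vanishes_cong[OF _ assms(1) vanishes_scale_left[OF assms(1) smooth_const[of "-1"] smooth_diff[OF smooth_power[OF s] smooth_const] 2[of N, unfolded jet_eq_def]]])
       (auto simp: flatten_def DA_one_def)
qed

text \<open>Here the outer exponent does the work: the base \<open>DA_one z - \<phi> z ^ N\<close>
  vanishes at \<open>p\<close>, hence its power vanishes to order \<open>N\<close>.\<close>

lemma flatten_1:
  assumes "p \<in> DA_ball" "smooth \<phi>" "\<phi> p = 1"
  shows "jet_eq N p (flatten N \<phi>) (\<lambda>_. 1)"
proof -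
  have s: "smooth (\<lambda>z. DA_one z - \<phi> z ^ N)" using assms by (intro smooth_diff smooth_power smooth_one)
  have "vanishes p N (\<lambda>z. (DA_one z - \<phi> z ^ N) ^ N)"
    by (rule vanishes_power[OF assms(1) s]) (use assms in \<open>auto simp: DA_one_def\<close>)
  from vanishes_scale_left[OF assms(1) smooth_const[of "-1"] smooth_power[OF s] this]
  show ?thesis unfolding jet_eq_def
    by (rule vanishes_cong[OF _ assms(1), rotated]) (auto simp: flatten_def DA_one_def)
qed

section \<open>Hilbert spaces\<close>

lemma cscale_zero_left: "cscale 0 x = (0::'a::chilbert)"
  using cscale_add_left[of 0 0 x] by simp

lemma cscale_zero_right: "cscale a 0 = (0::'a::chilbert)"
  using cscale_add_right[of a "0::'a" 0] by simp

lemma cscale_minus_one: "cscale (-1) x = - (x::'a::chilbert)"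
proof -
  have "cscale (-1) x + x = 0" using cscale_add_left[of "-1" 1 x] by (simp add: cscale_one cscale_zero_left)
  then show ?thesis by (simp add: eq_neg_iff_add_eq_0)
qed

lemma cscale_minus_right: "cscale a (- x) = - cscale a (x::'a::chilbert)"
  using cscale_add_right[of a x "-x"] by (simp add: cscale_zero_right eq_neg_iff_add_eq_0 add.commute)

lemma cscale_diff_right: "cscale a (x - y) = cscale a x - cscale a (y::'a::chilbert)"
  using cscale_add_right[of a x "-y"] by (simp add: cscale_minus_right)

lemma cinner_zero_left: "cinner 0 (y::'a::chilbert) = 0"
  using cinner_add_left[of 0 0 y] by simp

lemma cinner_zero_right: "cinner (y::'a::chilbert) 0 = 0"
  using cinner_conj[of y 0] by (simp add: cinner_zero_left)

lemma cinner_minus_left: "cinner (- x) (y::'a::chilbert) = - cinner x y"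
  using cinner_add_left[of x "-x" y] by (simp add: cinner_zero_left eq_neg_iff_add_eq_0 add.commute)

lemma cinner_diff_left: "cinner (x - y) (z::'a::chilbert) = cinner x z - cinner y z"
  using cinner_add_left[of x "-y" z] by (simp add: cinner_minus_left)

lemma cinner_add_right: "cinner (x::'a::chilbert) (y + z) = cinner x y + cinner x z"
  by (subst (1 2 3) cinner_conj) (simp add: cinner_add_left)

lemma cinner_diff_right: "cinner (x::'a::chilbert) (y - z) = cinner x y - cinner x z"
  by (subst (1 2 3) cinner_conj) (simp add: cinner_diff_left)

lemma cinner_cscale_right: "cinner (x::'a::chilbert) (cscale a y) = cnj a * cinner x y"
  by (subst (1 2) cinner_conj) (simp add: cinner_cscale_left)

lemma cinner_sum_left: "cinner (\<Sum>i\<in>F. f i) (y::'a::chilbert) = (\<Sum>i\<in>F. cinner (f i) y)"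
  by (induction F rule: infinite_finite_induct) (auto simp: cinner_zero_left cinner_add_left)

lemma cscale_sum_right: "cscale a (\<Sum>i\<in>F. f i :: 'a::chilbert) = (\<Sum>i\<in>F. cscale a (f i))"
  by (induction F rule: infinite_finite_induct) (auto simp: cscale_zero_right cscale_add_right)

lemma cnorm_sq: "(cnorm x)\<^sup>2 = Re (cinner x (x::'a::chilbert))"
  by (simp add: cnorm_def cinner_nonneg)

lemma cnorm_nonneg: "0 \<le> cnorm (x::'a::chilbert)"
  by (simp add: cnorm_def cinner_nonneg)

lemma cinner_self: "cinner x (x::'a::chilbert) = complex_of_real ((cnorm x)\<^sup>2)"
  using cinner_conj[of x x] unfolding cnorm_sq by (simp add: complex_eq_iff)

lemma cnorm_eq_0: "cnorm (x::'a::chilbert) = 0 \<longleftrightarrow> x = 0"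
  using cinner_eq_zero[of x] cinner_self[of x] by simp

lemma cnorm_zero: "cnorm (0::'a::chilbert) = 0"
  by (simp add: cnorm_eq_0)

lemma cnorm_cscale: "cnorm (cscale a x) = cmod a * cnorm (x::'a::chilbert)"
proof -
  have "cinner (cscale a x) (cscale a x) = complex_of_real ((cmod a)\<^sup>2) * cinner x x"
    unfolding cinner_cscale_left cinner_cscale_right complex_norm_square by simp
  then have "(cnorm (cscale a x))\<^sup>2 = (cmod a * cnorm x)\<^sup>2" by (simp add: cnorm_sq power_mult_distrib)
  then show ?thesis by (rule power2_eq_imp_eq) (simp_all add: cnorm_nonneg)
qed

lemma cnorm_minus: "cnorm (- x) = cnorm (x::'a::chilbert)"
  using cnorm_cscale[of "-1" x] by (simp add: cscale_minus_one)

lemma cnorm_minus_commute: "cnorm (x - y) = cnorm (y - x::'a::chilbert)"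
  using cnorm_minus[of "x - y"] by simp

lemma cnorm_add_sq: "(cnorm (x + y))\<^sup>2 = (cnorm x)\<^sup>2 + 2 * Re (cinner x y) + (cnorm (y::'a::chilbert))\<^sup>2"
proof -
  have "Re (cinner y x) = Re (cinner x y)" by (subst cinner_conj) simp
  then show ?thesis by (simp add: cnorm_sq cinner_add_left cinner_add_right)
qed

lemma cauchy_schwarz: "cmod (cinner x y) \<le> cnorm x * cnorm (y::'a::chilbert)"
proof (cases "y = 0")
  case False
  then have n: "cnorm y > 0" using cnorm_nonneg[of y] cnorm_eq_0[of y] by linarith
  \<comment> \<open>The coefficient for which \<open>x + cscale a y\<close> is orthogonal to
    \<open>y\<close>, so that the norm is minimal.\<close>
  define a where "a = - cinner x y / of_real ((cnorm y)\<^sup>2)"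
  have "0 \<le> (cnorm (x + cscale a y))\<^sup>2" by simp
  also have "\<dots> = (cnorm x)\<^sup>2 + 2 * Re (cnj a * cinner x y) + (cmod a)\<^sup>2 * (cnorm y)\<^sup>2"
    by (simp add: cnorm_add_sq cinner_cscale_right cnorm_cscale power_mult_distrib)
  also have "cnj a * cinner x y = - of_real ((cmod (cinner x y))\<^sup>2 / (cnorm y)\<^sup>2)"
    unfolding of_real_divide complex_norm_square[of "cinner x y"] by (simp add: a_def)
  also have "(cmod a)\<^sup>2 * (cnorm y)\<^sup>2 = (cmod (cinner x y))\<^sup>2 / (cnorm y)\<^sup>2"
  proof -
    have "cmod a = cmod (cinner x y) / (cnorm y)\<^sup>2" unfolding a_def norm_divide norm_minus_cancel norm_of_real by simp
    then show ?thesis using n by (simp add: power_divide power2_eq_square)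
  qed
  finally have "(cmod (cinner x y))\<^sup>2 / (cnorm y)\<^sup>2 \<le> (cnorm x)\<^sup>2" by simp
  then have "(cmod (cinner x y))\<^sup>2 \<le> (cnorm x * cnorm y)\<^sup>2" using n by (simp add: divide_le_eq power_mult_distrib)
  then show ?thesis by (rule power2_le_imp_le) (simp add: cnorm_nonneg)
qed (simp add: cinner_zero_right cnorm_zero)

lemma cnorm_triangle: "cnorm (x + y) \<le> cnorm x + cnorm (y::'a::chilbert)"
proof -
  have "Re (cinner x y) \<le> cnorm x * cnorm y" using cauchy_schwarz[of x y] complex_Re_le_cmod order_trans by blast
  then have "(cnorm (x + y))\<^sup>2 \<le> (cnorm x + cnorm y)\<^sup>2" by (simp add: cnorm_add_sq power2_sum)
  then show ?thesis using cnorm_nonneg by (meson add_nonneg_nonneg power2_le_imp_le)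
qed

lemma cnorm_sum: "cnorm (\<Sum>i\<in>F. f i :: 'a::chilbert) \<le> (\<Sum>i\<in>F. cnorm (f i))"
proof (induction F rule: infinite_finite_induct)
  case (insert x F)
  then show ?case using cnorm_triangle[of "f x" "sum f F"] by simp
qed (simp_all add: cnorm_zero)

text \<open>The class \<open>chilbert\<close> carries no topology, so norm convergence is expressed
  by a real null sequence.\<close>

definition cconv :: "(nat \<Rightarrow> 'a::chilbert) \<Rightarrow> 'a \<Rightarrow> bool" where
  "cconv X L \<longleftrightarrow> (\<lambda>n. cnorm (X n - L)) \<longlonglongrightarrow> 0"

lemma cconvI:
  assumes "\<And>n. cnorm (X n - L) \<le> e n" "e \<longlonglongrightarrow> 0"
  shows "cconv X L"
  unfolding cconv_def by (rule tendsto_sandwich[OF always_eventually always_eventually tendsto_const assms(2)]) (use assms cnorm_nonneg in auto)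

lemma cconv_cinner:
  assumes "cconv X L"
  shows "(\<lambda>n. cinner (X n) y) \<longlonglongrightarrow> cinner L y"
proof -
  have "(\<lambda>n. cinner (X n) y - cinner L y) \<longlonglongrightarrow> 0"
  proof (rule Lim_null_comparison)
    show "\<forall>\<^sub>F n in sequentially. cmod (cinner (X n) y - cinner L y) \<le> cnorm (X n - L) * cnorm y"
      using cauchy_schwarz[of _ y] by (auto simp: cinner_diff_left[symmetric])
    show "(\<lambda>n. cnorm (X n - L) * cnorm y) \<longlonglongrightarrow> 0"
      using tendsto_mult_right[OF assms[unfolded cconv_def], of "cnorm y"] by simp
  qed
  then show ?thesis by (simp add: LIM_zero_iff)
qed

lemma cinner_ext: "(\<And>y. cinner x y = cinner x' y) \<Longrightarrow> x = (x'::'a::chilbert)"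
  using cinner_eq_zero[of "x - x'"] by (simp add: cinner_diff_left)

lemma cconv_unique: "cconv X L \<Longrightarrow> cconv X L' \<Longrightarrow> L = L'"
  by (rule cinner_ext) (meson LIMSEQ_unique cconv_cinner)

lemma cconv_const: "cconv (\<lambda>_. x) x"
  by (simp add: cconv_def cnorm_zero)

lemma cconv_add: "cconv X L \<Longrightarrow> cconv Y K \<Longrightarrow> cconv (\<lambda>n. X n + Y n) (L + K)"
proof -
  assume "cconv X L" "cconv Y K"
  then have "(\<lambda>n. cnorm (X n - L) + cnorm (Y n - K)) \<longlonglongrightarrow> 0 + 0" unfolding cconv_def by (intro tendsto_add)
  moreover have "cnorm (X n + Y n - (L + K)) \<le> cnorm (X n - L) + cnorm (Y n - K)" for n
    using cnorm_triangle[of "X n - L" "Y n - K"] by (simp add: algebra_simps)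
  ultimately show ?thesis by (intro cconvI) auto
qed

lemma cconv_cscale: "cconv X L \<Longrightarrow> cconv (\<lambda>n. cscale a (X n)) (cscale a L)"
  unfolding cconv_def by (simp add: cscale_diff_right[symmetric] cnorm_cscale tendsto_mult_right_zero)

lemma cconv_norm: "cconv X L \<Longrightarrow> (\<lambda>n. cnorm (X n)) \<longlonglongrightarrow> cnorm L"
proof -
  assume L: "cconv X L"
  have "(\<lambda>n. cnorm (X n) - cnorm L) \<longlonglongrightarrow> 0"
  proof (rule Lim_null_comparison[OF always_eventually])
    show "\<forall>n. norm (cnorm (X n) - cnorm L) \<le> cnorm (X n - L)"
      using cnorm_triangle[of "X _ - L" L] cnorm_triangle[of "L - X _" "X _"] cnorm_minus_commute
      by (metis abs_le_iff diff_add_cancel diff_le_eq minus_diff_eq real_norm_def)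
  qed (use L in \<open>simp add: cconv_def\<close>)
  then show ?thesis by (simp add: LIM_zero_iff)
qed

lemma cconv_complete:
  assumes "\<And>e. e > 0 \<Longrightarrow> \<exists>N. \<forall>m\<ge>N. \<forall>n\<ge>N. cnorm (X m - X n) < e"
  shows "\<exists>L. cconv X (L::'a::chilbert)"
proof -
  have "\<exists>N::nat. \<forall>m\<ge>N. \<forall>n\<ge>N. Re (cinner (X m - X n) (X m - X n)) < e" if "e > 0" for e
  proof -
    have "sqrt e > 0" using that by simp
    from assms[OF this] show ?thesis unfolding cnorm_def real_sqrt_less_iff .
  qed
  then obtain L where L: "\<And>e. e > 0 \<Longrightarrow> \<exists>N. \<forall>n\<ge>N. Re (cinner (X n - L) (X n - L)) < e"
    using cinner_complete[of X] by auto
  have "cconv X L" unfolding cconv_def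
  proof (rule LIMSEQ_I)
    fix r :: real assume r: "r > 0"
    obtain N where N: "\<And>n. n \<ge> N \<Longrightarrow> Re (cinner (X n - L) (X n - L)) < r\<^sup>2" using L[of "r\<^sup>2"] r by auto
    have "norm (cnorm (X n - L) - 0) < r" if "n \<ge> N" for n
      using N[OF that] r cnorm_nonneg[of "X n - L"] unfolding cnorm_sq[symmetric]
      by (simp add: power2_less_imp_less)
    then show "\<exists>no. \<forall>n\<ge>no. norm (cnorm (X n - L) - 0) < r" by blast
  qed
  then show ?thesis by blast
qed

text \<open>The bound on the limit is included because it later becomes the operator bound of a
  series of operators.\<close>

lemma cseries_conv:
  fixes x :: "nat \<Rightarrow> 'a::chilbert"
  assumes "summable b" "\<And>n. cnorm (x n) \<le> b n"
  shows "\<exists>L. cconv (\<lambda>n. \<Sum>i<n. x i) L \<and> cnorm L \<le> suminf b"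
proof -
  have b0: "0 \<le> b n" for n using assms(2)[of n] cnorm_nonneg[of "x n"] by simp
  have "\<exists>L. cconv (\<lambda>n. \<Sum>i<n. x i) L"
  proof (rule cconv_complete)
    fix e :: real assume "e > 0"
    then obtain N where N: "\<And>m n. m \<ge> N \<Longrightarrow> norm (sum b {m..<n}) < e"
      using assms(1) unfolding summable_Cauchy by blast
    have 1: "cnorm ((\<Sum>i<n. x i) - (\<Sum>i<m. x i)) < e" if "m \<ge> N" "m \<le> n" for m n
    proof -
      have "(\<Sum>i<n. x i) - (\<Sum>i<m. x i) = (\<Sum>i\<in>{m..<n}. x i)"
        using that sum_diff[of "{..<n}" "{..<m}" x] by (simp add: lessThan_minus_lessThan)
      then have "cnorm ((\<Sum>i<n. x i) - (\<Sum>i<m. x i)) \<le> sum b {m..<n}"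
        using cnorm_sum[of x "{m..<n}"] sum_mono[of "{m..<n}" "\<lambda>i. cnorm (x i)" b] assms(2) by simp
      then show ?thesis using N[OF that(1), of n] by simp
    qed
    then show "\<exists>N. \<forall>m\<ge>N. \<forall>n\<ge>N. cnorm ((\<Sum>i<m. x i) - (\<Sum>i<n. x i)) < e"
      by (metis cnorm_minus_commute nle_le)
  qed
  then obtain L where L: "cconv (\<lambda>n. \<Sum>i<n. x i) L" by blast
  have "cnorm (\<Sum>i<n. x i) \<le> suminf b" for n
  proof -
    have "cnorm (\<Sum>i<n. x i) \<le> (\<Sum>i<n. cnorm (x i))" by (rule cnorm_sum)
    also have "\<dots> \<le> (\<Sum>i<n. b i)" by (intro sum_mono assms(2))
    also have "\<dots> \<le> suminf b" using b0 by (intro sum_le_suminf assms(1)) auto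
    finally show ?thesis .
  qed
  then have "cnorm L \<le> suminf b" using LIMSEQ_le_const2[OF cconv_norm[OF L]] by blast
  then show ?thesis using L by blast
qed

section \<open>Bounded operators\<close>

lemma bounded_op_add: "bounded_op A \<Longrightarrow> A (x + y) = A x + A y"
  by (simp add: bounded_op_def)

lemma bounded_op_cscale: "bounded_op A \<Longrightarrow> A (cscale c x) = cscale c (A x)"
  by (simp add: bounded_op_def)

lemma bounded_op_zero: "bounded_op A \<Longrightarrow> A 0 = 0"
  using bounded_op_cscale[of A 0 0] by (simp add: cscale_zero_left)

lemma bounded_op_diff: "bounded_op A \<Longrightarrow> A (x - y) = A x - A y"
  using bounded_op_add[of A x "-y"] bounded_op_cscale[of A "-1" y] by (simp add: cscale_minus_one)

lemma bounded_op_sum: "bounded_op A \<Longrightarrow> A (\<Sum>i\<in>F. f i) = (\<Sum>i\<in>F. A (f i))"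
  by (induction F rule: infinite_finite_induct) (auto simp: bounded_op_zero bounded_op_add)

lemma bounded_op_conv:
  assumes "bounded_op A" "cconv X L"
  shows "cconv (\<lambda>n. A (X n)) (A L)"
proof -
  obtain K where K: "\<And>x. cnorm (A x) \<le> K * cnorm x" using assms(1) by (auto simp: bounded_op_def)
  have "(\<lambda>n. K * cnorm (X n - L)) \<longlonglongrightarrow> 0"
    using assms(2) unfolding cconv_def by (rule tendsto_mult_right_zero)
  then show ?thesis by (rule cconvI[rotated]) (use K assms(1) in \<open>simp add: bounded_op_diff[symmetric]\<close>)
qed

lemma cdense_conv:
  assumes "cdense A"
  obtains X where "\<And>n. X n \<in> A" "cconv X y"
proof -
  have "\<forall>n::nat. \<exists>x. x \<in> A \<and> cnorm (x - y) < 1 / real (Suc n)" 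
  proof
    fix n :: nat
    have "1 / real (Suc n) > 0" by simp
    then show "\<exists>x. x \<in> A \<and> cnorm (x - y) < 1 / real (Suc n)" using assms unfolding cdense_def by blast
  qed
  from choice[OF this] obtain X where X: "\<And>n. X n \<in> A" "\<And>n. cnorm (X n - y) < 1 / real (Suc n)" by blast
  have "cconv X y" by (rule cconvI[of _ _ "\<lambda>n. 1 / real (Suc n)"]) (use X LIMSEQ_Suc[OF lim_1_over_n] in \<open>auto simp: less_imp_le\<close>)
  then show thesis using that X by blast
qed

section \<open>Subspaces, density and orthogonality\<close>

definition csubspace :: "'a::chilbert set \<Rightarrow> bool" where
  "csubspace W \<longleftrightarrow> 0 \<in> W \<and> (\<forall>x\<in>W. \<forall>y\<in>W. x + y \<in> W) \<and> (\<forall>c. \<forall>x\<in>W. cscale c x \<in> W)"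

lemma csubspace_sum: "csubspace W \<Longrightarrow> (\<And>i. i \<in> F \<Longrightarrow> f i \<in> W) \<Longrightarrow> (\<Sum>i\<in>F. f i) \<in> W"
  by (induction F rule: infinite_finite_induct) (auto simp: csubspace_def)

lemma csubspace_diff: "csubspace W \<Longrightarrow> x \<in> W \<Longrightarrow> y \<in> W \<Longrightarrow> x - y \<in> W"
  using cscale_minus_one[of y] unfolding csubspace_def by (metis diff_conv_add_uminus)

text \<open>First variation: moving \<open>v\<close> a little against its component along
  \<open>w\<close> lowers the squared norm at first order in the step, while the correction is of
  second order.\<close>

lemma orthogonal_if_minimal:
  fixes v w :: "'a::chilbert"
  assumes "\<And>t. cnorm v \<le> cnorm (v + cscale t w)"
  shows "cinner w v = 0"
proof (rule ccontr)
  assume "cinner w v \<noteq> 0"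
  \<comment> \<open>The step is small enough that \<open>s * (cnorm w)\<^sup>2 < 1\<close>, below
    the 2 needed for the contradiction; the added 1 excludes division by zero.\<close>
  define s where "s = 1 / ((cnorm w)\<^sup>2 + 1)"
  have w1: "(cnorm w)\<^sup>2 + 1 > 0" by (simp add: add_nonneg_pos)
  define a where "a = cinner v w"
  have a: "a \<noteq> 0" using \<open>cinner w v \<noteq> 0\<close> cinner_conj[of w v] by (auto simp: a_def)
  have "(cnorm v)\<^sup>2 \<le> (cnorm (v + cscale (- of_real s * a) w))\<^sup>2"
    using assms cnorm_nonneg by (intro power_mono) auto
  also have "\<dots> = (cnorm v)\<^sup>2 - 2 * s * (cmod a)\<^sup>2 + (s * cmod a)\<^sup>2 * (cnorm w)\<^sup>2"
  proof -
    have "cnj a * a = of_real ((cmod a)\<^sup>2)" by (simp only: complex_norm_square mult.commute)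
    then have "Re (cinner v (cscale (- of_real s * a) w)) = - s * (cmod a)\<^sup>2"
      by (simp add: cinner_cscale_right a_def[symmetric] mult.assoc del: of_real_power)
    moreover have "s \<ge> 0" using w1 by (simp add: s_def)
    ultimately show ?thesis by (simp add: cnorm_add_sq cnorm_cscale norm_mult power_mult_distrib)
  qed
  finally have "2 * s * (cmod a)\<^sup>2 \<le> (s * cmod a)\<^sup>2 * (cnorm w)\<^sup>2" by simp
  then have "(cmod a)\<^sup>2 * s * 2 \<le> (cmod a)\<^sup>2 * s * (s * (cnorm w)\<^sup>2)" by (simp add: power2_eq_square algebra_simps)
  moreover have "(cmod a)\<^sup>2 * s > 0" using a w1 by (simp add: s_def)
  ultimately have "2 \<le> s * (cnorm w)\<^sup>2" by (rule mult_left_le_imp_le)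
  then show False using w1 by (simp add: s_def field_simps)
qed

text \<open>A minimizing sequence in \<open>W\<close> for the distance to \<open>x\<close> converges
  to some \<open>u\<close>. By minimality \<open>u - x\<close> is orthogonal to \<open>W\<close>,
  hence zero, so \<open>x\<close> is a limit of points of \<open>W\<close>.\<close>

lemma cdense_if_orthogonal_trivial:
  fixes W :: "'a::chilbert set"
  assumes W: "csubspace W" and triv: "\<And>y. (\<And>w. w \<in> W \<Longrightarrow> cinner w y = 0) \<Longrightarrow> y = 0"
  shows "cdense W"
  unfolding cdense_def
proof (intro allI impI)
  fix x :: 'a and e :: real assume "e > 0"
  define d where "d = Inf ((\<lambda>w. cnorm (w - x)) ` W)"
  have bdd: "bdd_below ((\<lambda>w. cnorm (w - x)) ` W)" using cnorm_nonneg by (auto simp: bdd_below_def)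
  have ne: "W \<noteq> {}" using W by (auto simp: csubspace_def)
  have d: "d \<le> cnorm (w - x)" if "w \<in> W" for w unfolding d_def by (rule cInf_lower) (use that bdd in auto)
  have d0: "0 \<le> d" unfolding d_def by (rule cInf_greatest) (use ne cnorm_nonneg in auto)
  have "\<exists>w. w \<in> W \<and> cnorm (w - x) < d + 1 / real (Suc n)" for n
  proof -
    have "\<exists>y\<in>(\<lambda>w. cnorm (w - x)) ` W. y < d + 1 / real (Suc n)"
      unfolding d_def by (rule cInf_lessD) (use ne in auto)
    then show ?thesis by auto
  qed
  then have "\<forall>n. \<exists>w. w \<in> W \<and> cnorm (w - x) < d + 1 / real (Suc n)" by blast
  from choice[OF this] obtain w where w: "\<And>n. w n \<in> W" "\<And>n. cnorm (w n - x) < d + 1 / real (Suc n)" by blast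
  have lim: "(\<lambda>n. cnorm (w n - x)) \<longlonglongrightarrow> d"
  proof (rule tendsto_sandwich[OF _ _ tendsto_const])
    show "(\<lambda>n. d + 1 / real (Suc n)) \<longlonglongrightarrow> d" using tendsto_add[OF tendsto_const LIMSEQ_Suc[OF lim_1_over_n], of d] by simp
  qed (use w d in \<open>auto intro!: always_eventually less_imp_le\<close>)
  \<comment> \<open>Parallelogram law. The midpoint of \<open>w m\<close> and \<open>w n\<close>
    lies in \<open>W\<close>, hence has distance at least \<open>d\<close> from \<open>x\<close>,
    and this forces the minimizing sequence to be Cauchy.\<close>
  have par: "(cnorm (w m - w n))\<^sup>2 \<le> 2 * (cnorm (w m - x))\<^sup>2 + 2 * (cnorm (w n - x))\<^sup>2 - 4 * d\<^sup>2" for m n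
  proof -
    let ?a = "w m - x" and ?b = "w n - x"
    have "(cnorm (?a + ?b))\<^sup>2 + (cnorm (?a + - ?b))\<^sup>2 = 2 * (cnorm ?a)\<^sup>2 + 2 * (cnorm ?b)\<^sup>2"
    proof -
      have "cinner ?a (- ?b) = - cinner ?a ?b" using cinner_diff_right[of ?a 0 ?b] by (simp add: cinner_zero_right)
      then show ?thesis unfolding cnorm_add_sq by (simp add: cnorm_minus del: minus_diff_eq)
    qed
    moreover have "?a + - ?b = w m - w n" by simp
    moreover have "4 * d\<^sup>2 \<le> (cnorm (?a + ?b))\<^sup>2"
    proof -
      let ?h = "cscale (1/2) (w m + w n)"
      have "?h \<in> W" using W w unfolding csubspace_def by blast
      then have "d \<le> cnorm (?h - x)" by (rule d)
      moreover have "?a + ?b = cscale 2 (?h - x)"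
        using cscale_add_left[of 1 1 x] by (simp add: cscale_diff_right cscale_cscale cscale_one algebra_simps)
      ultimately have "2 * d \<le> cnorm (?a + ?b)" by (simp add: cnorm_cscale)
      from power_mono[OF this, of 2] d0 show ?thesis by (simp add: power_mult_distrib)
    qed
    ultimately show ?thesis by simp
  qed
  have "\<exists>u. cconv w u"
  proof (rule cconv_complete)
    fix e :: real assume e: "e > 0"
    have "(\<lambda>n. (cnorm (w n - x))\<^sup>2) \<longlonglongrightarrow> d\<^sup>2" by (intro tendsto_intros lim)
    then obtain N where N: "\<And>n. n \<ge> N \<Longrightarrow> norm ((cnorm (w n - x))\<^sup>2 - d\<^sup>2) < e\<^sup>2 / 4"
      using LIMSEQ_D[of _ _ "e\<^sup>2 / 4"] e by (metis divide_pos_pos zero_less_numeral zero_less_power)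
    have "cnorm (w m - w n) < e" if "m \<ge> N" "n \<ge> N" for m n
    proof -
      have "(cnorm (w m - w n))\<^sup>2 < e\<^sup>2" using par[of m n] N[OF that(1)] N[OF that(2)]
        unfolding real_norm_def abs_less_iff by linarith
      then show ?thesis using e by (simp add: power2_less_imp_less)
    qed
    then show "\<exists>N. \<forall>m\<ge>N. \<forall>n\<ge>N. cnorm (w m - w n) < e" by blast
  qed
  then obtain u where u: "cconv w u" by blast
  have "u - x = 0"
  proof (rule triv)
    fix w' assume w': "w' \<in> W"
    \<comment> \<open>The subspace need not be closed, so \<open>u\<close> itself may lie outside
      it; minimality is obtained for the approximants and passed to the limit.\<close>
    have sh: "cconv (\<lambda>n. w n + (- x + cscale t w')) (u + (- x + cscale t w'))" for t
      by (intro cconv_add u cconv_const)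
    have "cnorm (u - x) \<le> cnorm (u - x + cscale t w')" for t
    proof -
      have "cnorm (u - x) = d"
        using cconv_norm[OF cconv_add[OF u cconv_const[of "-x"]]] lim LIMSEQ_unique by simp
      also have "d \<le> cnorm (u + (- x + cscale t w'))"
      proof (rule LIMSEQ_le_const[OF cconv_norm[OF sh]])
        have "d \<le> cnorm (w n + (- x + cscale t w'))" for n
          using d[of "w n + cscale t w'"] W w w' by (simp add: csubspace_def algebra_simps)
        then show "\<exists>N. \<forall>n\<ge>N. d \<le> cnorm (w n + (- x + cscale t w'))" by blast
      qed
      finally show ?thesis by (simp add: algebra_simps)
    qed
    then show "cinner w' (u - x) = 0" by (rule orthogonal_if_minimal)
  qed
  then have "cconv w x" using u by simp
  then have "\<exists>N. \<forall>n\<ge>N. norm (cnorm (w n - x) - 0) < e" unfolding cconv_def using \<open>e > 0\<close> by (rule LIMSEQ_D)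
  then obtain N where "norm (cnorm (w N - x) - 0) < e" by blast
  then have "cnorm (w N - x) < e" by simp
  then show "\<exists>w\<in>W. cnorm (w - x) < e" using w by blast
qed

text \<open>Gram-Schmidt, one vector at a time; a vector already in the span adds nothing. The
  clause over all subspaces \<open>W\<close> says that \<open>B\<close> lies in the span of
  \<open>F\<close>, in the form in which it is applied later.\<close>

lemma orthonormal_basis:
  fixes F :: "'a::chilbert set"
  assumes "finite F"
  shows "\<exists>B. finite B \<and> (\<forall>b\<in>B. \<forall>b'\<in>B. cinner b b' = (if b = b' then 1 else 0))
     \<and> (\<forall>W. csubspace W \<longrightarrow> F \<subseteq> W \<longrightarrow> B \<subseteq> W) \<and> (\<forall>x\<in>F. x = (\<Sum>b\<in>B. cscale (cinner x b) b))"
  using assms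
proof (induction F)
  case (insert v F)
  from insert.IH obtain B where "finite B \<and> (\<forall>b\<in>B. \<forall>b'\<in>B. cinner b b' = (if b = b' then 1 else 0))
     \<and> (\<forall>W. csubspace W \<longrightarrow> F \<subseteq> W \<longrightarrow> B \<subseteq> W) \<and> (\<forall>x\<in>F. x = (\<Sum>b\<in>B. cscale (cinner x b) b))" ..
  then have B: "finite B" "\<And>b b'. b \<in> B \<Longrightarrow> b' \<in> B \<Longrightarrow> cinner b b' = (if b = b' then 1 else 0)"
    "\<And>W. csubspace W \<Longrightarrow> F \<subseteq> W \<Longrightarrow> B \<subseteq> W" "\<And>x. x \<in> F \<Longrightarrow> x = (\<Sum>b\<in>B. cscale (cinner x b) b)" by (elim conjE; blast)+
  define u where "u = v - (\<Sum>b\<in>B. cscale (cinner v b) b)"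
  have uB: "cinner u b = 0" if "b \<in> B" for b
  proof -
    have "(\<Sum>b'\<in>B. cinner v b' * cinner b' b) = (\<Sum>b'\<in>B. if b' = b then cinner v b else 0)"
      using that by (intro sum.cong) (auto simp: B(2))
    then show ?thesis using B(1) that by (simp add: u_def cinner_diff_left cinner_sum_left cinner_cscale_left)
  qed
  show ?case
  proof (cases "u = 0")
    case True
    then have "v = (\<Sum>b\<in>B. cscale (cinner v b) b)" by (simp add: u_def)
    then have "x = (\<Sum>b\<in>B. cscale (cinner x b) b)" if "x \<in> insert v F" for x using that B(4) by blast
    then show ?thesis using B(1,2,3) by (intro exI[of _ B] conjI) blast+
  next
    case False
    then have n: "cnorm u > 0" using cnorm_nonneg[of u] cnorm_eq_0[of u] by linarith
    define b0 where "b0 = cscale (of_real (1 / cnorm u)) u"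
    have b0: "cinner b0 b0 = 1"
      using n by (simp add: cinner_self b0_def cnorm_cscale norm_divide cnorm_nonneg)
    have b0B: "cinner b0 b = 0" "cinner b b0 = 0" if "b \<in> B" for b
    proof -
      show 1: "cinner b0 b = 0" using uB[OF that] by (simp add: b0_def cinner_cscale_left)
      show "cinner b b0 = 0" using cinner_conj[of b b0] 1 by simp
    qed
    have nB: "b0 \<notin> B" using b0B(1)[of b0] b0 by auto
    have "\<forall>b\<in>insert b0 B. \<forall>b'\<in>insert b0 B. cinner b b' = (if b = b' then 1 else 0)"
      using B(2) b0 b0B nB by auto
    moreover have "insert b0 B \<subseteq> W" if W: "csubspace W" "insert v F \<subseteq> W" for W
    proof -
      have BW: "B \<subseteq> W" using B(3)[OF W(1)] W(2) by blast
      have "u \<in> W" unfolding u_def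
        using W BW by (intro csubspace_diff csubspace_sum) (auto simp: csubspace_def)
      then show ?thesis using W(1) BW by (auto simp: b0_def csubspace_def)
    qed
    moreover have "x = (\<Sum>b\<in>insert b0 B. cscale (cinner x b) b)" if x: "x \<in> insert v F" for x
    proof (cases "x \<in> F")
      case True
      have "cinner x b0 = (\<Sum>b\<in>B. cinner x b * cinner b b0)"
        by (subst B(4)[OF True]) (simp add: cinner_sum_left cinner_cscale_left)
      also have "\<dots> = 0" by (simp add: b0B)
      finally show ?thesis using B(1) nB B(4)[OF True] by (simp add: cscale_zero_left)
    next
      case False
      then have x: "x = v" using x by simp
      have veq: "v = u + (\<Sum>b\<in>B. cscale (cinner v b) b)" by (simp add: u_def)
      have "cinner v b0 = cinner u b0 + (\<Sum>b\<in>B. cinner v b * cinner b b0)"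
        by (subst veq) (simp add: cinner_add_left cinner_sum_left cinner_cscale_left)
      also have "\<dots> = of_real (cnorm u)" using n
        by (simp add: b0B) (unfold b0_def cinner_cscale_right cinner_self, simp add: power2_eq_square)
      finally have "cscale (cinner v b0) b0 = u" using n by (simp add: b0_def cscale_cscale cscale_one)
      then show ?thesis using B(1) nB veq x by simp
    qed
    ultimately show ?thesis using B(1) by (intro exI[of _ "insert b0 B"] conjI) blast+
  qed
qed auto

section \<open>The idempotents of an interpolating sequence\<close>

text \<open>Baire's theorem for countably many closed sets in the Cantor space, with finite prefixes
  describing the cylinders. If no set contained a cylinder, nested cylinders avoiding one
  \<open>K m\<close> after the other would shrink to an uncovered point.\<close>

lemma cantor_baire:
  fixes K :: "nat \<Rightarrow> (nat \<Rightarrow> bool) set"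
  assumes cover: "\<And>a. \<exists>m. a \<in> K m"
    and closed: "\<And>m a. (\<And>n. \<exists>b\<in>K m. \<forall>i<n. b i = a i) \<Longrightarrow> a \<in> K m"
  shows "\<exists>m n a. \<forall>b. (\<forall>i<n. b i = a i) \<longrightarrow> b \<in> K m"
proof (rule ccontr)
  assume neg: "\<not> ?thesis"
  \<comment> \<open>A pair \<open>s\<close> stands for the cylinder of all sequences agreeing with
    \<open>snd s\<close> below \<open>fst s\<close>.\<close>
  have step: "\<exists>s'. fst s < fst s' \<and> (\<forall>i<fst s. snd s' i = snd s i) \<and> (\<forall>c. (\<forall>i<fst s'. c i = snd s' i) \<longrightarrow> c \<notin> K m)"
    for m and s :: "nat \<times> (nat \<Rightarrow> bool)"
  proof -
    obtain b where b: "\<forall>i<fst s. b i = snd s i" "b \<notin> K m" using neg by blast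
    have "\<not> (\<forall>n. \<exists>c\<in>K m. \<forall>i<n. c i = b i)" using closed[of m b] b(2) by fast
    then obtain n' where n': "\<not> (\<exists>c\<in>K m. \<forall>i<n'. c i = b i)" unfolding not_all by (rule exE)
    \<comment> \<open>The length must exceed the old one strictly, so that in the end every
      coordinate becomes fixed.\<close>
    have "c \<notin> K m" if "\<forall>i<max (Suc (fst s)) n'. c i = b i" for c using n' that by auto
    then show ?thesis using b by (intro exI[of _ "(max (Suc (fst s)) n', b)"]) auto
  qed
  have "\<exists>s. \<forall>m. True \<and> (fst (s m) < fst (s (Suc m)) \<and> (\<forall>i<fst (s m). snd (s (Suc m)) i = snd (s m) i) \<and>
      (\<forall>c. (\<forall>i<fst (s (Suc m)). c i = snd (s (Suc m)) i) \<longrightarrow> c \<notin> K m))"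
    (is "\<exists>s. ?P s")
    by (rule dependent_nat_choice[of "\<lambda>_ _. True"]) (use step in auto)
  then obtain s where "?P s" ..
  then have s: "\<And>m. fst (s m) < fst (s (Suc m))" "\<And>m i. i < fst (s m) \<Longrightarrow> snd (s (Suc m)) i = snd (s m) i"
    "\<And>m c. (\<forall>i<fst (s (Suc m)). c i = snd (s (Suc m)) i) \<Longrightarrow> c \<notin> K m" by simp_all
  have ge: "m \<le> fst (s m)" for m
  proof (induction m)
    case (Suc m)
    then show ?case using s(1)[of m] by simp
  qed simp
  have "fst (s m) \<le> fst (s (m + k)) \<and> (\<forall>i<fst (s m). snd (s (m + k)) i = snd (s m) i)" for m k
  proof (induction k)
    case (Suc k)
    then show ?case using s(1)[of "m + k"] s(2)[where m = "m + k"] by (simp add: less_le_trans)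
  qed simp
  then have agree: "snd (s k) i = snd (s m) i" if "m \<le> k" "i < fst (s m)" for m k i
    using that by (metis le_add_diff_inverse)
  \<comment> \<open>Stage \<open>Suc i\<close> has length greater than \<open>i\<close>, so
    coordinate \<open>i\<close> is final there.\<close>
  define c where "c i = snd (s (Suc i)) i" for i
  have "c i = snd (s m) i" if "i < fst (s m)" for i m
  proof -
    have "i < fst (s (Suc i))" using ge[of "Suc i"] by simp
    then show ?thesis using agree[of m "max m (Suc i)" i] agree[of "Suc i" "max m (Suc i)" i] that by (simp add: c_def)
  qed
  then have "c \<notin> K m" for m using s(3)[of m c] by blast
  then show False using cover by blast
qed

lemma mult_bound_mono:
  assumes "mult_bound M \<phi>" "M \<le> N"
  shows "mult_bound N \<phi>"
  unfolding mult_bound_def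
proof (intro conjI allI impI)
  fix f :: "complex^'a \<Rightarrow> complex" and L assume "H2_bound L f"
  then show "H2_bound (N * L) (\<lambda>z. \<phi> z * f z)"
    using H2_bound_mono[OF mult_bound_apply[OF assms(1)]] H2_bound_nonneg assms(2) mult_right_mono by blast
qed (use assms(1) in \<open>simp add: mult_bound_def\<close>)

lemma multipliers_sum: "(\<And>i. i \<in> F \<Longrightarrow> f i \<in> multipliers) \<Longrightarrow> (\<lambda>z. \<Sum>i\<in>F. f i z) \<in> multipliers"
  by (induction F rule: infinite_finite_induct) (simp_all add: multipliers_zero multipliers_add)

text \<open>Weak-* convergence implies weak operator convergence: a single matrix coefficient is the
  case of sequences supported at index 0.\<close>

lemma op_wstar_limit:
  fixes A :: "nat \<Rightarrow> 'a::chilbert \<Rightarrow> 'a"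
  assumes lim: "limitin op_wstar A B sequentially" and A: "\<And>n. bounded_op (A n)" and B: "bounded_op B"
  shows "(\<lambda>n. cinner (A n x) y) \<longlonglongrightarrow> cinner (B x) y"
proof (rule topological_tendstoI)
  fix U :: "complex set" assume U: "open U" "cinner (B x) y \<in> U"
  define x' where "x' n = (if n = 0 then x else 0)" for n :: nat
  define y' where "y' n = (if n = 0 then y else 0)" for n :: nat
  have sum: "(\<Sum>n. cinner (C (x' n)) (y' n)) = cinner (C x) y" if "bounded_op C" for C :: "'a \<Rightarrow> 'a"
    by (subst suminf_finite[of "{0}"]) (auto simp: x'_def y'_def cinner_zero_right)
  let ?W = "{C. bounded_op C \<and> (\<Sum>n. cinner (C (x' n)) (y' n)) \<in> U}"
  have "summable (\<lambda>n. (cnorm (x' n))\<^sup>2)" "summable (\<lambda>n. (cnorm (y' n))\<^sup>2)"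
    by (rule summable_finite[of "{0}"]; auto simp: x'_def y'_def cnorm_zero)+
  then have "openin op_wstar ?W" unfolding op_wstar_def
    by (intro topology_generated_by_Basis) (use U in blast)
  moreover have "B \<in> ?W" using U B sum[OF B] by simp
  ultimately have "\<forall>\<^sub>F n in sequentially. A n \<in> ?W" using lim unfolding limitin_def by blast
  then show "\<forall>\<^sub>F n in sequentially. cinner (A n x) y \<in> U"
    by (rule eventually_mono) (use A sum in auto)
qed

text \<open>The situation of a single tuple. It is interpreted once for \<open>S\<close> and once
  for \<open>T\<close>, with the same \<open>\<Lambda>\<close> and \<open>\<kappa>\<close>.\<close>

locale annihilating_sequence =
  fixes T :: "'d::finite \<Rightarrow> 'a::chilbert \<Rightarrow> 'a"
    and \<Phi> :: "(complex^'d \<Rightarrow> complex) \<Rightarrow> 'a \<Rightarrow> 'a"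
    and \<Lambda> :: "(complex^'d) set"
    and \<kappa> :: nat
  assumes hom: "abs_cont_hom T \<Phi>" and interp: "interpolating \<Lambda>"
    and vanish: "vanish_ideal \<kappa> \<Lambda> \<subseteq> Ann \<Phi>"
begin

lemma bounded: "\<phi> \<in> multipliers \<Longrightarrow> bounded_op (\<Phi> \<phi>)"
  using hom by (simp add: abs_cont_hom_def)

lemma hom_one: "\<Phi> DA_one x = x"
  using hom by (simp add: abs_cont_hom_def)

lemma hom_add: "\<phi> \<in> multipliers \<Longrightarrow> \<psi> \<in> multipliers \<Longrightarrow> \<Phi> (\<lambda>z. \<phi> z + \<psi> z) x = \<Phi> \<phi> x + \<Phi> \<psi> x"
  using hom by (simp add: abs_cont_hom_def)

lemma hom_scale: "\<phi> \<in> multipliers \<Longrightarrow> \<Phi> (\<lambda>z. c * \<phi> z) x = cscale c (\<Phi> \<phi> x)"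
  using hom by (simp add: abs_cont_hom_def)

lemma hom_mult: "\<phi> \<in> multipliers \<Longrightarrow> \<psi> \<in> multipliers \<Longrightarrow> \<Phi> (\<lambda>z. \<phi> z * \<psi> z) x = \<Phi> \<phi> (\<Phi> \<psi> x)"
  using hom by (simp add: abs_cont_hom_def)

lemma hom_coord: "\<Phi> (DA_coord j) = T j"
  using hom by (simp add: abs_cont_hom_def)

lemma hom_zero: "\<Phi> (\<lambda>_. 0) x = 0"
  using hom_scale[OF multipliers_one, of 0] by (simp add: cscale_zero_left)

lemma hom_diff:
  assumes "\<phi> \<in> multipliers" "\<psi> \<in> multipliers"
  shows "\<Phi> (\<lambda>z. \<phi> z - \<psi> z) x = \<Phi> \<phi> x - \<Phi> \<psi> x"
  using hom_add[OF assms(1) multipliers_scale[OF assms(2)], of "-1"] hom_scale[OF assms(2), of "-1"]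
  by (simp add: cscale_minus_one)

lemma hom_sum:
  "(\<And>i. i \<in> F \<Longrightarrow> f i \<in> multipliers) \<Longrightarrow> \<Phi> (\<lambda>z. \<Sum>i\<in>F. f i z) x = (\<Sum>i\<in>F. \<Phi> (f i) x)"
  by (induction F rule: infinite_finite_induct) (simp_all add: hom_zero hom_add multipliers_sum)

lemma in_ball: "p \<in> \<Lambda> \<Longrightarrow> p \<in> DA_ball"
  using interp by (auto simp: interpolating_def)

lemma hom_vanishes:
  assumes "f \<in> multipliers" "\<And>p. p \<in> \<Lambda> \<Longrightarrow> vanishes p (Suc \<kappa>) f"
  shows "\<Phi> f x = 0"
  using vanish_idealI[of f \<Lambda> \<kappa>, OF assms] vanish by (auto simp: Ann_def)

text \<open>Through this lemma, identities between operators below reduce to comparing jets at the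
  points of \<open>\<Lambda>\<close>.\<close>

lemma hom_jet_eq:
  assumes f: "f \<in> multipliers" and g: "g \<in> multipliers" and "\<And>p. p \<in> \<Lambda> \<Longrightarrow> jet_eq (Suc \<kappa>) p f g"
  shows "\<Phi> f x = \<Phi> g x"
  using hom_vanishes[OF multipliers_diff[OF f g], of x] assms(3) hom_diff[OF f g] by (simp add: jet_eq_def)

text \<open>The only place where weak-* continuity of \<open>\<Phi>\<close> enters, and only for
  bounded sequences.\<close>

lemma hom_limit:
  assumes \<phi>: "\<And>n. mult_bound M (\<phi> n)" and lim: "\<And>z. (\<lambda>n. \<phi> n z) \<longlonglongrightarrow> \<psi> z"
  shows "(\<lambda>n. cinner (\<Phi> (\<phi> n) x) y) \<longlonglongrightarrow> cinner (\<Phi> \<psi> x) y"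
proof -
  have "continuous_map DA_wstar op_wstar \<Phi>" using hom by (simp add: abs_cont_hom_def)
  then have "limitin op_wstar (\<Phi> \<circ> \<phi>) (\<Phi> \<psi>) sequentially"
    using mult_wstar_limit[of M \<phi> \<psi>, OF \<phi> lim] by (rule continuous_map_limit)
  then show ?thesis
    using op_wstar_limit[of "\<Phi> \<circ> \<phi>" "\<Phi> \<psi>" x y] bounded mult_boundD[OF \<phi>] mult_boundD[OF mult_bound_limit[of M \<phi> \<psi>, OF \<phi> lim]]
    by simp
qed

text \<open>The choice refers to \<open>\<Lambda>\<close> alone and not to \<open>\<Phi>\<close>, so
  the two tuples share the same multipliers \<open>unit_at\<close>. The comparison of their ranges
  depends on this.\<close>

definition peak :: "complex^'d \<Rightarrow> complex^'d \<Rightarrow> complex" where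
  "peak p = (SOME \<phi>. \<phi> \<in> multipliers \<and> (\<forall>q\<in>\<Lambda>. \<phi> q = (if q = p then 1 else 0)))"

definition unit_at :: "complex^'d \<Rightarrow> complex^'d \<Rightarrow> complex" where
  "unit_at p = flatten (Suc \<kappa>) (peak p)"

lemma interpolate:
  fixes h :: "complex^'d \<Rightarrow> bool"
  shows "\<exists>\<phi>. \<phi> \<in> multipliers \<and> (\<forall>q\<in>\<Lambda>. \<phi> q = (if h q then 1 else 0))"
proof -
  have "\<exists>B. \<forall>p\<in>\<Lambda>. cmod (if h p then 1 else 0) \<le> B" by (rule exI[of _ 1]) auto
  moreover have "(\<exists>B. \<forall>p\<in>\<Lambda>. cmod (g p) \<le> B) \<longrightarrow> (\<exists>\<phi>\<in>multipliers. \<forall>p\<in>\<Lambda>. \<phi> p = g p)" for g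
    using interp unfolding interpolating_def by blast
  from this[of "\<lambda>q. if h q then 1 else 0"] calculation show ?thesis by auto
qed

lemma peak: "peak p \<in> multipliers" "q \<in> \<Lambda> \<Longrightarrow> peak p q = (if q = p then 1 else 0)"
proof -
  have "peak p \<in> multipliers \<and> (\<forall>q\<in>\<Lambda>. peak p q = (if q = p then 1 else 0))"
    unfolding peak_def by (rule someI_ex[OF interpolate[of "\<lambda>q. q = p"]])
  then show "peak p \<in> multipliers" "q \<in> \<Lambda> \<Longrightarrow> peak p q = (if q = p then 1 else 0)" by auto
qed

lemma flatten_in_multipliers: "\<phi> \<in> multipliers \<Longrightarrow> flatten (Suc \<kappa>) \<phi> \<in> multipliers"
  using flatten_multiplier mult_boundD multipliers_iff by blast

lemma unit_at: "unit_at p \<in> multipliers"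
  unfolding unit_at_def by (intro flatten_in_multipliers peak)

lemma flatten_jet:
  assumes "\<phi> \<in> multipliers" "q \<in> \<Lambda>" "\<phi> q = (if b then 1 else 0)"
  shows "jet_eq (Suc \<kappa>) q (flatten (Suc \<kappa>) \<phi>) (\<lambda>_. if b then 1 else 0)"
  using flatten_0[OF in_ball[OF assms(2)] smooth_multiplier[OF assms(1)]]
    flatten_1[OF in_ball[OF assms(2)] smooth_multiplier[OF assms(1)]] assms(3) by (cases b) auto

lemma unit_at_jet: "q \<in> \<Lambda> \<Longrightarrow> jet_eq (Suc \<kappa>) q (unit_at p) (\<lambda>_. if q = p then 1 else 0)"
  unfolding unit_at_def by (rule flatten_jet) (simp_all add: peak)

lemma sum_unit_at_jet:
  assumes "finite F" "q \<in> \<Lambda>"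
  shows "jet_eq (Suc \<kappa>) q (\<lambda>z. \<Sum>p\<in>F. unit_at p z) (\<lambda>_. if q \<in> F then 1 else 0)"
  using assms(1)
proof (induction F)
  case (insert p F)
  have "jet_eq (Suc \<kappa>) q (\<lambda>z. unit_at p z + (\<Sum>p\<in>F. unit_at p z)) (\<lambda>_. (if q = p then 1 else 0) + (if q \<in> F then 1 else 0))"
    using in_ball[OF assms(2)] unit_at_jet[OF assms(2)] insert.IH
    by (intro jet_eq_add smooth_const smooth_multiplier multipliers_sum unit_at) auto
  moreover have "((if q = p then 1 else 0) + (if q \<in> F then 1 else 0) :: complex) = (if q \<in> insert p F then 1 else 0)"
    using insert.hyps by auto
  ultimately show ?case using insert.hyps by simp
qed (simp add: jet_eq_refl)

text \<open>At every point of \<open>\<Lambda>\<close> both multipliers have the constant jet given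
  by the indicator of \<open>F\<close>.\<close>

lemma hom_flatten_finite:
  assumes "\<phi> \<in> multipliers" "finite F" "\<And>q. q \<in> \<Lambda> \<Longrightarrow> \<phi> q = (if q \<in> F then 1 else 0)"
  shows "\<Phi> (flatten (Suc \<kappa>) \<phi>) x = (\<Sum>p\<in>F. \<Phi> (unit_at p) x)"
proof -
  have m: "flatten (Suc \<kappa>) \<phi> \<in> multipliers" "(\<lambda>z. \<Sum>p\<in>F. unit_at p z) \<in> multipliers"
    by (intro flatten_in_multipliers multipliers_sum unit_at assms)+
  have "\<Phi> (flatten (Suc \<kappa>) \<phi>) x = \<Phi> (\<lambda>z. \<Sum>p\<in>F. unit_at p z) x"
  proof (rule hom_jet_eq[OF m])
    fix q assume q: "q \<in> \<Lambda>"
    show "jet_eq (Suc \<kappa>) q (flatten (Suc \<kappa>) \<phi>) (\<lambda>z. \<Sum>p\<in>F. unit_at p z)"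
      by (rule jet_eq_trans[OF in_ball[OF q] _ _ _ flatten_jet[OF assms(1) q assms(3)[OF q]]
            jet_eq_sym[OF in_ball[OF q] _ _ sum_unit_at_jet[OF assms(2) q]]])
         (auto intro: smooth_multiplier m smooth_const)
  qed
  then show ?thesis by (simp add: hom_sum unit_at)
qed

text \<open>The jets of the indicators of \<open>F\<close> and of its complement add up to the jet
  of 1, and \<open>\<Phi>\<close> sends 1 to the identity.\<close>

lemma hom_flatten_cofinite:
  assumes "\<phi> \<in> multipliers" "finite F" "\<And>q. q \<in> \<Lambda> \<Longrightarrow> \<phi> q = (if q \<in> F then 0 else 1)"
  shows "x = \<Phi> (flatten (Suc \<kappa>) \<phi>) x + (\<Sum>p\<in>F. \<Phi> (unit_at p) x)"
proof -
  have m: "flatten (Suc \<kappa>) \<phi> \<in> multipliers" "(\<lambda>z. \<Sum>p\<in>F. unit_at p z) \<in> multipliers"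
    by (intro flatten_in_multipliers multipliers_sum unit_at assms)+
  have "\<Phi> DA_one x = \<Phi> (\<lambda>z. flatten (Suc \<kappa>) \<phi> z + (\<Sum>p\<in>F. unit_at p z)) x"
  proof (rule hom_jet_eq[OF multipliers_one multipliers_add[OF m]])
    fix q assume q: "q \<in> \<Lambda>"
    have "\<phi> q = (if q \<notin> F then 1 else 0)" using assms(3)[OF q] by simp
    note f = flatten_jet[OF assms(1) q this]
    have "jet_eq (Suc \<kappa>) q (\<lambda>z. flatten (Suc \<kappa>) \<phi> z + (\<Sum>p\<in>F. unit_at p z)) (\<lambda>_. (if q \<notin> F then 1 else 0) + (if q \<in> F then 1 else 0))"
      by (intro jet_eq_add in_ball q f sum_unit_at_jet assms(2) smooth_multiplier m smooth_const)
    then have "jet_eq (Suc \<kappa>) q (\<lambda>z. flatten (Suc \<kappa>) \<phi> z + (\<Sum>p\<in>F. unit_at p z)) (\<lambda>_. 1)" by (cases "q \<in> F") auto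
    then have 1: "jet_eq (Suc \<kappa>) q (\<lambda>_. 1) (\<lambda>z. flatten (Suc \<kappa>) \<phi> z + (\<Sum>p\<in>F. unit_at p z))"
      by (rule jet_eq_sym[OF in_ball[OF q], rotated 2]) (intro smooth_add smooth_multiplier m smooth_const)+
    have 2: "jet_eq (Suc \<kappa>) q DA_one (\<lambda>_. 1)" by (rule jet_eq_ball[OF in_ball[OF q]]) (simp add: DA_one_def)
    show "jet_eq (Suc \<kappa>) q DA_one (\<lambda>z. flatten (Suc \<kappa>) \<phi> z + (\<Sum>p\<in>F. unit_at p z))"
      by (rule jet_eq_trans[OF in_ball[OF q] _ _ _ 2 1]) (intro smooth_one smooth_add smooth_multiplier m smooth_const)+
  qed
  then show ?thesis by (simp add: hom_one hom_add[OF m] hom_sum unit_at)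
qed

text \<open>By Baire's theorem on the Cantor space of subsets of \<open>\<Lambda>\<close>, all subsets in some cylinder
  are interpolated with a uniform bound; weak-* continuity of \<open>\<Phi>\<close> along finite subsets increasing
  to a cofinite one then gives countable additivity of the idempotents.\<close>

lemma unit_at_total:
  assumes zero: "\<And>p. p \<in> \<Lambda> \<Longrightarrow> cinner (\<Phi> (unit_at p) x) y = 0"
  shows "cinner x y = 0"
proof -
  define idx where "idx = to_nat_on \<Lambda>"
  have inj: "inj_on idx \<Lambda>" using interp unfolding idx_def interpolating_def by (simp add: inj_on_to_nat_on)
  \<comment> \<open>Subsets of \<open>\<Lambda>\<close> are coded by sequences through an
    enumeration; \<open>K m\<close> collects those whose indicator has an interpolant of norm at
    most \<open>m\<close>.\<close>
  define K where "K m = {a::nat\<Rightarrow>bool. \<exists>\<phi>. mult_bound (real m) \<phi> \<and> (\<forall>p\<in>\<Lambda>. \<phi> p = (if a (idx p) then 1 else 0))}" for m :: nat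
  have "\<exists>m n a. \<forall>b. (\<forall>i<n. b i = a i) \<longrightarrow> b \<in> K m"
  proof (rule cantor_baire)
    fix a :: "nat \<Rightarrow> bool"
    obtain \<phi> where \<phi>: "\<phi> \<in> multipliers" "\<forall>q\<in>\<Lambda>. \<phi> q = (if a (idx q) then 1 else 0)" using interpolate[of "\<lambda>q. a (idx q)"] by blast
    obtain M where M: "mult_bound M \<phi>" using \<phi>(1) multipliers_iff by blast
    obtain m :: nat where "M \<le> real m" using real_arch_simple by blast
    then show "\<exists>m. a \<in> K m" using \<phi>(2) mult_bound_mono[OF M] unfolding K_def by blast
  next
    fix m and a :: "nat \<Rightarrow> bool"
    assume a: "\<And>n. \<exists>b\<in>K m. \<forall>i<n. b i = a i"
    \<comment> \<open>Closedness: the interpolants of approximating subsets obey one bound, so a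
      subsequence converges pointwise, and its limit interpolates the indicator of \<open>a\<close>
      with the same bound.\<close>
    have "\<forall>n. \<exists>\<phi>. mult_bound (real m) \<phi> \<and> (\<forall>p\<in>\<Lambda>. idx p < n \<longrightarrow> \<phi> p = (if a (idx p) then 1 else 0))"
    proof
      fix n
      obtain b where b: "b \<in> K m" "\<forall>i<n. b i = a i" using a[of n] by blast
      then obtain \<phi> where "mult_bound (real m) \<phi>" "\<forall>p\<in>\<Lambda>. \<phi> p = (if b (idx p) then 1 else 0)" unfolding K_def by blast
      then show "\<exists>\<phi>. mult_bound (real m) \<phi> \<and> (\<forall>p\<in>\<Lambda>. idx p < n \<longrightarrow> \<phi> p = (if a (idx p) then 1 else 0))"
        using b(2) by (intro exI[of _ \<phi>]) auto
    qed
    from choice[OF this] obtain \<phi> where \<phi>: "\<And>n. mult_bound (real m) (\<phi> n)"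
      "\<And>n p. p \<in> \<Lambda> \<Longrightarrow> idx p < n \<Longrightarrow> \<phi> n p = (if a (idx p) then 1 else 0)" by blast
    obtain r \<psi> where r: "strict_mono (r::nat\<Rightarrow>nat)" "mult_bound (real m) \<psi>" "\<And>z. (\<lambda>n. \<phi> (r n) z) \<longlonglongrightarrow> \<psi> z"
      using mult_bound_subsequence[of "real m" \<phi>, OF \<phi>(1)] by blast
    have "\<psi> p = (if a (idx p) then 1 else 0)" if p: "p \<in> \<Lambda>" for p
    proof (rule LIMSEQ_unique[OF r(3)])
      show "(\<lambda>n. \<phi> (r n) p) \<longlonglongrightarrow> (if a (idx p) then 1 else 0)"
      proof (rule tendsto_eventually, rule eventually_sequentiallyI[of "Suc (idx p)"])
        fix n assume "Suc (idx p) \<le> n"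
        then have "idx p < r n" using seq_suble[OF r(1), of n] by simp
        then show "\<phi> (r n) p = (if a (idx p) then 1 else 0)" using \<phi>(2)[OF p] by simp
      qed
    qed
    then show "a \<in> K m" using r(2) unfolding K_def by blast
  qed
  then obtain m n a where cyl: "\<And>b. (\<forall>i<n. b i = a i) \<Longrightarrow> b \<in> K m" by blast
  \<comment> \<open>Members of the cylinder that code finite sets and increase with \<open>k\<close>
    to a set missing only finitely many points.\<close>
  define B where "B k i = (if i < n then a i else i < k)" for k i :: nat
  have "\<forall>k. \<exists>\<phi>. mult_bound (real m) \<phi> \<and> (\<forall>p\<in>\<Lambda>. \<phi> p = (if B k (idx p) then 1 else 0))"
    using cyl[of "B _"] unfolding K_def B_def by auto
  from choice[OF this] obtain \<phi> where \<phi>: "\<And>k. mult_bound (real m) (\<phi> k)"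
    "\<And>k p. p \<in> \<Lambda> \<Longrightarrow> \<phi> k p = (if B k (idx p) then 1 else 0)" by blast
  obtain r \<psi> where r: "strict_mono (r::nat\<Rightarrow>nat)" "mult_bound (real m) \<psi>" "\<And>z. (\<lambda>n. \<phi> (r n) z) \<longlonglongrightarrow> \<psi> z"
    using mult_bound_subsequence[of "real m" \<phi>, OF \<phi>(1)] by blast
  \<comment> \<open>The points that the prescribed part of the cylinder excludes from every
    \<open>B k\<close>.\<close>
  define F where "F = {p \<in> \<Lambda>. idx p < n \<and> \<not> a (idx p)}"
  have fin: "finite {p \<in> \<Lambda>. idx p < N \<and> P p}" for N P
    by (rule inj_on_finite[of idx _ "{..<N}"]) (auto intro: inj_on_subset[OF inj])
  have \<psi>: "\<psi> p = (if p \<in> F then 0 else 1)" if p: "p \<in> \<Lambda>" for p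
  proof (rule LIMSEQ_unique[OF r(3)])
    show "(\<lambda>k. \<phi> (r k) p) \<longlonglongrightarrow> (if p \<in> F then 0 else 1)"
    proof (rule tendsto_eventually, rule eventually_sequentiallyI[of "Suc (idx p)"])
      fix k assume "Suc (idx p) \<le> k"
      then have "idx p < r k" using seq_suble[OF r(1), of k] by simp
      then show "\<phi> (r k) p = (if p \<in> F then 0 else 1)" using \<phi>(2)[OF p] p by (simp add: B_def F_def)
    qed
  qed
  \<comment> \<open>Each \<open>B k\<close> codes a finite set, so finite additivity and the
    hypothesis on the single points suffice.\<close>
  have z: "cinner (\<Phi> (flatten (Suc \<kappa>) (\<phi> k)) x) y = 0" for k
  proof -
    define G where "G = {p \<in> \<Lambda>. idx p < max n k \<and> B k (idx p)}"
    have G: "finite G" unfolding G_def by (rule fin)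
    have "\<phi> k q = (if q \<in> G then 1 else 0)" if "q \<in> \<Lambda>" for q
      using \<phi>(2)[OF that, of k] that by (auto simp: G_def B_def)
    then show ?thesis
      using hom_flatten_finite[OF mult_boundD[OF \<phi>(1)[of k]] G] zero by (simp add: cinner_sum_left G_def)
  qed
  have "(\<lambda>k. cinner (\<Phi> (flatten (Suc \<kappa>) (\<phi> (r k))) x) y) \<longlonglongrightarrow> cinner (\<Phi> (flatten (Suc \<kappa>) \<psi>) x) y"
  proof (rule hom_limit)
    show "mult_bound (1 + (1 + real m ^ Suc \<kappa>) ^ Suc \<kappa>) (flatten (Suc \<kappa>) (\<phi> (r k)))" for k
      by (rule flatten_multiplier[OF \<phi>(1)])
    show "(\<lambda>k. flatten (Suc \<kappa>) (\<phi> (r k)) u) \<longlonglongrightarrow> flatten (Suc \<kappa>) \<psi> u" for u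
      unfolding flatten_def by (intro tendsto_intros r)
  qed
  then have "cinner (\<Phi> (flatten (Suc \<kappa>) \<psi>) x) y = 0" unfolding z by (simp add: LIMSEQ_const_iff)
  moreover have "finite F" unfolding F_def by (rule fin)
  ultimately show ?thesis
    using arg_cong[OF hom_flatten_cofinite[OF mult_boundD[OF r(2)] _ \<psi>, of x], of "\<lambda>v. cinner v y"] zero
    by (simp add: cinner_add_left cinner_sum_left F_def)
qed

end

section \<open>Intertwining operators\<close>

context annihilating_sequence
begin

lemma hom_commute:
  "f \<in> multipliers \<Longrightarrow> g \<in> multipliers \<Longrightarrow> \<Phi> f (\<Phi> g x) = \<Phi> g (\<Phi> f x)"
  using hom_mult[of f g x] hom_mult[of g f x] by (simp add: mult.commute)

lemma unit_at_mult:
  assumes "q \<in> \<Lambda>"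
  shows "\<Phi> (unit_at p) (\<Phi> (unit_at q) x) = (if p = q then \<Phi> (unit_at q) x else 0)"
proof -
  have m: "(\<lambda>z. unit_at p z * unit_at q z) \<in> multipliers" by (intro multipliers_mult unit_at)
  let ?c = "if p = q then 1 else 0 :: complex"
  have "\<Phi> (\<lambda>z. unit_at p z * unit_at q z) x = \<Phi> (\<lambda>z. ?c * unit_at q z) x"
  proof (rule hom_jet_eq[OF m multipliers_scale[OF unit_at]])
    fix r assume r: "r \<in> \<Lambda>"
    note b = in_ball[OF r] and s = smooth_multiplier[OF unit_at]
    have 1: "jet_eq (Suc \<kappa>) r (\<lambda>z. unit_at p z * unit_at q z) (\<lambda>_. (if r = p then 1 else 0) * (if r = q then 1 else 0))"
      by (intro jet_eq_mult b s smooth_const unit_at_jet r)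
    have 2: "jet_eq (Suc \<kappa>) r (\<lambda>z. ?c * unit_at q z) (\<lambda>_. ?c * (if r = q then 1 else 0))"
      by (intro jet_eq_scale b s smooth_const unit_at_jet r)
    have eq: "(if r = p then 1 else 0) * (if r = q then 1 else 0) = (?c * (if r = q then 1 else 0) :: complex)" by simp
    show "jet_eq (Suc \<kappa>) r (\<lambda>z. unit_at p z * unit_at q z) (\<lambda>z. ?c * unit_at q z)"
      by (rule jet_eq_trans[OF b _ _ _ 1[unfolded eq] jet_eq_sym[OF b _ _ 2]])
         (intro smooth_mult smooth_const s)+
  qed
  then show ?thesis by (simp add: hom_mult unit_at hom_scale cscale_one cscale_zero_left hom_zero split: if_splits)
qed

text \<open>A product of factors \<open>z $ j - p $ j\<close>, indexed by a word so that an extra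
  application of some \<open>T j\<close> can be recorded by prepending a letter.\<close>

fun shift_word :: "complex^'d \<Rightarrow> 'd list \<Rightarrow> complex^'d \<Rightarrow> complex" where
  "shift_word p [] = DA_one"
| "shift_word p (j # w) = (\<lambda>z. (DA_coord j z - p $ j * DA_one z) * shift_word p w z)"

lemma shift_multiplier: "(\<lambda>z. DA_coord j z - c * DA_one z) \<in> multipliers"
  by (intro multipliers_diff multipliers_coord multipliers_scale multipliers_one)

lemma shift_word_multiplier: "shift_word p w \<in> multipliers"
  by (induction w) (simp_all add: multipliers_one multipliers_mult shift_multiplier)

lemma shift_word_vanishes:
  assumes "p \<in> DA_ball"
  shows "vanishes p (length w) (shift_word p w)"
proof (induction w)
  case (Cons j w)
  have "vanishes p (1 + length w) (\<lambda>z. (DA_coord j z - p $ j * DA_one z) * shift_word p w z)"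
    using assms Cons
    by (intro vanishes_mult smooth_multiplier shift_multiplier shift_word_multiplier) (auto simp: DA_coord_def DA_one_def)
  then show ?case by simp
qed simp

lemma vanishes_le: "vanishes p m f \<Longrightarrow> n \<le> m \<Longrightarrow> vanishes p n f"
  by (induction m) (use vanishes_antimono in \<open>auto simp: le_Suc_eq\<close>)

text \<open>At \<open>p\<close> the word vanishes to sufficient order, and at every other point of
  \<open>\<Lambda>\<close> the factor \<open>unit_at p\<close> does.\<close>

lemma long_word_zero:
  assumes "p \<in> \<Lambda>" "length w > \<kappa>"
  shows "\<Phi> (\<lambda>z. shift_word p w z * unit_at p z) x = 0"
proof (rule hom_vanishes)
  fix q assume q: "q \<in> \<Lambda>"
  note b = in_ball[OF q] and s = smooth_multiplier[OF shift_word_multiplier] smooth_multiplier[OF unit_at]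
  show "vanishes q (Suc \<kappa>) (\<lambda>z. shift_word p w z * unit_at p z)"
  proof (cases "q = p")
    case True
    have "vanishes p (Suc \<kappa>) (shift_word p w)"
      using assms(2) by (intro vanishes_le[OF shift_word_vanishes[OF in_ball[OF assms(1)]]]) simp
    then have "vanishes p (Suc \<kappa>) (\<lambda>z. unit_at p z * shift_word p w z)"
      using b by (intro vanishes_scale_left s) (simp add: True)
    then show ?thesis unfolding True by (simp only: mult.commute)
  next
    case False
    then have "vanishes q (Suc \<kappa>) (unit_at p)" using unit_at_jet[OF q, of p] by (simp only: jet_eq_def if_False diff_zero)
    then show ?thesis by (rule vanishes_scale_left[OF b s])
  qed
qed (intro multipliers_mult shift_word_multiplier unit_at)

text \<open>Writing \<open>T j\<close> as \<open>T j - p $ j\<close> plus a scalar replaces a word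
  applied to \<open>T j x\<close> by a longer word and the same word applied to \<open>x\<close>.
  The induction is over all words at once, and it stays in \<open>V\<close> because long words give
  zero.\<close>

lemma word_orbit:
  assumes p: "p \<in> \<Lambda>" and V: "csubspace V"
    and F: "\<And>w. length w \<le> \<kappa> \<Longrightarrow> \<Phi> (\<lambda>z. shift_word p w z * unit_at p z) \<xi> \<in> V"
    and x: "x \<in> poly_orbit T \<xi>"
  shows "\<Phi> (\<lambda>z. shift_word p w z * unit_at p z) x \<in> V"
  using x
proof (induction arbitrary: w)
  case base
  show ?case
  proof (cases "length w \<le> \<kappa>")
    case False
    then show ?thesis using long_word_zero[OF p] V by (simp add: csubspace_def)
  qed (rule F)
next
  case (apply_T x j)
  let ?g = "\<lambda>w z. shift_word p w z * unit_at p z"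
  have m: "?g w \<in> multipliers" for w by (intro multipliers_mult shift_word_multiplier unit_at)
  have "(\<lambda>z. ?g w z * DA_coord j z) = (\<lambda>z. ?g (j # w) z + p $ j * ?g w z)"
  proof
    fix z
    show "?g w z * DA_coord j z = ?g (j # w) z + p $ j * ?g w z"
      using multipliers_outside[OF unit_at, of z p] by (cases "z \<in> DA_ball") (simp_all add: DA_one_def algebra_simps)
  qed
  then have "\<Phi> (?g w) (T j x) = \<Phi> (\<lambda>z. ?g (j # w) z + p $ j * ?g w z) x"
    using hom_mult[OF m multipliers_coord, of w j x] by (simp add: hom_coord)
  also have "\<dots> = \<Phi> (?g (j # w)) x + cscale (p $ j) (\<Phi> (?g w) x)"
    unfolding hom_add[OF m multipliers_scale[OF m]] hom_scale[OF m] ..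
  also have "\<dots> \<in> V" using apply_T.IH V by (simp only: csubspace_def)
  finally show ?case .
next
  case (add x y)
  then show ?case using V bounded_op_add[OF bounded[OF multipliers_mult[OF shift_word_multiplier unit_at]]] by (simp add: csubspace_def)
next
  case (scale x c)
  then show ?case using V bounded_op_cscale[OF bounded[OF multipliers_mult[OF shift_word_multiplier unit_at]]] by (simp add: csubspace_def)
qed

text \<open>On the orbit of \<open>\<xi>\<close> the idempotent takes values in the span of the
  finitely many vectors given by words of length at most \<open>\<kappa>\<close>. Density extends
  this to all \<open>x\<close>, because the orthogonal projection \<open>P\<close> onto this span is
  continuous.\<close>

lemma finite_dim:
  assumes p: "p \<in> \<Lambda>" and cyc: "cdense (poly_orbit T \<xi>)"
  shows "\<exists>B. finite B \<and> (\<forall>b\<in>B. \<exists>f\<in>multipliers. b = \<Phi> (\<lambda>z. f z * unit_at p z) \<xi>)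
     \<and> (\<forall>x. \<Phi> (unit_at p) x = (\<Sum>b\<in>B. cscale (cinner (\<Phi> (unit_at p) x) b) b))"
proof -
  let ?F = "(\<lambda>w. \<Phi> (\<lambda>z. shift_word p w z * unit_at p z) \<xi>) ` {w. length w \<le> \<kappa>}"
  have "finite {w::'d list. set w \<subseteq> UNIV \<and> length w \<le> \<kappa>}" by (rule finite_lists_length_le) simp
  then have "finite ?F" by simp
  from orthonormal_basis[OF this] obtain B where "finite B \<and> (\<forall>b\<in>B. \<forall>b'\<in>B. cinner b b' = (if b = b' then 1 else 0))
     \<and> (\<forall>W. csubspace W \<longrightarrow> ?F \<subseteq> W \<longrightarrow> B \<subseteq> W) \<and> (\<forall>x\<in>?F. x = (\<Sum>b\<in>B. cscale (cinner x b) b))" ..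
  then have B: "finite B" "\<And>W. csubspace W \<Longrightarrow> ?F \<subseteq> W \<Longrightarrow> B \<subseteq> W" "\<And>x. x \<in> ?F \<Longrightarrow> x = (\<Sum>b\<in>B. cscale (cinner x b) b)"
    by (elim conjE; blast)+
  \<comment> \<open>A subspace containing the generating vectors, so the span clause of
    \<open>orthonormal_basis\<close> puts each basis vector into the form
    \<open>\<Phi> (f e)\<xi>\<close> with \<open>e\<close> the unit at \<open>p\<close>.\<close>
  define W where "W = {\<Phi> (\<lambda>z. f z * unit_at p z) \<xi> | f. f \<in> multipliers}"
  have WI: "\<Phi> (\<lambda>z. f z * unit_at p z) \<xi> \<in> W" if "f \<in> multipliers" for f using that unfolding W_def by blast
  have "csubspace W" unfolding csubspace_def
  proof (intro conjI ballI allI)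
    show "0 \<in> W" using WI[OF multipliers_zero] by (simp add: hom_zero)
  next
    fix x y assume "x \<in> W" "y \<in> W"
    then obtain f g where fg: "f \<in> multipliers" "g \<in> multipliers" "x = \<Phi> (\<lambda>z. f z * unit_at p z) \<xi>" "y = \<Phi> (\<lambda>z. g z * unit_at p z) \<xi>"
      unfolding W_def by blast
    then show "x + y \<in> W"
      using WI[OF multipliers_add[OF fg(1,2)]] hom_add[OF multipliers_mult[OF fg(1) unit_at] multipliers_mult[OF fg(2) unit_at]]
      by (simp add: distrib_right)
  next
    fix c x assume "x \<in> W"
    then obtain f where f: "f \<in> multipliers" "x = \<Phi> (\<lambda>z. f z * unit_at p z) \<xi>" unfolding W_def by blast
    then show "cscale c x \<in> W"
      using WI[OF multipliers_scale[OF f(1)], of c] hom_scale[OF multipliers_mult[OF f(1) unit_at]] by (simp add: mult.assoc)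
  qed
  moreover have "?F \<subseteq> W" using WI[OF shift_word_multiplier] by blast
  ultimately have BW: "B \<subseteq> W" by (rule B(2))
  define P where "P x = (\<Sum>b\<in>B. cscale (cinner x b) b)" for x
  have Padd: "P (x + y) = P x + P y" for x y by (simp add: P_def cinner_add_left cscale_add_left sum.distrib)
  have Pscale: "P (cscale c x) = cscale c (P x)" for c x
    by (simp add: P_def cinner_cscale_left cscale_sum_right cscale_cscale)
  have Pzero: "P 0 = 0" by (simp add: P_def cinner_zero_left cscale_zero_left)
  have "bounded_op P" unfolding bounded_op_def
  proof (intro conjI allI Padd Pscale exI)
    fix x
    have "cnorm (P x) \<le> (\<Sum>b\<in>B. cnorm (cscale (cinner x b) b))" unfolding P_def by (rule cnorm_sum)
    also have "\<dots> \<le> (\<Sum>b\<in>B. cnorm x * cnorm b * cnorm b)"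
      by (intro sum_mono) (simp add: cnorm_cscale mult_right_mono cauchy_schwarz cnorm_nonneg)
    also have "\<dots> = (\<Sum>b\<in>B. cnorm b * cnorm b) * cnorm x" by (subst sum_distrib_right) (simp add: mult_ac)
    finally show "cnorm (P x) \<le> (\<Sum>b\<in>B. cnorm b * cnorm b) * cnorm x" .
  qed
  \<comment> \<open>The span, described as the fixed points of \<open>P\<close>, is the subspace to
    which \<open>word_orbit\<close> is applied.\<close>
  have V: "csubspace {x. x = P x}" unfolding csubspace_def using Padd Pscale Pzero by auto
  have orb: "\<Phi> (unit_at p) x = P (\<Phi> (unit_at p) x)" if "x \<in> poly_orbit T \<xi>" for x
  proof -
    have "\<Phi> (\<lambda>z. shift_word p w z * unit_at p z) \<xi> \<in> {x. x = P x}" if "length w \<le> \<kappa>" for w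
      using B(3) that unfolding P_def by blast
    \<comment> \<open>The empty word gives the idempotent itself.\<close>
    from word_orbit[OF p V this \<open>x \<in> poly_orbit T \<xi>\<close>, of "[]"]
    have "\<Phi> (\<lambda>z. DA_one z * unit_at p z) x = P (\<Phi> (\<lambda>z. DA_one z * unit_at p z) x)" by simp
    then show ?thesis by (simp add: hom_mult[OF multipliers_one unit_at] hom_one)
  qed
  have "\<Phi> (unit_at p) x = P (\<Phi> (unit_at p) x)" for x
  proof -
    obtain X where X: "\<And>n. X n \<in> poly_orbit T \<xi>" "cconv X x" using cdense_conv[OF cyc] by blast
    have 1: "cconv (\<lambda>n. \<Phi> (unit_at p) (X n)) (\<Phi> (unit_at p) x)" by (rule bounded_op_conv[OF bounded[OF unit_at] X(2)])
    have "cconv (\<lambda>n. P (\<Phi> (unit_at p) (X n))) (P (\<Phi> (unit_at p) x))" by (rule bounded_op_conv[OF \<open>bounded_op P\<close> 1])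
    then show ?thesis using 1 orb[OF X(1)] cconv_unique by simp
  qed
  then show ?thesis using B(1) BW unfolding P_def W_def by blast
qed

text \<open>Cyclicity alone would give approximation only. In finite dimension it becomes an exact
  representation, obtained by combining the representations of the basis vectors.\<close>

lemma unit_at_cyclic:
  assumes p: "p \<in> \<Lambda>" and cyc: "cdense (poly_orbit T \<xi>)"
  shows "\<exists>f. f \<in> multipliers \<and> \<Phi> (unit_at p) x = \<Phi> (\<lambda>z. f z * unit_at p z) \<xi>"
proof -
  obtain B where B: "finite B" "\<forall>b\<in>B. \<exists>f\<in>multipliers. b = \<Phi> (\<lambda>z. f z * unit_at p z) \<xi>"
     "\<And>x. \<Phi> (unit_at p) x = (\<Sum>b\<in>B. cscale (cinner (\<Phi> (unit_at p) x) b) b)" using finite_dim[OF assms] by blast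
  obtain f where f: "\<And>b. b \<in> B \<Longrightarrow> f b \<in> multipliers" "\<And>b. b \<in> B \<Longrightarrow> b = \<Phi> (\<lambda>z. f b z * unit_at p z) \<xi>"
    using bchoice[OF B(2)[unfolded Bex_def]] by blast
  define c where "c b = cinner (\<Phi> (unit_at p) x) b" for b
  have "\<Phi> (unit_at p) x = (\<Sum>b\<in>B. cscale (c b) (\<Phi> (\<lambda>z. f b z * unit_at p z) \<xi>))"
    unfolding c_def by (subst B(3), rule sum.cong) (use f(2) in simp_all)
  also have "\<dots> = \<Phi> (\<lambda>z. (\<Sum>b\<in>B. c b * f b z) * unit_at p z) \<xi>"
    unfolding sum_distrib_right
    by (subst hom_sum) (auto intro!: sum.cong multipliers_mult multipliers_scale unit_at f(1) simp: mult.assoc hom_scale[OF multipliers_mult[OF f(1) unit_at]])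
  finally show ?thesis using multipliers_sum[of B "\<lambda>b z. c b * f b z"] multipliers_scale[OF f(1)] by blast
qed

text \<open>The kernel of \<open>\<Phi> g\<close> is a closed subspace invariant under every
  \<open>T j\<close>, so it is everything as soon as it contains a cyclic vector.\<close>

lemma Ann_iff_cyclic:
  assumes cyc: "cdense (poly_orbit T \<xi>)" and g: "g \<in> multipliers"
  shows "g \<in> Ann \<Phi> \<longleftrightarrow> \<Phi> g \<xi> = 0"
proof
  assume 0: "\<Phi> g \<xi> = 0"
  have orb: "\<Phi> g x = 0" if "x \<in> poly_orbit T \<xi>" for x
    using that
  proof induction
    case (apply_T x j)
    have "\<Phi> g (T j x) = T j (\<Phi> g x)" using hom_commute[OF g multipliers_coord, of j x] by (simp add: hom_coord)
    then show ?case using apply_T bounded_op_zero[OF bounded[OF multipliers_coord[of j]]] by (simp add: hom_coord)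
  qed (simp_all add: 0 bounded_op_add[OF bounded[OF g]] bounded_op_cscale[OF bounded[OF g]] cscale_zero_right)
  have "\<Phi> g x = 0" for x
  proof -
    obtain X where X: "\<And>n. X n \<in> poly_orbit T \<xi>" "cconv X x" using cdense_conv[OF cyc] by blast
    have "cconv (\<lambda>n. \<Phi> g (X n)) (\<Phi> g x)" by (rule bounded_op_conv[OF bounded[OF g] X(2)])
    then show ?thesis using orb[OF X(1)] cconv_const[of 0] cconv_unique by simp
  qed
  then show "g \<in> Ann \<Phi>" using g by (auto simp: Ann_def)
qed (simp add: Ann_def)

end

text \<open>No uniform bound on the operators is available, so positive weights make the series
  absolutely convergent. That they are non-zero is what keeps each summand recoverable.\<close>

lemma weighted_op_series:
  fixes R :: "nat \<Rightarrow> 'h::chilbert \<Rightarrow> 'k::chilbert"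
  assumes R: "\<And>n. bounded_op (R n)"
  shows "\<exists>c X. (\<forall>n. c n \<noteq> 0) \<and> bounded_op X \<and> (\<forall>x. cconv (\<lambda>n. \<Sum>i<n. cscale (c i) (R i x)) (X x))"
proof -
  have "\<forall>n. \<exists>K. \<forall>x. cnorm (R n x) \<le> K * cnorm x" using R by (simp add: bounded_op_def)
  from choice[OF this] obtain K where K: "\<And>n x. cnorm (R n x) \<le> K n * cnorm x" by blast
  \<comment> \<open>Each weighted operator then has norm at most \<open>(1/2) ^ n\<close>; the
    absolute value and the added 1 allow bounds \<open>K n\<close> that are not positive.\<close>
  define c where "c n = 1 / (2 ^ n * (\<bar>K n\<bar> + 1))" for n
  have c0: "c n > 0" for n by (simp add: c_def add_nonneg_pos)
  have bnd: "cnorm (cscale (of_real (c n)) (R n x)) \<le> (1/2) ^ n * cnorm x" for n x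
  proof -
    have "cnorm (cscale (of_real (c n)) (R n x)) = c n * cnorm (R n x)" using c0[of n] by (simp add: cnorm_cscale)
    also have "\<dots> \<le> c n * ((\<bar>K n\<bar> + 1) * cnorm x)"
    proof (rule mult_left_mono)
      have "K n * cnorm x \<le> (\<bar>K n\<bar> + 1) * cnorm x" using cnorm_nonneg by (intro mult_right_mono) auto
      then show "cnorm (R n x) \<le> (\<bar>K n\<bar> + 1) * cnorm x" using K[of n x] by simp
    qed (use c0[of n] in simp)
    also have "\<dots> = (1/2) ^ n * cnorm x" by (simp add: c_def power_one_over field_simps add_nonneg_eq_0_iff)
    finally show ?thesis .
  qed
  have sm: "summable (\<lambda>n. (1/2) ^ n * cnorm x)" for x :: 'h by (intro summable_mult2 summable_geometric) simp
  have "\<forall>x. \<exists>L. cconv (\<lambda>n. \<Sum>i<n. cscale (of_real (c i)) (R i x)) L \<and> cnorm L \<le> (\<Sum>n. (1/2) ^ n * cnorm x)"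
    using cseries_conv[OF sm bnd] by blast
  from choice[OF this] obtain X where X: "\<And>x. cconv (\<lambda>n. \<Sum>i<n. cscale (of_real (c i)) (R i x)) (X x)"
    "\<And>x. cnorm (X x) \<le> (\<Sum>n. (1/2) ^ n * cnorm x)" by blast
  have "bounded_op X" unfolding bounded_op_def
  proof (intro conjI allI exI)
    fix x y :: 'h
    show "X (x + y) = X x + X y"
      by (rule cconv_unique[OF X(1)])
         (use cconv_add[OF X(1)[of x] X(1)[of y]] R in \<open>simp add: bounded_op_add cscale_add_right sum.distrib\<close>)
  next
    fix a and x :: 'h
    show "X (cscale a x) = cscale a (X x)"
      by (rule cconv_unique[OF X(1)])
         (use cconv_cscale[OF X(1)[of x], of a] R in \<open>simp add: bounded_op_cscale cscale_sum_right cscale_cscale mult.commute\<close>)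
  next
    fix x :: 'h
    have "(\<Sum>n. (1/2) ^ n * cnorm x) = (\<Sum>n. (1/2) ^ n) * cnorm x"
      by (rule suminf_mult2[symmetric]) (simp add: summable_geometric)
    then show "cnorm (X x) \<le> (\<Sum>n. (1/2) ^ n) * cnorm x" using X(2)[of x] by simp
  qed
  moreover have "complex_of_real (c n) \<noteq> 0" for n using c0[of n] by simp
  ultimately show ?thesis using X(1) by (intro exI[of _ "\<lambda>n. complex_of_real (c n)"] exI[of _ X]) blast
qed


text \<open>The vector representing \<open>x\<close> at \<open>p\<close> for \<open>T\<close> is
  transported to \<open>S\<close> by keeping the multiplier. Well-definedness rests on the
  annihilators, boundedness on the finite basis of the range.\<close>

lemma local_intertwiner:
  fixes S :: "'d::finite \<Rightarrow> 'k::chilbert \<Rightarrow> 'k" and T :: "'d \<Rightarrow> 'h::chilbert \<Rightarrow> 'h"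
  assumes "annihilating_sequence S \<Phi>S \<Lambda> \<kappa>" and "annihilating_sequence T \<Phi>T \<Lambda> \<kappa>"
    and Ann: "Ann \<Phi>S = Ann \<Phi>T" and \<eta>: "cdense (poly_orbit S \<eta>)" and \<xi>: "cdense (poly_orbit T \<xi>)"
    and p: "p \<in> \<Lambda>"
  defines "e \<equiv> annihilating_sequence.unit_at \<Lambda> \<kappa>"
  shows "\<exists>R. bounded_op R \<and>
    (\<forall>f\<in>multipliers. \<forall>x. \<Phi>T (e p) x = \<Phi>T (\<lambda>z. f z * e p z) \<xi> \<longrightarrow> R x = \<Phi>S (\<lambda>z. f z * e p z) \<eta>)"
proof -
  interpret S: annihilating_sequence S \<Phi>S \<Lambda> \<kappa> by fact
  interpret T: annihilating_sequence T \<Phi>T \<Lambda> \<kappa> by fact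
  have e: "e q \<in> multipliers" for q unfolding e_def by (rule S.unit_at)
  have eS: "S.unit_at = e" by (simp add: e_def)
  let ?m = "\<lambda>f z. f z * e p z"
  have m: "?m f \<in> multipliers" if "f \<in> multipliers" for f by (intro multipliers_mult that e)
  define R where "R x = \<Phi>S (?m (SOME f. f \<in> multipliers \<and> \<Phi>T (e p) x = \<Phi>T (?m f) \<xi>)) \<eta>" for x
  have R: "R x = \<Phi>S (?m f) \<eta>" if f: "f \<in> multipliers" "\<Phi>T (e p) x = \<Phi>T (?m f) \<xi>" for f x
  proof -
    define g where "g = (SOME f. f \<in> multipliers \<and> \<Phi>T (e p) x = \<Phi>T (?m f) \<xi>)"
    have g: "g \<in> multipliers \<and> \<Phi>T (e p) x = \<Phi>T (?m g) \<xi>"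
      unfolding g_def by (rule someI[where P = "\<lambda>f. f \<in> multipliers \<and> \<Phi>T (e p) x = \<Phi>T (?m f) \<xi>" and x = f]) (use f in blast)
    have d: "(\<lambda>z. ?m g z - ?m f z) \<in> multipliers" using g f m by (intro multipliers_diff) auto
    have "\<Phi>T (\<lambda>z. ?m g z - ?m f z) \<xi> = 0" using T.hom_diff[OF m m, of g f] g f by simp
    \<comment> \<open>Two representatives of the same vector differ by a multiplier that kills the
      cyclic vector \<open>\<xi>\<close>, hence annihilates \<open>T\<close>, hence
      \<open>S\<close>.\<close>
    then have "(\<lambda>z. ?m g z - ?m f z) \<in> Ann \<Phi>S" unfolding Ann using T.Ann_iff_cyclic[OF \<xi> d] by blast
    then have "\<Phi>S (\<lambda>z. ?m g z - ?m f z) \<eta> = 0" by (simp add: Ann_def)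
    then have "\<Phi>S (?m g) \<eta> = \<Phi>S (?m f) \<eta>"
      unfolding S.hom_diff[OF m[OF conjunct1[OF g]] m[OF f(1)]] by simp
    moreover have "R x = \<Phi>S (?m g) \<eta>" unfolding R_def g_def ..
    ultimately show ?thesis by simp
  qed
  have ex: "\<exists>f. f \<in> multipliers \<and> \<Phi>T (e p) x = \<Phi>T (?m f) \<xi>" for x
    using T.unit_at_cyclic[OF p \<xi>] unfolding eS .
  have "bounded_op R" unfolding bounded_op_def
  proof (intro conjI allI)
    fix x y
    obtain f g where fg: "f \<in> multipliers" "\<Phi>T (e p) x = \<Phi>T (?m f) \<xi>" "g \<in> multipliers" "\<Phi>T (e p) y = \<Phi>T (?m g) \<xi>"
      using ex by blast
    have "\<Phi>T (e p) (x + y) = \<Phi>T (?m (\<lambda>z. f z + g z)) \<xi>"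
      using T.hom_add[OF m m, of f g] fg by (simp add: distrib_right bounded_op_add[OF T.bounded[OF e]])
    from R[OF multipliers_add[OF fg(1,3)] this] show "R (x + y) = R x + R y"
      using S.hom_add[OF m m, of f g] fg R by (simp add: distrib_right)
  next
    fix c x
    obtain f where f: "f \<in> multipliers" "\<Phi>T (e p) x = \<Phi>T (?m f) \<xi>" using ex by blast
    have "\<Phi>T (e p) (cscale c x) = \<Phi>T (?m (\<lambda>z. c * f z)) \<xi>"
      using T.hom_scale[OF m, of f c] f by (simp add: mult.assoc bounded_op_cscale[OF T.bounded[OF e]])
    from R[OF multipliers_scale[OF f(1)] this] show "R (cscale c x) = cscale c (R x)"
      using S.hom_scale[OF m, of f c] f R by (simp add: mult.assoc)
  next
    obtain B where B: "finite B" "\<forall>b\<in>B. \<exists>f\<in>multipliers. b = \<Phi>T (?m f) \<xi>"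
      "\<And>x. \<Phi>T (e p) x = (\<Sum>b\<in>B. cscale (cinner (\<Phi>T (e p) x) b) b)"
      using T.finite_dim[OF p \<xi>] unfolding eS by blast
    obtain f where f: "\<And>b. b \<in> B \<Longrightarrow> f b \<in> multipliers" "\<And>b. b \<in> B \<Longrightarrow> b = \<Phi>T (?m (f b)) \<xi>"
      using bchoice[OF B(2)[unfolded Bex_def]] by blast
    obtain K where K: "\<And>x. cnorm (\<Phi>T (e p) x) \<le> K * cnorm x" using T.bounded[OF e[of p]] by (auto simp: bounded_op_def)
    \<comment> \<open>By Cauchy-Schwarz each coordinate of \<open>\<Phi>T (e p) x\<close> is at most
      \<open>cnorm b\<close> times its norm, so \<open>N\<close> bounds the transport on the range
      and \<open>K\<close> bounds the idempotent.\<close>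
    define N where "N = (\<Sum>b\<in>B. cnorm b * cnorm (\<Phi>S (?m (f b)) \<eta>))"
    have N: "N \<ge> 0" unfolding N_def by (intro sum_nonneg mult_nonneg_nonneg cnorm_nonneg)
    have "cnorm (R x) \<le> (N * K) * cnorm x" for x
    proof -
      define c where "c b = cinner (\<Phi>T (e p) x) b" for b
      have cf: "(\<lambda>z. c b * ?m (f b) z) \<in> multipliers" if "b \<in> B" for b by (intro multipliers_scale m f that)
      have eq: "?m (\<lambda>z. \<Sum>b\<in>B. c b * f b z) = (\<lambda>z. \<Sum>b\<in>B. c b * ?m (f b) z)"
        by (simp add: sum_distrib_right mult.assoc)
      have "\<Phi>T (e p) x = (\<Sum>b\<in>B. cscale (c b) (\<Phi>T (?m (f b)) \<xi>))"
        unfolding c_def by (subst B(3), rule sum.cong) (use f(2) in simp_all)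
      also have "\<dots> = \<Phi>T (?m (\<lambda>z. \<Sum>b\<in>B. c b * f b z)) \<xi>"
        unfolding eq by (subst T.hom_sum[OF cf]) (auto intro!: sum.cong simp: T.hom_scale[OF m[OF f(1)]])
      finally have "\<Phi>T (e p) x = \<Phi>T (?m (\<lambda>z. \<Sum>b\<in>B. c b * f b z)) \<xi>" .
      from R[OF _ this] have "R x = \<Phi>S (?m (\<lambda>z. \<Sum>b\<in>B. c b * f b z)) \<eta>"
        using multipliers_sum[of B "\<lambda>b z. c b * f b z"] multipliers_scale[OF f(1)] by blast
      also have "\<dots> = (\<Sum>b\<in>B. cscale (c b) (\<Phi>S (?m (f b)) \<eta>))"
        unfolding eq by (subst S.hom_sum[OF cf]) (auto intro!: sum.cong simp: S.hom_scale[OF m[OF f(1)]])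
      finally have "cnorm (R x) \<le> (\<Sum>b\<in>B. cnorm (cscale (c b) (\<Phi>S (?m (f b)) \<eta>)))"
        using cnorm_sum[of "\<lambda>b. cscale (c b) (\<Phi>S (?m (f b)) \<eta>)" B] by simp
      also have "\<dots> \<le> (\<Sum>b\<in>B. cnorm (\<Phi>T (e p) x) * (cnorm b * cnorm (\<Phi>S (?m (f b)) \<eta>)))"
        by (intro sum_mono) (simp add: cnorm_cscale c_def mult_right_mono cauchy_schwarz cnorm_nonneg flip: mult.assoc)
      also have "\<dots> = N * cnorm (\<Phi>T (e p) x)" by (simp add: N_def sum_distrib_left mult.commute)
      also have "\<dots> \<le> N * (K * cnorm x)" by (rule mult_left_mono[OF K N])
      finally show ?thesis by (simp add: mult.assoc)
    qed
    then show "\<exists>K. \<forall>x. cnorm (R x) \<le> K * cnorm x" by blast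
  qed
  then show ?thesis using R by blast
qed

text \<open>Applying the idempotent at \<open>p\<close> to \<open>X x\<close> isolates one summand
  of the series. Injectivity then reduces to totality of the idempotents of \<open>T\<close>, and
  density of the range to totality of those of \<open>S\<close>. The hypotheses are symmetric, so
  the opposite direction is another instance.\<close>

lemma quasi_affinity:
  fixes S :: "'d::finite \<Rightarrow> 'k::chilbert \<Rightarrow> 'k" and T :: "'d \<Rightarrow> 'h::chilbert \<Rightarrow> 'h"
  assumes aS: "annihilating_sequence S \<Phi>S \<Lambda> \<kappa>" and aT: "annihilating_sequence T \<Phi>T \<Lambda> \<kappa>"
    and Ann: "Ann \<Phi>S = Ann \<Phi>T" and "cyclic_tuple S" and "cyclic_tuple T"
  shows "\<exists>X. bounded_op X \<and> inj X \<and> cdense (range X) \<and> (\<forall>j. X \<circ> T j = S j \<circ> X)"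
proof -
  interpret S: annihilating_sequence S \<Phi>S \<Lambda> \<kappa> by fact
  interpret T: annihilating_sequence T \<Phi>T \<Lambda> \<kappa> by fact
  obtain \<eta> \<xi> where \<eta>: "cdense (poly_orbit S \<eta>)" and \<xi>: "cdense (poly_orbit T \<xi>)"
    using assms(4,5) by (auto simp: cyclic_tuple_def)
  define e where "e = S.unit_at"
  have eS: "S.unit_at = e" by (simp add: e_def)
  have e: "e q \<in> multipliers" for q unfolding e_def by (rule S.unit_at)
  define m where "m p f = (\<lambda>z. f z * e p z)" for p f
  have m: "m p f \<in> multipliers" if "f \<in> multipliers" for p f unfolding m_def by (intro multipliers_mult that e)
  have "\<forall>p\<in>\<Lambda>. \<exists>R. bounded_op R \<and>
    (\<forall>f\<in>multipliers. \<forall>x. \<Phi>T (e p) x = \<Phi>T (m p f) \<xi> \<longrightarrow> R x = \<Phi>S (m p f) \<eta>)"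
    unfolding m_def e_def using local_intertwiner[OF aS aT Ann \<eta> \<xi>] by blast
  from bchoice[OF this] obtain R0 where R0: "\<And>p. p \<in> \<Lambda> \<Longrightarrow> bounded_op (R0 p)"
    "\<And>p f x. p \<in> \<Lambda> \<Longrightarrow> f \<in> multipliers \<Longrightarrow> \<Phi>T (e p) x = \<Phi>T (m p f) \<xi> \<Longrightarrow> R0 p x = \<Phi>S (m p f) \<eta>" by blast
  have exT: "\<exists>f. f \<in> multipliers \<and> \<Phi>T (e p) x = \<Phi>T (m p f) \<xi>" if "p \<in> \<Lambda>" for p x
    using T.unit_at_cyclic[OF that \<xi>] unfolding eS m_def .
  have exS: "\<exists>f. f \<in> multipliers \<and> \<Phi>S (e p) x = \<Phi>S (m p f) \<eta>" if "p \<in> \<Lambda>" for p x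
    using S.unit_at_cyclic[OF that \<eta>] unfolding eS m_def .
  have eeS: "\<Phi>S (e q) (\<Phi>S (m p f) \<eta>) = (if q = p then \<Phi>S (m p f) \<eta> else 0)" if "p \<in> \<Lambda>" "f \<in> multipliers" for p q f
    using S.unit_at_mult[OF that(1), of q "\<Phi>S f \<eta>"] S.hom_mult[OF that(2) e, of p \<eta>]
      S.hom_commute[OF that(2) e, of p \<eta>] unfolding eS m_def by simp
  have eeT: "\<Phi>T (e q) (\<Phi>T (m p f) \<xi>) = (if q = p then \<Phi>T (m p f) \<xi> else 0)" if "p \<in> \<Lambda>" "f \<in> multipliers" for p q f
    using T.unit_at_mult[OF that(1), of q "\<Phi>T f \<xi>"] T.hom_mult[OF that(2) e, of p \<xi>]
      T.hom_commute[OF that(2) e, of p \<xi>] unfolding eS m_def by simp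
  have R_proj: "\<Phi>S (e q) (R0 p x) = (if q = p then R0 p x else 0)" if "p \<in> \<Lambda>" for p q x
  proof -
    obtain f where f: "f \<in> multipliers" "\<Phi>T (e p) x = \<Phi>T (m p f) \<xi>" using exT[OF \<open>p \<in> \<Lambda>\<close>] by blast
    show ?thesis unfolding R0(2)[OF that f] by (rule eeS[OF that f(1)])
  qed
  \<comment> \<open>Here the other inclusion of the annihilators is used: a representative that
    kills \<open>\<eta>\<close> annihilates \<open>S\<close>, hence also \<open>T\<close>.\<close>
  have R_ker: "\<Phi>T (e p) x = 0" if p: "p \<in> \<Lambda>" and "R0 p x = 0" for p x
  proof -
    obtain f where f: "f \<in> multipliers" "\<Phi>T (e p) x = \<Phi>T (m p f) \<xi>" using exT[OF p] by blast
    have "\<Phi>S (m p f) \<eta> = 0" using R0(2)[OF p f] \<open>R0 p x = 0\<close> by simp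
    then have "m p f \<in> Ann \<Phi>T" using S.Ann_iff_cyclic[OF \<eta> m[OF f(1)]] Ann by blast
    then show ?thesis using f(2) by (simp add: Ann_def)
  qed
  have R_coord: "R0 p (T j x) = S j (R0 p x)" if p: "p \<in> \<Lambda>" for p j x
  proof -
    obtain f where f: "f \<in> multipliers" "\<Phi>T (e p) x = \<Phi>T (m p f) \<xi>" using exT[OF p] by blast
    let ?g = "\<lambda>z. DA_coord j z * f z"
    have g: "?g \<in> multipliers" by (intro multipliers_mult multipliers_coord f)
    have mg: "m p ?g = (\<lambda>z. DA_coord j z * m p f z)" by (simp add: m_def mult.assoc)
    have "\<Phi>T (e p) (T j x) = T j (\<Phi>T (e p) x)" using T.hom_commute[OF e multipliers_coord, of p j x] by (simp add: T.hom_coord)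
    also have "\<dots> = \<Phi>T (m p ?g) \<xi>" unfolding f(2) mg T.hom_mult[OF multipliers_coord m[OF f(1)]] T.hom_coord ..
    finally have "R0 p (T j x) = \<Phi>S (m p ?g) \<eta>" by (rule R0(2)[OF p g])
    also have "\<dots> = S j (\<Phi>S (m p f) \<eta>)" unfolding mg S.hom_mult[OF multipliers_coord m[OF f(1)]] S.hom_coord ..
    finally show ?thesis unfolding R0(2)[OF p f] .
  qed
  define idx where "idx = to_nat_on \<Lambda>"
  have inj: "inj_on idx \<Lambda>" using S.interp unfolding idx_def interpolating_def by (simp add: inj_on_to_nat_on)
  \<comment> \<open>Indices that enumerate no point, as happens for finite \<open>\<Lambda>\<close>,
    receive the zero operator.\<close>
  define R where "R n = (if n \<in> idx ` \<Lambda> then R0 (inv_into \<Lambda> idx n) else (\<lambda>_. 0))" for n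
  have Ridx: "R (idx p) = R0 p" if "p \<in> \<Lambda>" for p using that inj by (simp add: R_def)
  have Rcase: "(\<exists>p\<in>\<Lambda>. n = idx p \<and> R n = R0 p) \<or> (n \<notin> idx ` \<Lambda> \<and> R n = (\<lambda>_. 0))" for n
    using Ridx by (cases "n \<in> idx ` \<Lambda>") (auto simp: R_def)
  have z: "bounded_op (\<lambda>_::'h. 0::'k)"
    unfolding bounded_op_def by (auto simp: cscale_zero_right cnorm_zero intro!: exI[of _ 0])
  have "bounded_op (R n)" for n using Rcase[of n] R0(1) z by auto
  from weighted_op_series[of R, OF this] obtain c X where c: "\<And>n. c n \<noteq> 0" and X: "bounded_op X"
    and conv: "\<And>x. cconv (\<lambda>n. \<Sum>i<n. cscale (c i) (R i x)) (X x)" by blast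
  \<comment> \<open>The value of \<open>R0 q\<close> lies in the range of the idempotent at
    \<open>q\<close>, so only the summand at \<open>p\<close> survives.\<close>
  have proj: "\<Phi>S (e p) (X x) = cscale (c (idx p)) (R0 p x)" if p: "p \<in> \<Lambda>" for p x
  proof -
    note bp = S.bounded[OF e[of p]]
    have t: "\<Phi>S (e p) (cscale (c i) (R i x)) = (if i = idx p then cscale (c (idx p)) (R0 p x) else 0)" for i
    proof -
      consider q where "q \<in> \<Lambda>" "i = idx q" "R i = R0 q" | "i \<notin> idx ` \<Lambda>" "R i = (\<lambda>_. 0)" using Rcase[of i] by blast
      then show ?thesis
      proof cases
        case 1
        then show ?thesis using R_proj[OF 1(1), of p x] inj p
          by (auto simp: bounded_op_cscale[OF bp] cscale_zero_right inj_on_eq_iff[OF inj])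
      next
        case 2
        then show ?thesis using p by (auto simp: cscale_zero_right bounded_op_zero[OF bp])
      qed
    qed
    have "cconv (\<lambda>n. \<Phi>S (e p) (\<Sum>i<n. cscale (c i) (R i x))) (\<Phi>S (e p) (X x))"
      by (rule bounded_op_conv[OF bp conv])
    then have 1: "cconv (\<lambda>n. \<Sum>i<n. if i = idx p then cscale (c (idx p)) (R0 p x) else 0) (\<Phi>S (e p) (X x))"
      by (simp only: bounded_op_sum[OF bp] t)
    have "cconv (\<lambda>n. \<Sum>i<n. if i = idx p then cscale (c (idx p)) (R0 p x) else 0) (cscale (c (idx p)) (R0 p x))"
      unfolding cconv_def
      by (rule tendsto_eventually, rule eventually_sequentiallyI[of "Suc (idx p)"]) (simp add: cnorm_zero)
    then show ?thesis using 1 cconv_unique by blast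
  qed
  have "inj X"
  proof (rule injI)
    fix x y assume "X x = X y"
    then have 0: "X (x - y) = 0" using bounded_op_diff[OF X] by simp
    have "\<Phi>T (e p) (x - y) = 0" if p: "p \<in> \<Lambda>" for p
    proof (rule R_ker[OF p])
      have "cscale (c (idx p)) (R0 p (x - y)) = 0"
        using proj[OF p, of "x - y"] 0 bounded_op_zero[OF S.bounded[OF e[of p]]] by simp
      then have "cscale (1 / c (idx p)) (cscale (c (idx p)) (R0 p (x - y))) = 0" by (simp add: cscale_zero_right)
      then show "R0 p (x - y) = 0" using c[of "idx p"] by (simp add: cscale_cscale cscale_one)
    qed
    then have "cinner (\<Phi>T (T.unit_at p) (x - y)) (x - y) = 0" if "p \<in> \<Lambda>" for p
      using that by (simp add: eS cinner_zero_left)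
    then have "cinner (x - y) (x - y) = 0" by (rule T.unit_at_total)
    then show "x = y" by (simp add: cinner_eq_zero)
  qed
  moreover have "cdense (range X)"
  proof (rule cdense_if_orthogonal_trivial)
    show "csubspace (range X)" unfolding csubspace_def
    proof (intro conjI ballI allI)
      show "0 \<in> range X" using rangeI[of X 0] unfolding bounded_op_zero[OF X] .
      show "u + v \<in> range X" if "u \<in> range X" "v \<in> range X" for u v
        using that by (auto simp: bounded_op_add[OF X, symmetric])
      show "cscale a u \<in> range X" if "u \<in> range X" for a u
        using that by (auto simp: bounded_op_cscale[OF X, symmetric])
    qed
    fix y assume y: "\<And>w. w \<in> range X \<Longrightarrow> cinner w y = 0"
    \<comment> \<open>It suffices that every component of \<open>y\<close> at a point of
      \<open>\<Lambda>\<close> lies in the range of \<open>X\<close>, since \<open>y\<close> is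
      orthogonal to that range.\<close>
    have "cinner (\<Phi>S (e p) y) y = 0" if p: "p \<in> \<Lambda>" for p
    proof -
      obtain f where f: "f \<in> multipliers" "\<Phi>S (e p) y = \<Phi>S (m p f) \<eta>" using exS[OF p] by blast
      \<comment> \<open>The same multiplier applied to \<open>\<xi>\<close> gives a vector whose
        only non-zero component can be the one at \<open>p\<close>, so \<open>X x\<close> is a
        single summand: a non-zero multiple of \<open>\<Phi>S (e p) y\<close>.\<close>
      define x where "x = \<Phi>T (m p f) \<xi>"
      have Rp: "R0 p x = \<Phi>S (m p f) \<eta>" by (rule R0(2)[OF p f(1)]) (simp add: x_def eeT[OF p f(1)])
      have Rq: "R0 q x = 0" if q: "q \<in> \<Lambda>" "q \<noteq> p" for q
      proof -
        have "\<Phi>T (e q) x = \<Phi>T (m q (\<lambda>_. 0)) \<xi>" using eeT[OF p f(1), of q] q by (simp add: x_def m_def T.hom_zero)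
        from R0(2)[OF q(1) multipliers_zero this] show ?thesis by (simp add: m_def S.hom_zero)
      qed
      have t: "cscale (c i) (R i x) = (if i = idx p then cscale (c (idx p)) (R0 p x) else 0)" for i
      proof -
        consider q where "q \<in> \<Lambda>" "i = idx q" "R i = R0 q" | "i \<notin> idx ` \<Lambda>" "R i = (\<lambda>_. 0)" using Rcase[of i] by blast
        then show ?thesis
        proof cases
          case 1
          then show ?thesis using Rq[of q] inj_on_eq_iff[OF inj 1(1) p] by (cases "q = p") (auto simp: cscale_zero_right)
        next
          case 2
          then show ?thesis using p by (auto simp: cscale_zero_right)
        qed
      qed
      have "cconv (\<lambda>n. \<Sum>i<n. cscale (c i) (R i x)) (cscale (c (idx p)) (R0 p x))"
        unfolding cconv_def t
        by (rule tendsto_eventually, rule eventually_sequentiallyI[of "Suc (idx p)"]) (simp add: cnorm_zero)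
      then have "X x = cscale (c (idx p)) (\<Phi>S (e p) y)" using conv cconv_unique Rp f(2) by metis
      then have "c (idx p) * cinner (\<Phi>S (e p) y) y = 0" using y[OF rangeI[of X x]] by (simp add: cinner_cscale_left)
      then show ?thesis using c by simp
    qed
    then have "cinner (\<Phi>S (S.unit_at p) y) y = 0" if "p \<in> \<Lambda>" for p using that by (simp add: eS)
    then have "cinner y y = 0" by (rule S.unit_at_total)
    then show "y = 0" by (simp add: cinner_eq_zero)
  qed
  moreover have "X \<circ> T j = S j \<circ> X" for j
  proof
    fix x
    have bS: "bounded_op (S j)" using S.bounded[OF multipliers_coord[of j]] by (simp add: S.hom_coord)
    have "R i (T j x) = S j (R i x)" for i
      using Rcase[of i] R_coord bounded_op_zero[OF bS] by auto
    then have "cconv (\<lambda>n. S j (\<Sum>i<n. cscale (c i) (R i x))) (X (T j x))"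
      using conv[of "T j x"] by (simp add: bounded_op_sum[OF bS] bounded_op_cscale[OF bS])
    then show "(X \<circ> T j) x = (S j \<circ> X) x" using bounded_op_conv[OF bS conv[of x]] cconv_unique by fastforce
  qed
  ultimately show ?thesis using X by blast
qed

theorem theorem6p3:
  fixes S :: "'d::finite \<Rightarrow> 'k::chilbert \<Rightarrow> 'k"
    and T :: "'d \<Rightarrow> 'h::chilbert \<Rightarrow> 'h"
    and \<Phi>S :: "(complex^'d \<Rightarrow> complex) \<Rightarrow> 'k \<Rightarrow> 'k"
    and \<Phi>T :: "(complex^'d \<Rightarrow> complex) \<Rightarrow> 'h \<Rightarrow> 'h"
    and \<Lambda> :: "(complex^'d) set"
    and \<kappa> :: nat
  assumes "comm_row_contraction S" and "comm_row_contraction T"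
    and "abs_cont_hom S \<Phi>S" and "abs_cont_hom T \<Phi>T"
    and "cyclic_tuple S" and "cyclic_tuple T"
    and "interpolating \<Lambda>"
    and "vanish_ideal \<kappa> \<Lambda> \<subseteq> Ann \<Phi>S" and "Ann \<Phi>S = Ann \<Phi>T"
  shows "quasi_similar S T"
proof -
  have S: "annihilating_sequence S \<Phi>S \<Lambda> \<kappa>" and T: "annihilating_sequence T \<Phi>T \<Lambda> \<kappa>"
    using assms by (simp_all add: annihilating_sequence_def)
  show ?thesis unfolding quasi_similar_def
    using quasi_affinity[OF S T assms(9,5,6)] quasi_affinity[OF T S assms(9)[symmetric] assms(6,5)] by blast
qed

end
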